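(* Let $r\ge 2$ be an integer, let $j\in\{2,\dots,r-1\}$ and let $n_j\in\mathbb{N}_0=\{0,1,2,\dots\}$. Then, as an identity of meromorphic functions of the complex variables $s_1,\dots,s_{j-1},s_{j+1},\dots,s_r$, \begin{align*} &\zeta_r(s_1,\dots,s_{j-1},-n_j,s_{j+1},\dots,s_r)+\zeta_{r-1}(s_1,\dots,s_{j-1},s_{j+1}-n_j,s_{j+2},\dots,s_r)\\ &= -\frac{1}{n_j+1}\zeta_{r-1}(s_1,\dots,s_{j-2},s_{j-1}-n_j-1,s_{j+1},\dots,s_r) +\frac{1}{n_j+1}\zeta_{r-1}(s_1,\dots,s_{j-1},s_{j+1}-n_j-1,s_{j+2},\dots,s_r)\\ &\quad+\sum_{k=0}^{n_j}\binom{n_j}{k}\zeta_{r-1}(s_1,\dots,s_{j-2},s_{j-1}-n_j+k,s_{j+1},\dots,s_r)\zeta(-k)\\ &\quad-\sum_{k=0}^{n_j}\binom{n_j}{k}\zeta_{r-1}(s_1,\dots,s_{j-1},s_{j+1}-n_j+k,s_{j+2},\dots,s_r)\zeta(-k). \end{align*} (When $j=2$, the list $s_1,\dots,s_{j-2}$ is empty.)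
   Context: For a positive integer $r$, the Euler–Zagier multiple zeta function is $\zeta_r(s_1,\dots,s_r)=\sum_{0<m_1<m_2<\cdots<m_r} m_1^{-s_1}m_2^{-s_2}\cdots m_r^{-s_r}$, which converges absolutely when $\mathrm{Re}(s_r)>1$, $\mathrm{Re}(s_{r-1}+s_r)>2,\dots,\mathrm{Re}(s_1+\cdots+s_r)>r$, and is continued meromorphically to $\mathbb{C}^r$; all occurrences of $\zeta_r$ denote this continuation. $\zeta=\zeta_1$ is the Riemann zeta function. *)

theory Defs
  imports "HOL-Analysis.Analysis"
begin

text \<open>
  Points of \<open>\<complex>\<^sup>I\<close>, for a finite set \<open>I\<close> of indices, are functions \<open>nat \<Rightarrow> complex\<close> vanishing
  outside \<open>I\<close>.  The topology is the one induced by the product topology on \<open>nat \<Rightarrow> complex\<close>,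
  which on this subspace is the usual topology of \<open>\<complex>\<^sup>I\<close>.  In particular \<open>\<complex>\<^sup>r\<close> is
  \<open>cspace {1..r}\<close>, with coordinates numbered from 1.
\<close>

definition cspace :: "nat set \<Rightarrow> (nat \<Rightarrow> complex) set" where
  "cspace I = {s. \<forall>i. i \<notin> I \<longrightarrow> s i = 0}"

text \<open>Holomorphic functions of several variables: continuous, and holomorphic in each variable.\<close>

definition holo_several :: "nat set \<Rightarrow> (nat \<Rightarrow> complex) set \<Rightarrow> ((nat \<Rightarrow> complex) \<Rightarrow> complex) \<Rightarrow> bool" where
  "holo_several I U f \<longleftrightarrow>
     openin (top_of_set (cspace I)) U \<and> continuous_on U f \<and>
     (\<forall>s\<in>U. \<forall>i\<in>I. (\<lambda>z. f (s(i := z))) field_differentiable at (s i))"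

text \<open>
  Meromorphic functions on \<open>\<complex>\<^sup>I\<close>: locally a quotient \<open>g / h\<close> of holomorphic functions, where \<open>h\<close>
  does not vanish identically on any nonempty open set.  The values at the zeros of the local
  denominators are irrelevant.
\<close>

definition mero_several :: "nat set \<Rightarrow> ((nat \<Rightarrow> complex) \<Rightarrow> complex) \<Rightarrow> bool" where
  "mero_several I f \<longleftrightarrow>
     (\<forall>p\<in>cspace I. \<exists>V g h. p \<in> V \<and> holo_several I V g \<and> holo_several I V h \<and>
        V \<subseteq> closure {s\<in>V. h s \<noteq> 0} \<and>
        (\<forall>s\<in>V. h s \<noteq> 0 \<longrightarrow> f s = g s / h s))"

text \<open>
  The identity \<open>F = G\<close> of meromorphic functions on \<open>\<complex>\<^sup>I\<close>, where \<open>D\<close> is the set of points at which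
  all the terms occurring in \<open>F\<close> and \<open>G\<close> are defined; \<open>D\<close> has to be open and dense.
\<close>

definition mero_identity ::
  "nat set \<Rightarrow> (nat \<Rightarrow> complex) set \<Rightarrow> ((nat \<Rightarrow> complex) \<Rightarrow> complex) \<Rightarrow> ((nat \<Rightarrow> complex) \<Rightarrow> complex) \<Rightarrow> bool"
where
  "mero_identity I D F G \<longleftrightarrow>
     mero_several I F \<and> mero_several I G \<and>
     openin (top_of_set (cspace I)) D \<and> cspace I \<subseteq> closure D \<and>
     (\<forall>s\<in>D. F s = G s)"

definition mzeta_region :: "nat \<Rightarrow> (nat \<Rightarrow> complex) set" where
  "mzeta_region r =
     {s \<in> cspace {1..r}. \<forall>k\<in>{1..r}. Re (\<Sum>i=k..r. s i) > real (r - k + 1)}"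

definition mzeta_series :: "nat \<Rightarrow> (nat \<Rightarrow> complex) \<Rightarrow> complex" where
  "mzeta_series r s =
     (\<Sum>\<^sub>\<infinity>m \<in> {m \<in> {1..r} \<rightarrow>\<^sub>E {0<..}. strict_mono_on {1..r} m}.
        \<Prod>i=1..r. complex_of_real (real (m i)) powr (- s i))"

definition mzeta_continuation :: "nat \<Rightarrow> ((nat \<Rightarrow> complex) \<Rightarrow> complex) \<Rightarrow> bool" where
  "mzeta_continuation r f \<longleftrightarrow>
     mero_several {1..r} f \<and> (\<forall>s\<in>mzeta_region r. f s = mzeta_series r s)"

text \<open>
  The continuation \<open>\<zeta>\<^sub>r\<close> is regular at \<open>s\<close>, with value \<open>v\<close>, if some function representing it is
  holomorphic near \<open>s\<close> and takes the value \<open>v\<close> there.  Representatives differ only on nowhere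
  dense sets, so \<open>v\<close> is unique, and removable singularities count as regular points.
\<close>

definition mzeta_value :: "nat \<Rightarrow> (nat \<Rightarrow> complex) \<Rightarrow> complex \<Rightarrow> bool" where
  "mzeta_value r s v \<longleftrightarrow>
     (\<exists>f U. mzeta_continuation r f \<and> holo_several {1..r} U f \<and> s \<in> U \<and> f s = v)"

definition mzeta_regular :: "nat \<Rightarrow> (nat \<Rightarrow> complex) \<Rightarrow> bool" where
  "mzeta_regular r s \<longleftrightarrow> (\<exists>v. mzeta_value r s v)"

definition mzeta :: "nat \<Rightarrow> (nat \<Rightarrow> complex) \<Rightarrow> complex" where
  "mzeta r s = (THE v. mzeta_value r s v)"

definition vec1 :: "complex \<Rightarrow> nat \<Rightarrow> complex" where
  "vec1 z = (\<lambda>_. 0)(1 := z)"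

text \<open>\<open>(s\<^sub>1, \<dots>, s\<^sub>r) \<mapsto> (s\<^sub>1, \<dots>, s\<^sub>j\<^sub>-\<^sub>1, s\<^sub>j\<^sub>+\<^sub>1, \<dots>, s\<^sub>r)\<close>, renumbered.\<close>

definition omit :: "nat \<Rightarrow> (nat \<Rightarrow> complex) \<Rightarrow> nat \<Rightarrow> complex" where
  "omit j s = (\<lambda>i. if i < j then s i else s (i + 1))"

end

(*
  Abel summation shows that in the region of convergence the series is dominated by a product of
  convergent one-variable series.  Summing over the last index the Taylor expansion of
  (m - 1) powr (1 - s) around m, the left-hand side telescopes, which gives

    (s_r - 1) zeta_r(s) = zeta_(r-1)(s_1, ..., s_(r-2), s_(r-1) + s_r - 1)
      - (sum k = 2..K. (s_r - 1)_k / k! zeta_r(s_1, ..., s_(r-1), s_r + k - 1)) - remainder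

  where the remainder converges K units further to the left.  Iterating, zeta_r times s_r - 1 times
  a product of reciprocal Gamma factors in the tails s_k + ... + s_r (k < r) is entire.  Every such
  factor involves s_r, so none vanishes identically on the hyperplane s_j = -n with j < r.
  For r = 1 and s = -n the remainder vanishes, which yields the Bernoulli-type recurrence for the
  values zeta(-k) and hence the power sums of m_j between m_(j-1) and m_(j+1).  This proves the
  identity where all the series converge, and the identity theorem extends it.
*)

theory Submission
  imports Defs "HOL-Complex_Analysis.Complex_Analysis"
begin

section \<open>Holomorphic functions of several variables\<close>

text \<open>The recursion produces possible poles along infinitely many hyperplanes, so a polynomial
  denominator cannot keep pace with it. Reciprocal Gamma factors can: raising \<open>s_r\<close> by
  \<open>n\<close> raises every tail by \<open>n\<close>, and
  \<open>rGamma z = pochhammer z n * rGamma (z + n)\<close> turns this into a polynomial cofactor.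
  One step of the same relation makes the factor of the tail \<open>s_(r-1) + s_r\<close> absorb the
  pole factor of the merged series. The coefficient \<open>(s_r - 1)_k\<close> contains the pole
  factor of the shifted series, so in the last variable only \<open>s_r = 1\<close> is left. Values
  at zeros of local denominators are arbitrary here, whereas the identity lives on the thin set
  \<open>s_j = -n\<close>. A global quotient whose denominator is nonzero at one point of that set
  restricts to a quotient again. Such a point exists in the region of convergence: every tail
  through \<open>s_j\<close> reaches \<open>s_r\<close>, and a large \<open>s_r\<close> outweighs
  \<open>-n\<close>. The second term on the left is the endpoint \<open>m_(j+1)\<close> of the power
  sum. With it the interval becomes half-open, and the sum is a difference of two values of one
  polynomial with coefficients built from the zeta(-k).\<close>

definition polybox :: "nat set \<Rightarrow> (nat \<Rightarrow> complex set) \<Rightarrow> (nat \<Rightarrow> complex) set" where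
  "polybox I B = {s \<in> cspace I. \<forall>i\<in>I. s i \<in> B i}"

lemma cspace_upd [simp]: "i \<in> I \<Longrightarrow> s \<in> cspace I \<Longrightarrow> s(i := z) \<in> cspace I"
  by (auto simp: cspace_def)

lemma continuous_on_coordinate: "continuous_on U (\<lambda>s :: nat \<Rightarrow> complex. s i)"
  by (rule continuous_on_subset[OF continuous_on_product_coordinates subset_UNIV])

lemma continuous_on_fun_upd: "continuous_on A (\<lambda>z. (s :: nat \<Rightarrow> complex)(i := z))"
proof (rule continuous_on_coordinatewise_then_product)
  fix k show "continuous_on A (\<lambda>z. (s(i := z)) k)" by (cases "k = i") auto
qed

lemma openin_polybox:
  assumes "finite I" "\<And>i. i \<in> I \<Longrightarrow> open (B i)"
  shows "openin (top_of_set (cspace I)) (polybox I B)"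
proof -
  have "polybox I B = cspace I \<inter> {f. \<forall>i\<in>I. f (id i) \<in> B i}"
    by (auto simp: polybox_def)
  then show ?thesis
    using product_topology_basis'[of I B id] assms by (auto intro: openin_open_Int)
qed

text \<open>Coordinates outside \<open>I\<close> are pinned to 0, so only the finitely many radii
  for \<open>i \<in> I\<close> matter, and their minimum serves all of them.\<close>

lemma openin_cspace_polybox:
  assumes "finite I" "openin (top_of_set (cspace I)) U" "p \<in> U"
  obtains e where "e > 0" "polybox I (\<lambda>i. ball (p i) e) \<subseteq> U"
proof -
  obtain V where V: "open V" "U = cspace I \<inter> V"
    using assms(2) by (auto simp: openin_open)
  have "openin (product_topology (\<lambda>i. euclidean) UNIV) V" "p \<in> V"
    using V assms(3) by (auto simp: open_fun_def)
  from product_topology_open_contains_basis[OF this]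
  obtain X where X: "p \<in> (\<Pi>\<^sub>E i\<in>UNIV. X i)" "\<And>i. open (X i)" "(\<Pi>\<^sub>E i\<in>UNIV. X i) \<subseteq> V"
    by auto
  have "\<exists>e>0. ball (p i) e \<subseteq> X i" for i
    using X(1,2) open_contains_ball[of "X i"] by (auto simp: PiE_iff)
  then obtain d where d: "\<And>i. d i > 0" "\<And>i. ball (p i) (d i) \<subseteq> X i"
    by metis
  \<comment> \<open>The inserted 1 keeps the minimum meaningful for empty \<open>I\<close>.\<close>
  define e where "e = Min (insert 1 (d ` I))"
  have e: "e > 0" "\<And>i. i \<in> I \<Longrightarrow> e \<le> d i"
    using assms(1) d by (auto simp: e_def)
  show ?thesis
  proof (rule that[OF e(1)], rule subsetI)
    fix s assume s: "s \<in> polybox I (\<lambda>i. ball (p i) e)"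
    have "s i \<in> X i" for i
    proof (cases "i \<in> I")
      case True
      then have "s i \<in> ball (p i) (d i)"
        using s e(2)[of i] by (auto simp: polybox_def)
      then show ?thesis using d(2) by blast
    next
      case False
      then have "s i = p i"
        using s assms(3) V by (auto simp: polybox_def cspace_def)
      then show ?thesis using X(1) by (auto simp: PiE_iff)
    qed
    then have "s \<in> V" using X(3) by (auto simp: PiE_iff)
    then show "s \<in> U" using s V by (auto simp: polybox_def)
  qed
qed

text \<open>It is the image of the full product space under the continuous map that zeroes the
  coordinates outside \<open>I\<close>.\<close>

lemma connected_cspace: "connected (cspace I)"
proof -
  have "connected (UNIV :: (nat \<Rightarrow> complex) set)"
  proof -
    have "connected_space (product_topology (\<lambda>i::nat. euclidean :: complex topology) UNIV)"
      using connectedin_iff_connected[of "UNIV :: complex set"] connected_UNIV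
      by (simp add: connected_space_product_topology connectedin_def)
    then have "connectedin (euclidean :: (nat \<Rightarrow> complex) topology) UNIV"
      by (simp add: euclidean_product_topology connectedin_def)
    then show ?thesis
      by (simp only: connectedin_iff_connected)
  qed
  moreover have "continuous_on UNIV (\<lambda>(s::nat\<Rightarrow>complex) i. if i \<in> I then s i else 0)"
  proof (rule continuous_on_coordinatewise_then_product)
    fix k show "continuous_on UNIV (\<lambda>s::nat\<Rightarrow>complex. if k \<in> I then s k else 0)"
      by (cases "k \<in> I") auto
  qed
  moreover have "(\<lambda>(s::nat\<Rightarrow>complex) i. if i \<in> I then s i else 0) ` UNIV = cspace I"
  proof (intro equalityI subsetI)
    fix s assume "s \<in> cspace I"
    then have "s = (\<lambda>i. if i \<in> I then s i else 0)"
      by (auto simp: cspace_def)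
    then show "s \<in> range (\<lambda>(s::nat\<Rightarrow>complex) i. if i \<in> I then s i else 0)"
      by (rule image_eqI[where x = s]) simp
  qed (auto simp: cspace_def)
  ultimately show ?thesis
    using connected_continuous_image[of UNIV "\<lambda>(s::nat\<Rightarrow>complex) i. if i \<in> I then s i else 0"] by simp
qed

lemma holo_severalD:
  assumes "holo_several I U f"
  shows "openin (top_of_set (cspace I)) U" "continuous_on U f" "U \<subseteq> cspace I"
    "\<And>s i. s \<in> U \<Longrightarrow> i \<in> I \<Longrightarrow> (\<lambda>z. f (s(i := z))) field_differentiable at (s i)"
  using assms openin_imp_subset by (auto simp: holo_several_def)

lemma open_slice:
  assumes "openin (top_of_set (cspace I)) U" "s \<in> cspace I" "i \<in> I"
  shows "open {z. s(i := z) \<in> U}"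
proof -
  obtain V where V: "open V" "U = cspace I \<inter> V"
    using assms(1) by (auto simp: openin_open)
  have "{z. s(i := z) \<in> U} = (\<lambda>z. s(i := z)) -` V"
    using V assms by auto
  then show ?thesis
    using continuous_on_fun_upd[of UNIV s i] V(1) by (simp add: open_vimage)
qed

lemma holo_several_cong:
  assumes "holo_several I U f" "\<And>s. s \<in> U \<Longrightarrow> f s = g s"
  shows "holo_several I U g"
  unfolding holo_several_def
proof (intro conjI ballI)
  note h = holo_severalD[OF assms(1)]
  show "openin (top_of_set (cspace I)) U" by (rule h)
  show "continuous_on U g" using h(2) assms(2) by (simp cong: continuous_on_cong)
  fix s i assume si: "s \<in> U" "i \<in> I"
  obtain d where d: "((\<lambda>z. f (s(i := z))) has_field_derivative d) (at (s i))"
    using h(4)[OF si] by (auto simp: field_differentiable_def)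
  have "((\<lambda>z. g (s(i := z))) has_field_derivative d) (at (s i))"
    by (rule has_field_derivative_transform_within_open[OF d open_slice[OF h(1) _ si(2), of s]])
       (use h(3) si assms(2) in auto)
  then show "(\<lambda>z. g (s(i := z))) field_differentiable at (s i)"
    by (auto simp: field_differentiable_def)
qed

lemma holo_several_subset:
  assumes "holo_several I U f" "openin (top_of_set (cspace I)) V" "V \<subseteq> U"
  shows "holo_several I V f"
  using assms by (auto simp: holo_several_def intro: continuous_on_subset)

lemma holo_several_local:
  assumes "\<And>p. p \<in> U \<Longrightarrow> \<exists>V. p \<in> V \<and> V \<subseteq> U \<and> holo_several I V f"
  shows "holo_several I U f"
  unfolding holo_several_def
proof (intro conjI ballI)
  show op: "openin (top_of_set (cspace I)) U"
    by (subst openin_subopen) (meson assms holo_severalD(1))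
  obtain V where V: "\<And>p. p \<in> U \<Longrightarrow> p \<in> V p \<and> V p \<subseteq> U \<and> holo_several I (V p) f"
    using assms by metis
  show "continuous_on U f"
    unfolding continuous_on_eq_continuous_within
  proof
    fix p assume p: "p \<in> U"
    obtain T where T: "open T" "V p = cspace I \<inter> T"
      using holo_severalD(1)[of I "V p" f] V[OF p] by (auto simp: openin_open)
    have "at p within U = at p within V p"
      by (rule at_within_nhd[of p T]) (use T V[OF p] openin_imp_subset[OF op] p in auto)
    then show "continuous (at p within U) f"
      using holo_severalD(2)[of I "V p" f] V[OF p] by (auto simp: continuous_on_eq_continuous_within)
  qed
  fix s i assume "s \<in> U" "i \<in> I"
  then show "(\<lambda>z. f (s(i := z))) field_differentiable at (s i)"
    using V holo_severalD(4) by blast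
qed

lemma holo_several_const:
  assumes "openin (top_of_set (cspace I)) U" shows "holo_several I U (\<lambda>s. c)"
  using assms by (auto simp: holo_several_def)

lemma holo_several_coordinate:
  assumes "openin (top_of_set (cspace I)) U" shows "holo_several I U (\<lambda>s. s k)"
  unfolding holo_several_def
proof (intro conjI ballI)
  fix s i
  show "(\<lambda>z. (s(i := z)) k) field_differentiable at (s i)"
    by (cases "k = i") auto
qed (use assms continuous_on_coordinate in auto)

lemma holo_several_add:
  assumes "holo_several I U f" "holo_several I U g"
  shows "holo_several I U (\<lambda>s. f s + g s)"
  unfolding holo_several_def
proof (intro conjI ballI)
  show "continuous_on U (\<lambda>s. f s + g s)"
    using assms holo_severalD(2) by (intro continuous_on_add) auto
  fix s i assume si: "s \<in> U" "i \<in> I"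
  show "(\<lambda>z. f (s(i := z)) + g (s(i := z))) field_differentiable at (s i)"
    by (rule field_differentiable_add[OF holo_severalD(4)[OF assms(1) si] holo_severalD(4)[OF assms(2) si]])
qed (rule holo_severalD(1)[OF assms(1)])

lemma holo_several_diff:
  assumes "holo_several I U f" "holo_several I U g"
  shows "holo_several I U (\<lambda>s. f s - g s)"
  unfolding holo_several_def
proof (intro conjI ballI)
  show "continuous_on U (\<lambda>s. f s - g s)"
    using assms holo_severalD(2) by (intro continuous_on_diff) auto
  fix s i assume si: "s \<in> U" "i \<in> I"
  show "(\<lambda>z. f (s(i := z)) - g (s(i := z))) field_differentiable at (s i)"
    by (rule field_differentiable_diff[OF holo_severalD(4)[OF assms(1) si] holo_severalD(4)[OF assms(2) si]])
qed (rule holo_severalD(1)[OF assms(1)])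

lemma holo_several_mult:
  assumes "holo_several I U f" "holo_several I U g"
  shows "holo_several I U (\<lambda>s. f s * g s)"
  unfolding holo_several_def
proof (intro conjI ballI)
  show "continuous_on U (\<lambda>s. f s * g s)"
    using assms holo_severalD(2) by (intro continuous_on_mult) auto
  fix s i assume si: "s \<in> U" "i \<in> I"
  show "(\<lambda>z. f (s(i := z)) * g (s(i := z))) field_differentiable at (s i)"
    by (rule field_differentiable_mult[OF holo_severalD(4)[OF assms(1) si] holo_severalD(4)[OF assms(2) si]])
qed (rule holo_severalD(1)[OF assms(1)])

lemma holo_several_divide:
  assumes "holo_several I U f" "holo_several I U g" "\<And>s. s \<in> U \<Longrightarrow> g s \<noteq> 0"
  shows "holo_several I U (\<lambda>s. f s / g s)"
  unfolding holo_several_def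
proof (intro conjI ballI)
  show "continuous_on U (\<lambda>s. f s / g s)"
    using assms holo_severalD(2) by (intro continuous_on_divide) auto
  fix s i assume si: "s \<in> U" "i \<in> I"
  then show "(\<lambda>z. f (s(i := z)) / g (s(i := z))) field_differentiable at (s i)"
    using field_differentiable_divide[OF holo_severalD(4)[OF assms(1) si] holo_severalD(4)[OF assms(2) si]]
      assms(3)[OF si(1)] by simp
qed (rule holo_severalD(1)[OF assms(1)])

lemma holo_several_sum:
  assumes "openin (top_of_set (cspace I)) U" "\<And>a. a \<in> A \<Longrightarrow> holo_several I U (f a)"
  shows "holo_several I U (\<lambda>s. \<Sum>a\<in>A. f a s)"
  using assms(2)
  by (induction A rule: infinite_finite_induct)
     (auto intro: holo_several_add holo_several_const assms(1))

lemma holo_several_prod: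
  assumes "openin (top_of_set (cspace I)) U" "\<And>a. a \<in> A \<Longrightarrow> holo_several I U (f a)"
  shows "holo_several I U (\<lambda>s. \<Prod>a\<in>A. f a s)"
  using assms(2)
  by (induction A rule: infinite_finite_induct)
     (auto intro: holo_several_mult holo_several_const assms(1))

lemma holo_several_compose_entire:
  assumes "holo_several I U f" "g holomorphic_on UNIV"
  shows "holo_several I U (\<lambda>s. g (f s))"
  unfolding holo_several_def
proof (intro conjI ballI)
  show "openin (top_of_set (cspace I)) U" using assms holo_severalD by blast
  show "continuous_on U (\<lambda>s. g (f s))"
    using continuous_on_compose2[OF holomorphic_on_imp_continuous_on[OF assms(2)] holo_severalD(2)[OF assms(1)]]
    by auto
  fix s i assume si: "s \<in> U" "i \<in> I"
  have "g field_differentiable at (f (s(i := s i)))"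
    using assms(2) by (auto simp: holomorphic_on_def)
  from field_differentiable_compose[OF holo_severalD(4)[OF assms(1) si] this]
  show "(\<lambda>z. g (f (s(i := z)))) field_differentiable at (s i)"
    unfolding o_def .
qed

text \<open>Holomorphy is defined one variable at a time. Therefore \<open>\<phi>\<close> has to
  move a single target coordinate, affinely, whenever one source coordinate moves; the one-variable
  chain rule then applies.\<close>

lemma holo_several_subst:
  assumes f: "holo_several J V f" and U: "openin (top_of_set (cspace I)) U"
    and cont: "continuous_on U \<phi>" and sub: "\<And>s. s \<in> U \<Longrightarrow> \<phi> s \<in> V"
    and upd: "\<And>s i. s \<in> U \<Longrightarrow> i \<in> I \<Longrightarrow>
      \<exists>j\<in>J. \<exists>a. \<forall>z. \<phi> (s(i := z)) = (\<phi> s)(j := \<phi> s j + a * (z - s i))"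
  shows "holo_several I U (\<lambda>s. f (\<phi> s))"
  unfolding holo_several_def
proof (intro conjI ballI)
  show "continuous_on U (\<lambda>s. f (\<phi> s))"
    using continuous_on_compose2[OF holo_severalD(2)[OF f] cont] sub by auto
  fix s i assume si: "s \<in> U" "i \<in> I"
  obtain j a where ja: "j \<in> J" "\<And>z. \<phi> (s(i := z)) = (\<phi> s)(j := \<phi> s j + a * (z - s i))"
    using upd[OF si] by blast
  have d1: "(\<lambda>w. f ((\<phi> s)(j := w))) field_differentiable at (\<phi> s j + a * (s i - s i))"
    using holo_severalD(4)[OF f sub[OF si(1)] ja(1)] by simp
  have d2: "(\<lambda>z. \<phi> s j + a * (z - s i)) field_differentiable at (s i)"
    by (rule holomorphic_on_imp_differentiable_at[OF _ open_UNIV])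
       (auto intro!: holomorphic_intros)
  note field_differentiable_compose[OF d2 d1]
  then show "(\<lambda>z. f (\<phi> (s(i := z)))) field_differentiable at (s i)"
    by (simp only: o_def ja)
qed (rule U)

lemma holo_several_slice:
  assumes "holo_several I U f" "i \<in> I" "\<And>z. z \<in> A \<Longrightarrow> s(i := z) \<in> U"
  shows "(\<lambda>z. f (s(i := z))) holomorphic_on A"
  unfolding holomorphic_on_def
proof
  fix z assume "z \<in> A"
  from holo_severalD(4)[OF assms(1) assms(3)[OF this] assms(2)]
  have "(\<lambda>z. f (s(i := z))) field_differentiable at z" by simp
  then show "(\<lambda>z. f (s(i := z))) field_differentiable at z within A"
    by (rule field_differentiable_at_within)
qed

text \<open>Identity theorem, one coordinate at a time: \<open>f\<close> vanishes on a small box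
  inside \<open>E\<close>, and the one-variable theorem enlarges its factors from
  \<open>ball (p i) e\<close> to \<open>B i\<close> successively. The set \<open>J\<close> collects
  the coordinates already enlarged.\<close>

lemma holo_several_polybox_zero:
  assumes I: "finite I" and B: "\<And>i. i \<in> I \<Longrightarrow> open (B i)" "\<And>i. i \<in> I \<Longrightarrow> connected (B i)"
    and f: "holo_several I (polybox I B) f"
    and E: "openin (top_of_set (cspace I)) E" "E \<subseteq> polybox I B" "E \<noteq> {}" "\<And>s. s \<in> E \<Longrightarrow> f s = 0"
    and s: "s \<in> polybox I B"
  shows "f s = 0"
proof -
  obtain p where p: "p \<in> E" using E by auto
  obtain e where e: "e > 0" "polybox I (\<lambda>i. ball (p i) e) \<subseteq> E"
    using openin_cspace_polybox[OF I E(1) p] .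
  have pc: "p \<in> cspace I" using p E(2) by (auto simp: polybox_def)
  have bB: "ball (p i) e \<subseteq> B i" if "i \<in> I" for i
  proof
    fix z assume "z \<in> ball (p i) e"
    then have "p(i := z) \<in> polybox I (\<lambda>i. ball (p i) e)"
      using pc that e(1) by (auto simp: polybox_def)
    then have "p(i := z) \<in> polybox I B" using e(2) E(2) by blast
    then show "z \<in> B i" using that by (force simp: polybox_def)
  qed
  have "\<forall>s\<in>polybox I (\<lambda>i. if i \<in> J then B i else ball (p i) e). f s = 0" if "J \<subseteq> I" for J
    using finite_subset[OF that I] that
  proof (induction J rule: finite_induct)
    case empty
    then show ?case using e E by auto
  next
    case (insert k J)
    show ?case
    proof
      fix s assume s: "s \<in> polybox I (\<lambda>i. if i \<in> insert k J then B i else ball (p i) e)"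
      have k: "k \<in> I" using insert by auto
      have "f (s(k := s k)) = (0::complex)"
      proof (rule analytic_continuation_open[where f = "\<lambda>z. f (s(k := z))" and g = "\<lambda>_. 0"])
        show "open (ball (p k) e)" "open (B k)" "ball (p k) e \<noteq> {}" "connected (B k)"
          "ball (p k) e \<subseteq> B k" using B k e bB by auto
        show "(\<lambda>z. f (s(k := z))) holomorphic_on B k"
        proof (rule holo_several_slice[OF f k])
          fix z assume "z \<in> B k"
          then show "s(k := z) \<in> polybox I B"
            using s k bB by (fastforce simp: polybox_def split: if_splits)
        qed
        show "s k \<in> B k" using s k by (auto simp: polybox_def)
        show "(\<lambda>_. 0) holomorphic_on B k" by simp
        fix z assume "z \<in> ball (p k) e"
        then have "s(k := z) \<in> polybox I (\<lambda>i. if i \<in> J then B i else ball (p i) e)"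
          using s k insert.hyps by (auto simp: polybox_def)
        then show "f (s(k := z)) = 0" using insert by auto
      qed
      then show "f s = 0" by simp
    qed
  qed
  from this[of I] s show ?thesis by (auto simp: polybox_def)
qed

lemma polybox_UNIV: "polybox I (\<lambda>_. UNIV) = cspace I"
  by (auto simp: polybox_def)

lemma holo_several_cspace_zero:
  assumes "finite I" "holo_several I (cspace I) f"
    "openin (top_of_set (cspace I)) E" "E \<noteq> {}" "\<And>s. s \<in> E \<Longrightarrow> f s = 0" "s \<in> cspace I"
  shows "f s = 0"
proof (rule holo_several_polybox_zero[where B = "\<lambda>_. UNIV" and I = I and E = E and f = f and s = s])
  show "E \<subseteq> polybox I (\<lambda>_. UNIV)"
    using assms(3) openin_imp_subset by (auto simp: polybox_UNIV)
qed (use assms in \<open>auto simp: polybox_UNIV\<close>)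

lemma openin_nonzero:
  assumes "holo_several I U h" "openin (top_of_set (cspace I)) V" "V \<subseteq> U"
  shows "openin (top_of_set (cspace I)) {s \<in> V. h s \<noteq> 0}"
proof -
  have "continuous_on V h"
    by (rule continuous_on_subset[OF holo_severalD(2)[OF assms(1)] assms(3)])
  then have "openin (top_of_set V) (V \<inter> h -` (- {0}))"
    by (intro continuous_openin_preimage_gen) auto
  moreover have "V \<inter> h -` (- {0}) = {s \<in> V. h s \<noteq> 0}" by auto
  ultimately show ?thesis using assms(2) openin_trans by metis
qed


section \<open>Relative density, nonvanishing sets and quotients\<close>

lemma in_closure_openinD:
  assumes "x \<in> closure A" "A \<subseteq> S" "openin (top_of_set S) V" "x \<in> V"
  shows "\<exists>y\<in>A. y \<in> V"
proof -
  obtain T where T: "open T" "V = S \<inter> T" using assms by (auto simp: openin_open)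
  then have "A \<inter> T \<noteq> {}"
    using assms(1,4) unfolding closure_iff_nhds_not_empty by blast
  then show ?thesis using T assms by auto
qed

lemma in_closure_openinI:
  assumes "\<And>V. openin (top_of_set S) V \<Longrightarrow> x \<in> V \<Longrightarrow> \<exists>y\<in>A. y \<in> V" "x \<in> S"
  shows "x \<in> closure A"
  unfolding closure_iff_nhds_not_empty
proof (intro allI impI)
  fix B U assume B: "U \<subseteq> B" "open U" "x \<in> U"
  then have "openin (top_of_set S) (S \<inter> U)" "x \<in> S \<inter> U"
    using assms(2) by (auto intro: openin_open_Int)
  from assms(1)[OF this] show "A \<inter> B \<noteq> {}" using B by auto
qed

text \<open>Approach \<open>x\<close> by a point of \<open>A\<close>; as \<open>A\<close> is open,
  that point can in turn be approached by points of \<open>B\<close> without leaving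
  \<open>A\<close>.\<close>

lemma closure_Int_openin:
  assumes "openin (top_of_set S) V" "V \<subseteq> closure A" "V \<subseteq> closure B"
    "openin (top_of_set S) A" "B \<subseteq> S"
  shows "V \<subseteq> closure (A \<inter> B)"
proof
  fix x assume x: "x \<in> V"
  have sub: "V \<subseteq> S" "A \<subseteq> S" using assms openin_imp_subset by blast+
  show "x \<in> closure (A \<inter> B)"
  proof (rule in_closure_openinI[of S])
    fix W assume W: "openin (top_of_set S) W" "x \<in> W"
    have o: "openin (top_of_set S) (W \<inter> V)" using W assms by auto
    then obtain y where y: "y \<in> A" "y \<in> W \<inter> V"
      using in_closure_openinD[of x A S "W \<inter> V"] x W assms sub by auto
    have "openin (top_of_set S) (W \<inter> V \<inter> A)" using o assms by auto
    then obtain z where "z \<in> B" "z \<in> W \<inter> V \<inter> A"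
      using in_closure_openinD[of y B S "W \<inter> V \<inter> A"] y assms by blast
    then show "\<exists>y\<in>A \<inter> B. y \<in> W" by blast
  qed (use x sub in auto)
qed

text \<open>Otherwise \<open>h\<close> would vanish on a nonempty open set, hence everywhere by the
  identity theorem, including at \<open>p\<close>.\<close>

lemma holo_several_polybox_dense:
  assumes I: "finite I" and B: "\<And>i. i \<in> I \<Longrightarrow> open (B i)" "\<And>i. i \<in> I \<Longrightarrow> connected (B i)"
    and h: "holo_several I (polybox I B) h" and p: "p \<in> polybox I B" "h p \<noteq> 0"
  shows "polybox I B \<subseteq> closure {s \<in> polybox I B. h s \<noteq> 0}"
proof
  fix x assume x: "x \<in> polybox I B"
  show "x \<in> closure {s \<in> polybox I B. h s \<noteq> 0}"
  proof (rule in_closure_openinI[of "cspace I"])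
    fix V assume V: "openin (top_of_set (cspace I)) V" "x \<in> V"
    show "\<exists>y\<in>{s \<in> polybox I B. h s \<noteq> 0}. y \<in> V"
    proof (rule ccontr)
      assume "\<not> ?thesis"
      then have "h s = 0" if "s \<in> V \<inter> polybox I B" for s using that by auto
      moreover have "openin (top_of_set (cspace I)) (V \<inter> polybox I B)"
        using V openin_polybox[OF I B(1)] by auto
      ultimately have "h p = 0"
        using holo_several_polybox_zero[OF I B h, of "V \<inter> polybox I B" p] V x p by blast
      with p show False by simp
    qed
  qed (use x in \<open>auto simp: polybox_def\<close>)
qed

lemma holo_several_cspace_dense:
  assumes "finite I" "holo_several I (cspace I) h" "p \<in> cspace I" "h p \<noteq> 0"
  shows "cspace I \<subseteq> closure {s \<in> cspace I. h s \<noteq> 0}"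
  using holo_several_polybox_dense[of I "\<lambda>_. UNIV" h p] assms connected_UNIV by (simp add: polybox_UNIV)

lemma mero_several_quotient:
  assumes "finite I" "holo_several I (cspace I) g" "holo_several I (cspace I) h"
    "p \<in> cspace I" "h p \<noteq> 0" "\<And>s. s \<in> cspace I \<Longrightarrow> h s \<noteq> 0 \<Longrightarrow> f s = g s / h s"
  shows "mero_several I f"
  unfolding mero_several_def
proof
  fix q assume q: "q \<in> cspace I"
  show "\<exists>V g h. q \<in> V \<and> holo_several I V g \<and> holo_several I V h \<and>
    V \<subseteq> closure {s \<in> V. h s \<noteq> 0} \<and> (\<forall>s\<in>V. h s \<noteq> 0 \<longrightarrow> f s = g s / h s)"
    using holo_several_cspace_dense[OF assms(1,3,4,5)] assms q
    by (intro exI[of _ "cspace I"] exI[of _ g] exI[of _ h]) auto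
qed

lemma continuous_zero_closure:
  fixes f :: "'a::topological_space \<Rightarrow> complex"
  assumes "continuous_on V f" "D \<subseteq> V" "\<And>s. s \<in> D \<Longrightarrow> f s = 0" "x \<in> V" "x \<in> closure D"
  shows "f x = 0"
proof -
  have "closedin (top_of_set V) {x \<in> V. f x = 0}"
    using assms(1) continuous_closedin_preimage_constant[of V f 0] by simp
  then obtain T where T: "closed T" "{x \<in> V. f x = 0} = V \<inter> T"
    by (auto simp: closedin_closed)
  then have "closure D \<subseteq> T"
    by (intro closure_minimal) (use assms in auto)
  then show ?thesis using T assms by blast
qed

section \<open>Uniqueness of the continuation\<close>

text \<open>On a box around \<open>p\<close> both functions are quotients, and off the zeros of the
  denominators they agree exactly where the cross difference \<open>g h' - g' h\<close> vanishes.
  Dense agreement on any open set meeting the box forces this difference to vanish on the whole box.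
  Since \<open>B\<close> is fixed before \<open>V\<close>, the statement serves the clopen argument
  below.\<close>

lemma mero_several_agree_local:
  assumes I: "finite I" and f: "mero_several I f" "mero_several I f'" and p: "p \<in> cspace I"
  obtains B where "openin (top_of_set (cspace I)) B" "p \<in> B"
    "\<And>V q. openin (top_of_set (cspace I)) V \<Longrightarrow> q \<in> V \<Longrightarrow> q \<in> B \<Longrightarrow>
       V \<subseteq> closure {s \<in> V. f s = f' s} \<Longrightarrow> B \<subseteq> closure {s \<in> B. f s = f' s}"
proof -
  obtain V1 g h where V1: "p \<in> V1 \<and> holo_several I V1 g \<and> holo_several I V1 h \<and>
      V1 \<subseteq> closure {s \<in> V1. h s \<noteq> 0} \<and> (\<forall>s\<in>V1. h s \<noteq> 0 \<longrightarrow> f s = g s / h s)"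
    using bspec[OF f(1)[unfolded mero_several_def] p] by (elim exE) (rule that)
  then have V1: "p \<in> V1" "holo_several I V1 g" "holo_several I V1 h" "V1 \<subseteq> closure {s \<in> V1. h s \<noteq> 0}"
    "\<And>s. s \<in> V1 \<Longrightarrow> h s \<noteq> 0 \<Longrightarrow> f s = g s / h s" by blast+
  obtain V2 g' h' where V2: "p \<in> V2 \<and> holo_several I V2 g' \<and> holo_several I V2 h' \<and>
      V2 \<subseteq> closure {s \<in> V2. h' s \<noteq> 0} \<and> (\<forall>s\<in>V2. h' s \<noteq> 0 \<longrightarrow> f' s = g' s / h' s)"
    using bspec[OF f(2)[unfolded mero_several_def] p] by (elim exE) (rule that)
  then have V2: "p \<in> V2" "holo_several I V2 g'" "holo_several I V2 h'" "V2 \<subseteq> closure {s \<in> V2. h' s \<noteq> 0}"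
    "\<And>s. s \<in> V2 \<Longrightarrow> h' s \<noteq> 0 \<Longrightarrow> f' s = g' s / h' s" by blast+
  let ?T = "top_of_set (cspace I)"
  have op: "openin ?T V1" "openin ?T V2" using V1 V2 holo_severalD(1) by blast+
  then have op12: "openin ?T (V1 \<inter> V2)" by auto
  then obtain e where e: "e > 0" "polybox I (\<lambda>i. ball (p i) e) \<subseteq> V1 \<inter> V2"
    using openin_cspace_polybox[OF I op12, of p] V1(1) V2(1) by auto
  define B where "B = polybox I (\<lambda>i. ball (p i) e)"
  have B: "openin ?T B" "p \<in> B" "B \<subseteq> V1" "B \<subseteq> V2"
    using openin_polybox[OF I, of "\<lambda>i. ball (p i) e"] e p by (auto simp: B_def polybox_def)
  define N where "N = {s \<in> V1. h s \<noteq> 0} \<inter> {s \<in> V2. h' s \<noteq> 0}"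
  have opN: "openin ?T {s \<in> V1. h s \<noteq> 0}" "openin ?T {s \<in> V2. h' s \<noteq> 0}"
    using openin_nonzero[OF V1(3) op(1)] openin_nonzero[OF V2(3) op(2)] by auto
  have N: "openin ?T N" "N \<subseteq> cspace I" "B \<subseteq> closure N"
  proof -
    show oN: "openin ?T N" unfolding N_def using opN by (rule openin_Int)
    then show "N \<subseteq> cspace I" using openin_imp_subset by blast
    show "B \<subseteq> closure N" unfolding N_def
      by (rule closure_Int_openin[OF B(1) _ _ opN(1) openin_imp_subset[OF opN(2)]])
         (use V1(4) V2(4) B in auto)
  qed
  define k where "k = (\<lambda>s. g s * h' s - g' s * h s)"
  have k: "holo_several I (V1 \<inter> V2) k"
    unfolding k_def
    by (intro holo_several_diff holo_several_mult)
       (use holo_several_subset[OF _ op12] V1 V2 in auto)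
  have kN: "f s = f' s \<longleftrightarrow> k s = 0" if "s \<in> N" for s
    using that V1(5)[of s] V2(5)[of s] by (simp add: N_def k_def frac_eq_eq)
  show ?thesis
  proof (rule that[OF B(1,2)])
    fix V q assume V: "openin ?T V" "q \<in> V" "q \<in> B" "V \<subseteq> closure {s \<in> V. f s = f' s}"
    have oVB: "openin ?T (V \<inter> B)" using V B by auto
    have "V \<inter> B \<subseteq> closure (N \<inter> {s \<in> V. f s = f' s})"
      by (rule closure_Int_openin[OF oVB _ _ N(1)])
         (use V(4) N(3) openin_imp_subset[OF V(1)] in auto)
    then have kz: "k s = 0" if "s \<in> V \<inter> B" for s
      using continuous_zero_closure[OF holo_severalD(2)[OF k], of "N \<inter> {s \<in> V. f s = f' s}" s]
        that B kN by (auto simp: N_def)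
    have kB: "k s = 0" if "s \<in> B" for s
      by (rule holo_several_polybox_zero[of I "\<lambda>i. ball (p i) e" k "V \<inter> B" s])
         (use I oVB V kz that B holo_several_subset[OF k, of B] in \<open>auto simp: B_def\<close>)
    show "B \<subseteq> closure {s \<in> B. f s = f' s}"
    proof
      fix x assume x: "x \<in> B"
      show "x \<in> closure {s \<in> B. f s = f' s}"
      proof (rule in_closure_openinI[of "cspace I"])
        fix W assume W: "openin ?T W" "x \<in> W"
        have "openin ?T (W \<inter> B)" using W B by auto
        then obtain y where "y \<in> N" "y \<in> W \<inter> B"
          using in_closure_openinD[of x N "cspace I" "W \<inter> B"] N W x by blast
        then show "\<exists>y\<in>{s \<in> B. f s = f' s}. y \<in> W" using kN kB by blast
      qed (use x B(1) openin_imp_subset in blast)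
    qed
  qed
qed

text \<open>Representatives may differ on thin sets, so what propagates is agreement on a dense
  subset, not pointwise agreement. The set \<open>G\<close> of points with such a neighbourhood is
  clopen in a connected space. At \<open>p\<close> both functions are continuous, and dense
  agreement becomes equality.\<close>

theorem mero_several_unique:
  assumes I: "finite I" and f: "mero_several I f" "mero_several I f'"
    and W: "openin (top_of_set (cspace I)) W" "W \<noteq> {}" "\<And>s. s \<in> W \<Longrightarrow> f s = f' s"
    and U: "holo_several I U f" "holo_several I U' f'" "p \<in> U" "p \<in> U'"
  shows "f p = f' p"
proof -
  let ?T = "top_of_set (cspace I)"
  define G where "G = {p \<in> cspace I. \<exists>V. openin ?T V \<and> p \<in> V \<and> V \<subseteq> closure {s \<in> V. f s = f' s}}"
  have "openin ?T G"
  proof (subst openin_subopen, intro ballI)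
    fix p assume "p \<in> G"
    then obtain V where "openin ?T V" "p \<in> V" "V \<subseteq> closure {s \<in> V. f s = f' s}"
      by (auto simp: G_def)
    then show "\<exists>T. openin ?T T \<and> p \<in> T \<and> T \<subseteq> G"
      using openin_imp_subset unfolding G_def by blast
  qed
  moreover have "openin ?T (cspace I - G)"
  proof (subst openin_subopen, intro ballI)
    fix p assume p: "p \<in> cspace I - G"
    then obtain B where B: "openin ?T B" "p \<in> B"
      "\<And>V q. openin ?T V \<Longrightarrow> q \<in> V \<Longrightarrow> q \<in> B \<Longrightarrow>
         V \<subseteq> closure {s \<in> V. f s = f' s} \<Longrightarrow> B \<subseteq> closure {s \<in> B. f s = f' s}"
      using mero_several_agree_local[OF I f, of p] by blast
    have "q \<notin> G" if "q \<in> B" for q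
    proof
      assume "q \<in> G"
      then have "B \<subseteq> closure {s \<in> B. f s = f' s}"
        using B(3) that by (auto simp: G_def)
      then have "p \<in> G" using B p by (auto simp: G_def)
      then show False using p by simp
    qed
    then show "\<exists>T. openin ?T T \<and> p \<in> T \<and> T \<subseteq> cspace I - G"
      using B(1,2) openin_imp_subset by blast
  qed
  ultimately have "G = {} \<or> G = cspace I"
    using connected_cspace[of I] unfolding connected_clopen closedin_def by (auto simp: G_def)
  moreover have "W \<subseteq> G"
  proof
    fix w assume "w \<in> W"
    moreover have "{s \<in> W. f s = f' s} = W" using W(3) by auto
    ultimately show "w \<in> G"
      using W(1) openin_imp_subset[OF W(1)] closure_subset[of W]
      unfolding G_def by (auto intro!: exI[of _ W])
  qed
  moreover have pc: "p \<in> cspace I" using U holo_severalD(3) by blast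
  ultimately have "p \<in> G" using W(2) by auto
  then obtain V where V: "openin ?T V" "p \<in> V" "V \<subseteq> closure {s \<in> V. f s = f' s}"
    by (auto simp: G_def)
  have op: "openin ?T (U \<inter> U')" using U holo_severalD(1) by blast
  have d: "holo_several I (U \<inter> U') (\<lambda>s. f s - f' s)"
    by (intro holo_several_diff) (use holo_several_subset[OF _ op] U in auto)
  have "p \<in> closure ({s \<in> V. f s = f' s} \<inter> (U \<inter> U'))"
  proof (rule in_closure_openinI[of "cspace I"])
    fix X assume X: "openin ?T X" "p \<in> X"
    from X(1) have "openin ?T (X \<inter> (U \<inter> U'))" by (rule openin_Int[OF _ op])
    then obtain y where "y \<in> {s \<in> V. f s = f' s}" "y \<in> X \<inter> (U \<inter> U')"
      using in_closure_openinD[of p "{s \<in> V. f s = f' s}" "cspace I" "X \<inter> (U \<inter> U')"]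
        V X U openin_imp_subset[OF V(1)] by auto
    then show "\<exists>y\<in>{s \<in> V. f s = f' s} \<inter> (U \<inter> U'). y \<in> X" by auto
  qed (rule pc)
  then have "f p - f' p = 0"
    using continuous_zero_closure[OF holo_severalD(2)[OF d], of "{s \<in> V. f s = f' s} \<inter> (U \<inter> U')" p] U
    by auto
  then show ?thesis by simp
qed

section \<open>Domains of stepwise continuation, and values of the continuation\<close>

text \<open>The region of convergence with all its bounds lowered by \<open>A\<close>. The
  continuation gains one unit at a time, and these sets exhaust the whole space.\<close>

definition mzeta_strip :: "nat \<Rightarrow> nat \<Rightarrow> (nat \<Rightarrow> complex) set" where
  "mzeta_strip r A =
     {s \<in> cspace {1..r}. \<forall>k\<in>{1..r}. Re (\<Sum>i=k..r. s i) > real (r - k + 1) - real A}"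

lemma mzeta_strip_0: "mzeta_strip r 0 = mzeta_region r"
  by (simp add: mzeta_strip_def mzeta_region_def)

lemma mzeta_strip_mono: "A \<le> A' \<Longrightarrow> mzeta_strip r A \<subseteq> mzeta_strip r A'"
  by (force simp: mzeta_strip_def)

lemma openin_mzeta_strip: "openin (top_of_set (cspace {1..r})) (mzeta_strip r A)"
proof -
  have c: "continuous_on UNIV (\<lambda>s::nat\<Rightarrow>complex. Re (\<Sum>i=k..r. s i))" for k
    by (intro continuous_intros continuous_on_coordinate)
  have "open (\<Inter>k\<in>{1..r}. {s::nat\<Rightarrow>complex. real (r - k + 1) - real A < Re (\<Sum>i=k..r. s i)})"
    by (intro open_INT ballI open_Collect_less continuous_on_const c) auto
  moreover have "mzeta_strip r A = cspace {1..r} \<inter>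
      (\<Inter>k\<in>{1..r}. {s. real (r - k + 1) - real A < Re (\<Sum>i=k..r. s i)})"
    by (auto simp: mzeta_strip_def)
  ultimately show ?thesis by (simp only: openin_open_Int)
qed

lemma openin_mzeta_region: "openin (top_of_set (cspace {1..r})) (mzeta_region r)"
  using openin_mzeta_strip[of r 0] by (simp add: mzeta_strip_0)

lemma mzeta_regionI:
  assumes "s \<in> cspace {1..r}" "\<And>i. i \<in> {1..r} \<Longrightarrow> Re (s i) > 1"
  shows "s \<in> mzeta_region r"
  unfolding mzeta_region_def
proof (intro CollectI conjI ballI assms(1))
  fix k assume k: "k \<in> {1..r}"
  have "(\<Sum>i=k..r. 1) < (\<Sum>i=k..r. Re (s i))"
    by (rule sum_strict_mono) (use k assms(2) in auto)
  then show "real (r - k + 1) < Re (\<Sum>i=k..r. s i)" using k by (simp add: of_nat_diff)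
qed

lemma mzeta_region_nonempty: "mzeta_region r \<noteq> {}"
proof -
  have "(\<lambda>i. if i \<in> {1..r} then 2 else 0) \<in> mzeta_region r"
    by (rule mzeta_regionI) (auto simp: cspace_def)
  then show ?thesis by blast
qed

lemma mzeta_value_unique:
  assumes "mzeta_value r s v" "mzeta_value r s w"
  shows "v = w"
proof -
  obtain f U where f: "mzeta_continuation r f" "holo_several {1..r} U f" "s \<in> U" "f s = v"
    using assms(1) by (auto simp: mzeta_value_def)
  obtain f' U' where f': "mzeta_continuation r f'" "holo_several {1..r} U' f'" "s \<in> U'" "f' s = w"
    using assms(2) by (auto simp: mzeta_value_def)
  have "f s = f' s"
    by (rule mero_several_unique[OF _ _ _ openin_mzeta_region mzeta_region_nonempty _ f(2) f'(2) f(3) f'(3)])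
       (use f(1) f'(1) in \<open>auto simp: mzeta_continuation_def\<close>)
  then show ?thesis using f f' by simp
qed

lemma mzeta_eqI: "mzeta_value r s v \<Longrightarrow> mzeta r s = v"
  unfolding mzeta_def using mzeta_value_unique by blast

lemma mzeta_regular_local:
  assumes "mzeta_regular r s"
  obtains U where "s \<in> U" "\<And>t. t \<in> U \<Longrightarrow> mzeta_regular r t" "holo_several {1..r} U (mzeta r)"
proof -
  obtain f U where f: "mzeta_continuation r f" "holo_several {1..r} U f" "s \<in> U"
    using assms by (auto simp: mzeta_regular_def mzeta_value_def)
  have v: "mzeta_value r t (f t)" if "t \<in> U" for t
    unfolding mzeta_value_def using f that by blast
  show ?thesis
  proof (rule that[OF f(3)])
    show "mzeta_regular r t" if "t \<in> U" for t
      using v[OF that] by (auto simp: mzeta_regular_def)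
    show "holo_several {1..r} U (mzeta r)"
      by (rule holo_several_cong[OF f(2)]) (use mzeta_eqI[OF v] in auto)
  qed
qed

lemma holo_several_mzeta:
  "holo_several {1..r} {s. mzeta_regular r s} (mzeta r)"
proof (rule holo_several_local)
  fix p assume "p \<in> {s. mzeta_regular r s}"
  then obtain U where "p \<in> U" "\<And>t. t \<in> U \<Longrightarrow> mzeta_regular r t" "holo_several {1..r} U (mzeta r)"
    using mzeta_regular_local by blast
  then show "\<exists>V. p \<in> V \<and> V \<subseteq> {s. mzeta_regular r s} \<and> holo_several {1..r} V (mzeta r)"
    by blast
qed

text \<open>Reduces statements about \<open>mzeta\<close>, a description over all representatives,
  to one explicit entire numerator and denominator.\<close>

lemma mzeta_quotient:
  assumes F: "holo_several {1..r} (cspace {1..r}) F" and H: "holo_several {1..r} (cspace {1..r}) H"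
    and ser: "\<And>s. s \<in> mzeta_region r \<Longrightarrow> F s = H s * mzeta_series r s"
    and nz: "\<And>s. s \<in> mzeta_region r \<Longrightarrow> H s \<noteq> 0"
    and s: "s \<in> cspace {1..r}" "H s \<noteq> 0"
  shows "mzeta_regular r s" "mzeta r s = F s / H s"
proof -
  obtain p where p: "p \<in> mzeta_region r" using mzeta_region_nonempty by auto
  have "mero_several {1..r} (\<lambda>s. F s / H s)"
    by (rule mero_several_quotient[OF _ F H _ nz[OF p]]) (use p in \<open>auto simp: mzeta_region_def\<close>)
  then have "mzeta_continuation r (\<lambda>s. F s / H s)"
    using ser nz by (auto simp: mzeta_continuation_def)
  moreover have "holo_several {1..r} {s \<in> cspace {1..r}. H s \<noteq> 0} (\<lambda>s. F s / H s)"
  proof -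
    have o: "openin (top_of_set (cspace {1..r})) {s \<in> cspace {1..r}. H s \<noteq> 0}"
      by (rule openin_nonzero[OF H]) auto
    show ?thesis
      by (intro holo_several_divide holo_several_subset[OF F o] holo_several_subset[OF H o]) auto
  qed
  ultimately have "mzeta_value r s (F s / H s)"
    using s unfolding mzeta_value_def by blast
  then show "mzeta_regular r s" "mzeta r s = F s / H s"
    using mzeta_eqI by (auto simp: mzeta_regular_def)
qed

section \<open>Multiple sums\<close>

definition mztuples :: "nat \<Rightarrow> (nat \<Rightarrow> nat) set" where
  "mztuples r = {m \<in> {1..r} \<rightarrow>\<^sub>E {0<..}. strict_mono_on {1..r} m}"

lemma mztuplesD:
  assumes "m \<in> mztuples r" "i \<in> {1..r}"
  shows "0 < m i" "\<And>j. i < j \<Longrightarrow> j \<le> r \<Longrightarrow> m i < m j"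
  using assms by (auto simp: mztuples_def PiE_iff strict_mono_on_def)

lemma norm_of_nat_powr: "cmod (of_nat n powr z) = real n powr Re z"
  using norm_powr_real_powr[of "of_nat n" z] by simp

text \<open>Downward induction on \<open>k\<close>: the later tail is nonnegative, so replacing its
  weight \<open>L (Suc k)\<close> by the smaller \<open>L k\<close> only decreases the sum.\<close>

lemma abel_sum_ge:
  fixes \<beta> L :: "nat \<Rightarrow> real"
  assumes "1 \<le> r" "k \<le> r" "1 \<le> k" and L: "\<And>i. 1 \<le> i \<Longrightarrow> i < r \<Longrightarrow> L i \<le> L (Suc i)"
    and tail: "\<And>k. k \<in> {1..r} \<Longrightarrow> 0 \<le> (\<Sum>i=k..r. \<beta> i)"
  shows "L k * (\<Sum>i=k..r. \<beta> i) \<le> (\<Sum>i=k..r. \<beta> i * L i)"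
  using assms(2,3)
proof (induction k rule: inc_induct)
  case base
  then show ?case by (simp add: mult.commute)
next
  case (step k)
  have s: "(\<Sum>i=k..r. f i) = f k + (\<Sum>i=Suc k..r. f i)" for f :: "nat \<Rightarrow> real"
    using step by (simp add: sum.atLeast_Suc_atMost)
  have "L k * (\<Sum>i=Suc k..r. \<beta> i) \<le> L (Suc k) * (\<Sum>i=Suc k..r. \<beta> i)"
    using L[of k] tail[of "Suc k"] step by (intro mult_right_mono) auto
  then show ?case using step by (simp add: s algebra_simps)
qed

text \<open>Abel summation applied to the logarithms.\<close>

lemma prod_powr_tails_le:
  fixes \<sigma> :: "nat \<Rightarrow> real"
  assumes m: "m \<in> mztuples r" and tail: "\<And>k. k \<in> {1..r} \<Longrightarrow> real (r - k + 1) * c \<le> (\<Sum>i=k..r. \<sigma> i)"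
  shows "(\<Prod>i=1..r. real (m i) powr - \<sigma> i) \<le> (\<Prod>i=1..r. real (m i) powr - c)"
proof (cases "r = 0")
  case False
  define L where "L = (\<lambda>i. ln (real (m i)))"
  define \<beta> where "\<beta> = (\<lambda>i. \<sigma> i - c)"
  have pos: "real (m i) > 0" if "i \<in> {1..r}" for i
    using mztuplesD[OF m that] by simp
  have ct: "0 \<le> (\<Sum>i=k..r. \<beta> i)" if k: "k \<in> {1..r}" for k
    using tail[OF k] k by (simp add: \<beta>_def sum_subtractf Suc_diff_le)
  have "L 1 * (\<Sum>i=1..r. \<beta> i) \<le> (\<Sum>i=1..r. \<beta> i * L i)"
  proof (rule abel_sum_ge)
    fix i assume "1 \<le> i" "i < r"
    then show "L i \<le> L (Suc i)"
      using mztuplesD(1)[OF m, of i] mztuplesD(2)[OF m, of i "Suc i"] by (simp add: L_def)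
  qed (use False ct in auto)
  moreover have "0 \<le> L 1 * (\<Sum>i=1..r. \<beta> i)"
    using ct[of 1] pos[of 1] False by (intro mult_nonneg_nonneg) (auto simp: L_def)
  ultimately have "(\<Sum>i=1..r. - \<sigma> i * L i) \<le> (\<Sum>i=1..r. - c * L i)"
    by (simp add: \<beta>_def left_diff_distrib sum_subtractf sum_negf)
  moreover have "(\<Prod>i=1..r. real (m i) powr - e i) = exp (\<Sum>i=1..r. - e i * L i)" for e
    unfolding exp_sum[OF finite_atLeastAtMost]
    by (rule prod.cong[OF refl]) (use pos in \<open>force simp: powr_def L_def\<close>)
  ultimately show ?thesis by simp
qed auto

lemma summable_on_mztuples_powr:
  fixes \<sigma> :: "nat \<Rightarrow> real"
  assumes tail: "\<And>k. k \<in> {1..r} \<Longrightarrow> real (r - k + 1) < (\<Sum>i=k..r. \<sigma> i)"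
  shows "(\<lambda>m. \<Prod>i=1..r. real (m i) powr - \<sigma> i) summable_on mztuples r"
proof -
  \<comment> \<open>The smallest mean exponent over all tails, capped at 2 so that
    \<open>r = 0\<close> is covered. It exceeds 1, and by Abel summation it may replace every
    individual exponent.\<close>
  define d where "d = Min (insert 2 ((\<lambda>k. (\<Sum>i=k..r. \<sigma> i) / real (r - k + 1)) ` {1..r}))"
  have d1: "d > 1" unfolding d_def
    by (subst Min_gr_iff) (use tail in \<open>auto simp: field_simps of_nat_diff\<close>)
  have d2: "real (r - k + 1) * d \<le> (\<Sum>i=k..r. \<sigma> i)" if "k \<in> {1..r}" for k
  proof -
    have "d \<le> (\<Sum>i=k..r. \<sigma> i) / real (r - k + 1)"
      unfolding d_def by (rule Min_le) (use that in auto)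
    then show ?thesis by (simp add: field_simps)
  qed
  \<comment> \<open>With equal exponents, the sum over all tuples of positive integers is a product
    of one-variable series; the increasing tuples form a subset.\<close>
  have "(\<lambda>n. real n powr - d) summable_on {0<..}"
  proof -
    have "summable (\<lambda>n. norm (real n powr - d))"
      using d1 by (simp add: summable_real_powr_iff)
    from summable_on_subset_banach[OF norm_summable_imp_summable_on[OF this] subset_UNIV]
    show ?thesis .
  qed
  then have "Infinite_Sum.abs_summable_on (\<lambda>n. real n powr - d) {0<..}"
    by (rule summable_on_iff_abs_summable_on_real[THEN iffD1])
  then have "Infinite_Set_Sum.abs_summable_on (\<lambda>n. real n powr - d) {0<..}"
    by (simp only: abs_summable_equivalent)
  then have "Infinite_Set_Sum.abs_summable_on (\<lambda>m. \<Prod>i\<in>{1..r}. real (m i) powr - d) (PiE {1..r} (\<lambda>_. {0<..}))"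
    by (intro abs_summable_on_prod_PiE) auto
  then have "Infinite_Sum.abs_summable_on (\<lambda>m. \<Prod>i\<in>{1..r}. real (m i) powr - d) (PiE {1..r} (\<lambda>_. {0<..}))"
    by (simp only: abs_summable_equivalent)
  from abs_summable_summable[OF this]
  have "(\<lambda>m. \<Prod>i\<in>{1..r}. real (m i) powr - d) summable_on mztuples r"
    by (rule summable_on_subset_banach) (auto simp: mztuples_def)
  then show ?thesis
    by (rule summable_on_comparison_test)
       (use prod_powr_tails_le[OF _ d2] in \<open>auto intro: prod_nonneg\<close>)
qed

text \<open>The last variable carries a general weight \<open>\<phi>\<close> in place of \<open>m powr - s\<close>.\<close>

definition wterm :: "nat \<Rightarrow> (nat \<Rightarrow> complex \<Rightarrow> complex) \<Rightarrow> (nat \<Rightarrow> complex) \<Rightarrow> (nat \<Rightarrow> nat) \<Rightarrow> complex" where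
  "wterm r \<phi> s m = (\<Prod>i\<in>{1..<r}. of_nat (m i) powr (- s i)) * \<phi> (m r) (s r)"

definition wsum :: "nat \<Rightarrow> (nat \<Rightarrow> complex \<Rightarrow> complex) \<Rightarrow> (nat \<Rightarrow> complex) \<Rightarrow> complex" where
  "wsum r \<phi> s = (\<Sum>\<^sub>\<infinity>m\<in>mztuples r. wterm r \<phi> s m)"

text \<open>The constant depends on the bound \<open>R\<close> for \<open>z\<close> but not on
  \<open>n\<close>, which makes the majorants locally uniform in \<open>s\<close>. The number
  \<open>a\<close> is the distance by which the domain of convergence moves to the left.\<close>

definition weight_order :: "nat \<Rightarrow> (nat \<Rightarrow> complex \<Rightarrow> complex) \<Rightarrow> bool" where
  "weight_order a \<phi> \<longleftrightarrow> (\<forall>n\<ge>1. \<phi> n holomorphic_on UNIV) \<and>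
     (\<forall>R. \<exists>C. \<forall>n\<ge>1. \<forall>z. cmod z \<le> R \<longrightarrow> cmod (\<phi> n z) \<le> C * real n powr (- Re z - real a))"

lemma mzeta_series_eq_wsum:
  assumes "r \<ge> 1" shows "mzeta_series r s = wsum r (\<lambda>n z. of_nat n powr - z) s"
proof -
  have *: "(\<Prod>i=1..r. f i) = (\<Prod>i\<in>{1..<r}. f i) * f r" for f :: "nat \<Rightarrow> complex"
    using assms by (metis atLeastLessThanSuc_atLeastAtMost prod.atLeastLessThan_Suc)
  show ?thesis
    unfolding mzeta_series_def wsum_def wterm_def mztuples_def * by simp
qed

lemma weight_order_powr: "weight_order 0 (\<lambda>n z. of_nat n powr - z)"
  unfolding weight_order_def
proof (intro conjI allI impI)
  show "\<exists>C. \<forall>n\<ge>1. \<forall>z. cmod z \<le> R \<longrightarrow> cmod (of_nat n powr - z) \<le> C * real n powr (- Re z - real 0)" for R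
    by (rule exI[of _ 1]) (simp add: norm_of_nat_powr)
qed (auto intro!: holomorphic_intros)

lemma wterm_majorant:
  assumes "r \<ge> 1" "p \<in> mzeta_strip r a" "weight_order a \<phi>"
  obtains e M where "e > 0" "M summable_on mztuples r"
    "\<And>s m. m \<in> mztuples r \<Longrightarrow> (\<And>i. i \<in> {1..r} \<Longrightarrow> dist (p i) (s i) < e) \<Longrightarrow>
       cmod (wterm r \<phi> s m) \<le> M m"
proof -
  define gap where "gap = Min ((\<lambda>k. Re (\<Sum>i=k..r. p i) - (real (r - k + 1) - real a)) ` {1..r})"
  have gap: "gap > 0" unfolding gap_def
    by (subst Min_gr_iff) (use assms(1,2) in \<open>auto simp: mzeta_strip_def\<close>)
  have gap': "gap \<le> Re (\<Sum>i=k..r. p i) - (real (r - k + 1) - real a)" if "k \<in> {1..r}" for k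
    unfolding gap_def by (rule Min_le) (use that in auto)
  \<comment> \<open>A tail has at most \<open>r\<close> entries, so lowering every real part by
    \<open>e\<close> costs less than \<open>gap\<close>.\<close>
  define e where "e = gap / (real r + 1)"
  have e: "e > 0" using gap by (simp add: e_def)
  \<comment> \<open>The extra decay \<open>a\<close> is credited to the last index. That index lies
    in every tail, so all bounds are relaxed by \<open>a\<close> at once.\<close>
  define \<sigma> where "\<sigma> = (\<lambda>i. Re (p i) - e + (if i = r then real a else 0))"
  have tail: "real (r - k + 1) < (\<Sum>i=k..r. \<sigma> i)" if k: "k \<in> {1..r}" for k
  proof -
    have "(\<Sum>i=k..r. \<sigma> i) = Re (\<Sum>i=k..r. p i) - real (r - k + 1) * e + real a"
      using k by (simp add: \<sigma>_def sum.distrib sum_subtractf Suc_diff_le)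
    moreover have "real (r - k + 1) * e < gap"
    proof -
      have "real (r - k + 1) * e < (real r + 1) * e"
        using k e by (intro mult_strict_right_mono) auto
      also have "\<dots> = gap" by (simp add: e_def)
      finally show ?thesis .
    qed
    ultimately show ?thesis using gap'[OF k] by linarith
  qed
  obtain C where C: "\<And>n z. n \<ge> 1 \<Longrightarrow> cmod z \<le> cmod (p r) + e \<Longrightarrow>
      cmod (\<phi> n z) \<le> C * real n powr (- Re z - real a)"
    using assms(3) unfolding weight_order_def by blast
  define M where "M = (\<lambda>m. \<bar>C\<bar> * (\<Prod>i=1..r. real (m i) powr - \<sigma> i))"
  show ?thesis
  proof (rule that[OF e])
    show "M summable_on mztuples r"
      unfolding M_def by (intro summable_on_cmult_right summable_on_mztuples_powr tail)
  next
    fix s m assume m: "m \<in> mztuples r" and s: "\<And>i. i \<in> {1..r} \<Longrightarrow> dist (p i) (s i) < e"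
    have re: "Re (p i) - e \<le> Re (s i)" if "i \<in> {1..r}" for i
      using s[OF that] abs_Re_le_cmod[of "p i - s i"] by (auto simp: dist_norm)
    have mp: "m i \<ge> 1" if "i \<in> {1..r}" for i
      using mztuplesD(1)[OF m that] by linarith
    have "cmod (s r) \<le> cmod (p r) + e"
      using s[of r] assms(1) norm_triangle_ineq2[of "s r" "p r"]
      by (auto simp: dist_norm norm_minus_commute)
    then have "cmod (\<phi> (m r) (s r)) \<le> C * real (m r) powr (- Re (s r) - real a)"
      using C[of "m r" "s r"] mp[of r] assms(1) by auto
    also have "\<dots> \<le> \<bar>C\<bar> * real (m r) powr - \<sigma> r"
      using re[of r] mp[of r] assms(1)
      by (intro mult_mono) (auto simp: \<sigma>_def intro!: powr_mono)
    finally have phi: "cmod (\<phi> (m r) (s r)) \<le> \<bar>C\<bar> * real (m r) powr - \<sigma> r" .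
    have "cmod (\<Prod>i\<in>{1..<r}. of_nat (m i) powr (- s i)) \<le> (\<Prod>i\<in>{1..<r}. real (m i) powr - \<sigma> i)"
      unfolding prod_norm[symmetric]
    proof (rule prod_mono)
      fix i assume i: "i \<in> {1..<r}"
      then show "0 \<le> cmod (of_nat (m i) powr - s i) \<and>
          cmod (of_nat (m i) powr - s i) \<le> real (m i) powr - \<sigma> i"
        using re[of i] mp[of i] by (auto simp: norm_of_nat_powr \<sigma>_def intro!: powr_mono)
    qed
    then have "cmod (wterm r \<phi> s m) \<le>
        (\<Prod>i\<in>{1..<r}. real (m i) powr - \<sigma> i) * (\<bar>C\<bar> * real (m r) powr - \<sigma> r)"
      unfolding wterm_def norm_mult
      by (intro mult_mono phi prod_nonneg) auto
    also have "\<dots> = M m"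
    proof -
      have "(\<Prod>i=1..r. f i) = (\<Prod>i\<in>{1..<r}. f i) * f r" for f :: "nat \<Rightarrow> real"
        using assms by (metis atLeastLessThanSuc_atLeastAtMost prod.atLeastLessThan_Suc)
      then show ?thesis by (simp add: M_def)
    qed
    finally show "cmod (wterm r \<phi> s m) \<le> M m" .
  qed
qed

lemma wterm_summable:
  assumes "r \<ge> 1" "s \<in> mzeta_strip r a" "weight_order a \<phi>"
  shows "wterm r \<phi> s summable_on mztuples r"
proof -
  obtain e M where eM: "e > 0" "M summable_on mztuples r"
    "\<And>t m. m \<in> mztuples r \<Longrightarrow> (\<And>i. i \<in> {1..r} \<Longrightarrow> dist (s i) (t i) < e) \<Longrightarrow>
       cmod (wterm r \<phi> t m) \<le> M m"
    using wterm_majorant[OF assms] by blast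
  have "Infinite_Sum.abs_summable_on (wterm r \<phi> s) (mztuples r)"
    by (rule summable_on_comparison_test[OF eM(2)]) (use eM(1) eM(3)[of _ s] in auto)
  then show ?thesis by (rule abs_summable_summable)
qed

lemma holo_several_uniform_limit:
  assumes U: "openin (top_of_set (cspace I)) U" and F: "F \<noteq> bot"
    and f: "eventually (\<lambda>n. holo_several I U (f n)) F" and lim: "uniform_limit U f g F"
  shows "holo_several I U g"
  unfolding holo_several_def
proof (intro conjI ballI)
  show "continuous_on U g"
    by (rule uniform_limit_theorem[OF _ lim F])
       (use f holo_severalD(2) in \<open>auto elim!: eventually_mono\<close>)
  fix s i assume s: "s \<in> U" and i: "i \<in> I"
  have "open {z. s(i := z) \<in> U}"
    using open_slice[OF U _ i] s openin_imp_subset[OF U] by blast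
  then obtain d where d: "d > 0" "cball (s i) d \<subseteq> {z. s(i := z) \<in> U}"
    using s open_contains_cball[of "{z. s(i := z) \<in> U}"] by (metis fun_upd_triv mem_Collect_eq)
  have "uniform_limit (cball (s i) d) (\<lambda>n z. f n (s(i := z))) (\<lambda>z. g (s(i := z))) F"
    by (rule uniform_limit_compose'[OF lim]) (use d in auto)
  moreover have "eventually (\<lambda>n. continuous_on (cball (s i) d) (\<lambda>z. f n (s(i := z))) \<and>
      (\<lambda>z. f n (s(i := z))) holomorphic_on ball (s i) d) F"
    using f
  proof (rule eventually_mono)
    fix n assume n: "holo_several I U (f n)"
    have "(\<lambda>z. f n (s(i := z))) holomorphic_on cball (s i) d"
      by (rule holo_several_slice[OF n i]) (use d in auto)
    then show "continuous_on (cball (s i) d) (\<lambda>z. f n (s(i := z))) \<and>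
      (\<lambda>z. f n (s(i := z))) holomorphic_on ball (s i) d"
      using holomorphic_on_imp_continuous_on holomorphic_on_subset ball_subset_cball by metis
  qed
  ultimately have "(\<lambda>z. g (s(i := z))) holomorphic_on ball (s i) d"
    using holomorphic_uniform_limit[of "s i" d "\<lambda>n z. f n (s(i := z))" F "\<lambda>z. g (s(i := z))"] F by metis
  then show "(\<lambda>z. g (s(i := z))) field_differentiable at (s i)"
    using d(1) holomorphic_on_imp_differentiable_at by (metis centre_in_ball open_ball)
qed (rule U)

text \<open>The majorant is common to a whole polydisc around each point, so the M-test yields a
  uniform limit of finite sums of holomorphic terms.\<close>

lemma holo_several_wsum:
  assumes r: "r \<ge> 1" and \<phi>: "weight_order a \<phi>"
  shows "holo_several {1..r} (mzeta_strip r a) (wsum r \<phi>)"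
proof (rule holo_several_local)
  fix p assume p: "p \<in> mzeta_strip r a"
  obtain e M where eM: "e > 0" "M summable_on mztuples r"
    "\<And>s m. m \<in> mztuples r \<Longrightarrow> (\<And>i. i \<in> {1..r} \<Longrightarrow> dist (p i) (s i) < e) \<Longrightarrow>
       cmod (wterm r \<phi> s m) \<le> M m"
    using wterm_majorant[OF r p \<phi>] by blast
  define V where "V = mzeta_strip r a \<inter> polybox {1..r} (\<lambda>i. ball (p i) e)"
  have V: "openin (top_of_set (cspace {1..r})) V"
    unfolding V_def by (intro openin_Int openin_mzeta_strip openin_polybox) auto
  have h: "holo_several {1..r} V (\<lambda>s. wterm r \<phi> s m)" if m: "m \<in> mztuples r" for m
    unfolding wterm_def
  proof (intro holo_several_mult holo_several_prod V)
    fix i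
    show "holo_several {1..r} V (\<lambda>s. of_nat (m i) powr - s i)"
      by (rule holo_several_compose_entire[OF holo_several_coordinate[OF V]])
         (auto intro!: holomorphic_intros)
    have "m r \<ge> 1" using mztuplesD(1)[OF m, of r] r by auto
    then show "holo_several {1..r} V (\<lambda>s. \<phi> (m r) (s r))"
      using \<phi> by (intro holo_several_compose_entire[OF holo_several_coordinate[OF V]])
                   (auto simp: weight_order_def)
  qed
  have "uniform_limit V (\<lambda>X s. \<Sum>m\<in>X. wterm r \<phi> s m) (\<lambda>s. \<Sum>\<^sub>\<infinity>m\<in>mztuples r. wterm r \<phi> s m)
      (finite_subsets_at_top (mztuples r))"
    by (rule Weierstrass_m_test_general[OF _ eM(2)])
       (use eM(3) in \<open>auto simp: V_def polybox_def\<close>)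
  moreover have "eventually (\<lambda>X. holo_several {1..r} V (\<lambda>s. \<Sum>m\<in>X. wterm r \<phi> s m))
      (finite_subsets_at_top (mztuples r))"
    by (intro eventually_finite_subsets_at_top_weakI holo_several_sum V h) auto
  ultimately have "holo_several {1..r} V (wsum r \<phi>)"
    unfolding wsum_def[abs_def] by (intro holo_several_uniform_limit[OF V]) auto
  moreover have "p \<in> V" using p eM(1) by (auto simp: V_def polybox_def mzeta_strip_def)
  ultimately show "\<exists>V. p \<in> V \<and> V \<subseteq> mzeta_strip r a \<and> holo_several {1..r} V (wsum r \<phi>)"
    by (intro exI[of _ V]) (auto simp: V_def)
qed

section \<open>The Taylor remainder\<close>

text \<open>
  The Taylor remainder of \<open>(n - 1) powr (1 - z)\<close> around \<open>n\<close>.  Since \<open>0 powr w = 0\<close>, the case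
  \<open>n = 1\<close> needs no separate treatment in the telescoping sums below.
\<close>

definition taylor_rem :: "nat \<Rightarrow> nat \<Rightarrow> complex \<Rightarrow> complex" where
  "taylor_rem K n z = of_nat (n - 1) powr (1 - z)
     - (\<Sum>k\<le>K. pochhammer (z - 1) k / fact k * of_nat n powr (1 - z - of_nat k))"

lemma norm_pochhammer_le:
  assumes "cmod z \<le> R"
  shows "cmod (pochhammer (z - 1) k) \<le> (R + 1 + real k) ^ k"
proof -
  have "cmod (pochhammer (z - 1) k) = (\<Prod>i<k. cmod (z - 1 + of_nat i))"
    by (simp add: pochhammer_prod prod_norm lessThan_atLeast0)
  also have "\<dots> \<le> (\<Prod>i<k. R + 1 + real k)"
  proof (rule prod_mono)
    fix i assume "i \<in> {..<k}"
    moreover have "cmod (z - 1 + of_nat i) \<le> cmod z + 1 + real i"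
      using norm_triangle_ineq[of "z - 1" "of_nat i"] norm_triangle_ineq4[of z 1] by simp
    ultimately show "0 \<le> cmod (z - 1 + of_nat i) \<and> cmod (z - 1 + of_nat i) \<le> R + 1 + real k"
      using assms by auto
  qed
  finally show ?thesis by simp
qed

lemma holomorphic_taylor_rem: "taylor_rem K n holomorphic_on UNIV"
  unfolding taylor_rem_def by (intro holomorphic_intros) auto

text \<open>For \<open>n = 1\<close> the expansion would be evaluated at
  \<open>1 - 1 / n = 0\<close>, the branch point of the power; this case is bounded term by
  term.\<close>

lemma norm_taylor_rem_1_le:
  assumes "cmod z \<le> R"
  shows "cmod (taylor_rem K 1 z) \<le> (\<Sum>k\<le>K. (R + 1 + real k) ^ k)"
proof -
  have "taylor_rem K 1 z = - (\<Sum>k\<le>K. pochhammer (z - 1) k / fact k)"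
    by (simp add: taylor_rem_def)
  then have "cmod (taylor_rem K 1 z) \<le> (\<Sum>k\<le>K. cmod (pochhammer (z - 1) k / fact k))"
    using norm_sum[of _ "{..K}"] by (simp only: norm_minus_cancel)
  also have "\<dots> \<le> (\<Sum>k\<le>K. (R + 1 + real k) ^ k)"
  proof (rule sum_mono)
    fix k
    have "cmod (pochhammer (z - 1) k / fact k) \<le> cmod (pochhammer (z - 1) k) / 1"
      unfolding norm_divide by (rule divide_left_mono) (auto simp: norm_fact)
    then show "cmod (pochhammer (z - 1) k / fact k) \<le> (R + 1 + real k) ^ k"
      using norm_pochhammer_le[OF assms, of k] by simp
  qed
  finally show ?thesis .
qed

text \<open>After division by \<open>n powr (1 - z)\<close> this is the Taylor remainder of
  \<open>(1 - x) powr (1 - z)\<close> at 0, evaluated at \<open>x = 1 / n\<close>. Its factor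
  \<open>n powr - (K + 1)\<close> leaves the exponent \<open>- Re z - K\<close>.\<close>

lemma norm_taylor_rem_le:
  assumes z: "cmod z \<le> R" and n: "n \<ge> 2"
  shows "cmod (taylor_rem K n z) \<le>
    (R + 2 + real K) ^ Suc K * 2 powr (R + real K) / fact K * real n powr (- Re z - real K)"
proof -
  \<comment> \<open>\<open>f k\<close> is the \<open>k\<close>-th derivative of
    \<open>(1 - x) powr (1 - z)\<close>.\<close>
  define f where "f = (\<lambda>k (x::complex). pochhammer (z - 1) k * (1 - x) powr (1 - z - of_nat k))"
  \<comment> \<open>On this real segment \<open>1 - x\<close> stays at least 1/2, away from the
    branch cut. This is where \<open>n \<ge> 2\<close> enters and where the power of 2 in
    \<open>B\<close> comes from.\<close>
  define S where "S = complex_of_real ` {0..1/2}"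
  define B where "B = (R + 2 + real K) ^ Suc K * 2 powr (R + real K)"
  have R: "R \<ge> 0" using z norm_ge_zero order_trans by blast
  have "cmod (f 0 (1 / of_nat n) - (\<Sum>k\<le>K. f k 0 * (1 / of_nat n - 0) ^ k / fact k))
      \<le> B * cmod (1 / of_nat n - 0) ^ Suc K / fact K"
  proof (rule complex_Taylor)
    show "convex S" unfolding S_def
      by (intro convex_linear_image bounded_linear.linear bounded_linear_of_real) auto
    show "0 \<in> S" unfolding S_def by (rule image_eqI[of _ _ 0]) auto
    show "1 / of_nat n \<in> S" unfolding S_def
      by (rule image_eqI[of _ _ "1 / real n"]) (use n in \<open>auto simp: field_simps\<close>)
  next
    fix k x assume "x \<in> S"
    then obtain t where t: "x = of_real t" "0 \<le> t" "t \<le> 1/2" by (auto simp: S_def)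
    have "1 - x \<notin> \<real>\<^sub>\<le>\<^sub>0" using t by (auto simp: complex_nonpos_Reals_iff)
    then have "(f k has_field_derivative f (Suc k) x) (at x)"
      unfolding f_def
      by (auto intro!: derivative_eq_intros simp: pochhammer_Suc algebra_simps)
    then show "(f k has_field_derivative f (Suc k) x) (at x within S)"
      by (rule has_field_derivative_at_within)
  next
    fix x assume "x \<in> S"
    then obtain t where t: "x = of_real t" "0 \<le> t" "t \<le> 1/2" by (auto simp: S_def)
    have "cmod ((1 - x) powr (1 - z - of_nat (Suc K))) = (1 - t) powr Re (1 - z - of_nat (Suc K))"
      using norm_powr_real_powr[of "1 - x" "1 - z - of_nat (Suc K)"] t
      by (simp add: Reals_diff)
    also have "\<dots> = (1 - t) powr - (Re z + real K)" by simp
    also have "\<dots> \<le> (1 - t) powr - (R + real K)"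
      using t abs_Re_le_cmod[of z] z by (intro powr_mono') auto
    also have "\<dots> \<le> (1 / 2) powr - (R + real K)"
      using t R by (intro powr_mono2') auto
    also have "\<dots> = 2 powr (R + real K)"
      using powr_minus_divide[of 2 "- (R + real K)"] by (simp add: powr_divide add.commute)
    finally have 1: "cmod ((1 - x) powr (1 - z - of_nat (Suc K))) \<le> 2 powr (R + real K)" .
    have "cmod (pochhammer (z - 1) (Suc K)) \<le> (R + 2 + real K) ^ Suc K"
      using norm_pochhammer_le[OF z, of "Suc K"] by (simp add: algebra_simps)
    then show "cmod (f (Suc K) x) \<le> B"
      unfolding f_def B_def norm_mult using 1 R by (intro mult_mono) auto
  qed
  also have "\<dots> = B / fact K * real n powr - (real K + 1)"
  proof -
    have "real n powr - (real K + 1) = inverse (real n powr real (Suc K))"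
      by (simp only: powr_minus of_nat_Suc add.commute)
    also have "\<dots> = inverse (real n ^ Suc K)"
      using n by (subst powr_realpow) auto
    finally show ?thesis
      by (simp add: norm_divide norm_inverse power_inverse divide_inverse)
  qed
  finally have le: "cmod (f 0 (1 / of_nat n) - (\<Sum>k\<le>K. f k 0 * (1 / of_nat n) ^ k / fact k))
      \<le> B / fact K * real n powr - (real K + 1)" by simp
  have "of_nat (n - 1) powr (1 - z) = of_nat n powr (1 - z) * f 0 (1 / of_nat n)"
  proof -
    have "complex_of_nat (n - 1) = of_nat n * (1 - 1 / of_nat n)"
      using n by (simp add: of_nat_diff field_simps)
    also have "\<dots> powr (1 - z) = of_nat n powr (1 - z) * (1 - 1 / of_nat n) powr (1 - z)"
      by (rule powr_times_real_left) auto
    finally show ?thesis by (simp add: f_def)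
  qed
  moreover have "of_nat n powr (1 - z - of_nat k) = of_nat n powr (1 - z) * (1 / of_nat n) ^ k" for k
    using n by (simp add: powr_diff power_one_over)
  ultimately have "taylor_rem K n z = of_nat n powr (1 - z) *
      (f 0 (1 / of_nat n) - (\<Sum>k\<le>K. f k 0 * (1 / of_nat n) ^ k / fact k))"
    by (simp add: taylor_rem_def f_def right_diff_distrib sum_distrib_left mult_ac)
  then have "cmod (taylor_rem K n z) = real n powr Re (1 - z) *
      cmod (f 0 (1 / of_nat n) - (\<Sum>k\<le>K. f k 0 * (1 / of_nat n) ^ k / fact k))"
    by (simp only: norm_mult norm_of_nat_powr)
  also have "\<dots> \<le> real n powr Re (1 - z) * (B / fact K * real n powr - (real K + 1))"
    by (rule mult_left_mono[OF le]) simp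
  also have "\<dots> = B / fact K * real n powr (Re (1 - z) + - (real K + 1))"
    by (simp only: powr_add mult_ac)
  also have "Re (1 - z) + - (real K + 1) = - Re z - real K" by simp
  finally show ?thesis by (simp add: B_def)
qed

lemma weight_order_taylor_rem: "weight_order K (taylor_rem K)"
  unfolding weight_order_def
proof (intro conjI allI impI holomorphic_taylor_rem)
  fix R :: real
  define C1 where "C1 = (\<Sum>k\<le>K. (R + 1 + real k) ^ k)"
  define C2 where "C2 = (R + 2 + real K) ^ Suc K * 2 powr (R + real K) / fact K"
  have "cmod (taylor_rem K n z) \<le> max C1 C2 * real n powr (- Re z - real K)"
    if n: "n \<ge> 1" and z: "cmod z \<le> R" for n z
  proof (cases "n = 1")
    case True
    then show ?thesis using norm_taylor_rem_1_le[OF z, of K] by (simp add: C1_def)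
  next
    case False
    then have "cmod (taylor_rem K n z) \<le> C2 * real n powr (- Re z - real K)"
      using norm_taylor_rem_le[OF z, of n K] n by (simp add: C2_def)
    also have "\<dots> \<le> max C1 C2 * real n powr (- Re z - real K)"
      by (intro mult_right_mono) auto
    finally show ?thesis .
  qed
  then show "\<exists>C. \<forall>n\<ge>1. \<forall>z. cmod z \<le> R \<longrightarrow> cmod (taylor_rem K n z) \<le> C * real n powr (- Re z - real K)"
    by blast
qed

lemma taylor_rem_0:
  assumes "n \<ge> 1"
  shows "taylor_rem 0 n z = of_nat (n - 1) powr (1 - z) - of_nat n powr (1 - z)"
  by (simp add: taylor_rem_def)

text \<open>The exponents are arranged so that term \<open>k\<close> is a power with
  \<open>z\<close> raised by \<open>k - 1\<close>: inside the multiple sum it becomes the series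
  with last argument shifted by \<open>k - 1\<close>.\<close>

lemma taylor_rem_0_eq:
  "taylor_rem 0 n z = (\<Sum>k=1..K. pochhammer (z - 1) k / fact k * of_nat n powr (- (z + of_nat (k - 1))))
     + taylor_rem K n z"
proof -
  have "(\<Sum>k\<le>K. g k) = g 0 + (\<Sum>k=1..K. g k)" for g :: "nat \<Rightarrow> complex"
    by (simp add: atMost_atLeast0 sum.atLeast_Suc_atMost)
  moreover have "(\<Sum>k=1..K. pochhammer (z - 1) k / fact k * of_nat n powr (1 - z - of_nat k)) =
      (\<Sum>k=1..K. pochhammer (z - 1) k / fact k * of_nat n powr (- (z + of_nat (k - 1))))"
    by (intro sum.cong refl) (auto simp: of_nat_diff algebra_simps)
  ultimately show ?thesis by (simp add: taylor_rem_def)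
qed

lemma has_sum_taylor_rem_0:
  assumes z: "Re z > 1"
  shows "((\<lambda>x. taylor_rem 0 x z) has_sum of_nat M powr (1 - z)) {M<..}"
proof -
  define g where "g = (\<lambda>i. complex_of_nat (M + i) powr (1 - z))"
  have t: "taylor_rem 0 (M + 1 + i) z = g i - g (Suc i)" for i
    by (simp add: taylor_rem_0 g_def add_ac)
  have "filterlim (\<lambda>i. real (M + i)) at_top sequentially"
    using filterlim_tendsto_add_at_top[OF tendsto_const[of "real M"] filterlim_real_sequentially]
    by (simp only: of_nat_add)
  then have "(\<lambda>i. complex_of_real (real (M + i)) powr (1 - z)) \<longlonglongrightarrow> 0"
    by (rule tendsto_neg_powr_complex_of_real) (use z in simp)
  then have "g \<longlonglongrightarrow> 0" by (simp add: g_def)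
  then have "(\<lambda>i. g i - g (Suc i)) sums (g 0 - 0)" by (rule telescope_sums')
  \<comment> \<open>Convergence of the telescoping series is conditional so far;
    \<open>has_sum\<close> demands absolute convergence, which the order-0 bound supplies for
    \<open>Re z > 1\<close>.\<close>
  moreover have "summable (\<lambda>i. norm (g i - g (Suc i)))"
  proof -
    obtain C where C: "\<And>n w. n \<ge> 1 \<Longrightarrow> cmod w \<le> cmod z \<Longrightarrow>
        cmod (taylor_rem 0 n w) \<le> C * real n powr (- Re w - real 0)"
      using weight_order_taylor_rem[of 0] unfolding weight_order_def by blast
    have "summable (\<lambda>n. C * real n powr (- Re z))"
      using z by (intro summable_mult) (simp add: summable_real_powr_iff)
    then have "summable (\<lambda>i. C * real (i + (M + 1)) powr (- Re z))"
      by (rule summable_ignore_initial_segment)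
    then show ?thesis
      by (rule summable_comparison_test[rotated], intro exI[of _ 0] allI impI)
         (use C[of "M + 1 + _" z] in \<open>simp add: t[symmetric] add_ac\<close>)
  qed
  ultimately have "((\<lambda>i. g i - g (Suc i)) has_sum g 0) UNIV"
    using norm_summable_imp_has_sum by force
  then have "((\<lambda>i. taylor_rem 0 (M + 1 + i) z) has_sum g 0) UNIV"
    by (simp only: t)
  moreover have "((\<lambda>i. taylor_rem 0 (M + 1 + i) z) has_sum g 0) UNIV \<longleftrightarrow>
      ((\<lambda>x. taylor_rem 0 x z) has_sum g 0) {M<..}"
    by (rule has_sum_reindex_bij_witness[of _ "\<lambda>x. x - (M + 1)" "\<lambda>i. M + 1 + i"]) auto
  ultimately show ?thesis by (simp add: g_def)
qed

section \<open>The functional equation\<close>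

text \<open>The argument left after the last index has been summed out. Entry \<open>r\<close> is
  reset to 0 so that the result lies in \<open>cspace {1..r - 1}\<close>.\<close>

definition merge_last :: "nat \<Rightarrow> (nat \<Rightarrow> complex) \<Rightarrow> nat \<Rightarrow> complex" where
  "merge_last r s = s(r := 0, r - 1 := s (r - 1) + s r - 1)"

text \<open>For \<open>q = 0\<close> the number 0 stands in for the missing predecessor, so the last
  entry always runs over an unbounded interval above a given number.\<close>

lemma mztuples_Suc_iff:
  "m \<in> mztuples (Suc q) \<longleftrightarrow> restrict m {1..q} \<in> mztuples q \<and> m \<in> extensional {1..Suc q} \<and>
     (if q = 0 then 0 else m q) < m (Suc q)"
proof
  assume m: "m \<in> mztuples (Suc q)"
  have "restrict m {1..q} \<in> mztuples q" "m \<in> extensional {1..Suc q}"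
    using m by (auto simp: mztuples_def PiE_iff strict_mono_on_def)
  moreover have "(if q = 0 then 0 else m q) < m (Suc q)"
    using mztuplesD(1)[OF m, of "Suc q"] mztuplesD(2)[OF m, of q "Suc q"] by auto
  ultimately show "restrict m {1..q} \<in> mztuples q \<and> m \<in> extensional {1..Suc q} \<and>
     (if q = 0 then 0 else m q) < m (Suc q)" by blast
next
  assume m: "restrict m {1..q} \<in> mztuples q \<and> m \<in> extensional {1..Suc q} \<and>
     (if q = 0 then 0 else m q) < m (Suc q)"
  then have r: "restrict m {1..q} \<in> mztuples q" by blast
  have 1: "0 < m i" if "i \<in> {1..q}" for i
    using mztuplesD(1)[OF r that] that by simp
  have 2: "m i < m j" if "1 \<le> i" "i < j" "j \<le> q" for i j
    using mztuplesD(2)[OF r, of i j] that by simp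
  have 3: "m i < m (Suc q)" if "1 \<le> i" "i \<le> q" for i
    using 2[of i q] m that by (cases "i = q") (auto split: if_splits)
  show "m \<in> mztuples (Suc q)"
    unfolding mztuples_def
  proof (intro CollectI conjI strict_mono_onI)
    show "m \<in> {1..Suc q} \<rightarrow>\<^sub>E {0<..}"
      using m 1 by (auto simp: PiE_iff le_Suc_eq)
    fix i j assume "i \<in> {1..Suc q}" "j \<in> {1..Suc q}" "i < j"
    then show "m i < m j" using 2[of i j] 3[of i] by (auto simp: le_Suc_eq)
  qed
qed

text \<open>For fixed earlier entries the sum over the last one telescopes to the preceding entry
  raised to \<open>1 - s r\<close>, which joins the power already there. For \<open>r = 1\<close>
  the predecessor is 0 and \<open>0 powr w = 0\<close>.\<close>

lemma wsum_telescope: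
  assumes r: "r \<ge> 1" and s: "s \<in> mzeta_region r"
  shows "wsum r (taylor_rem 0) s = (if r = 1 then 0 else mzeta_series (r - 1) (merge_last r s))"
proof -
  obtain q where q: "r = Suc q" using r by (cases r) auto
  define lastv where "lastv = (\<lambda>m. if q = 0 then 0 else m q :: nat)"
  define B where "B = (\<lambda>m. {lastv m<..})"
  define P where "P = (\<lambda>m. \<Prod>i\<in>{1..<Suc q}. complex_of_nat (m i) powr (- s i))"
  define h where "h = (\<lambda>(m, x). P m * taylor_rem 0 x (s (Suc q)))"
  define g where "g = (\<lambda>m. P m * of_nat (lastv m) powr (1 - s (Suc q)))"
  have re: "Re (s (Suc q)) > 1"
  proof -
    have "\<forall>k\<in>{1..r}. Re (\<Sum>i=k..r. s i) > real (r - k + 1)"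
      using s unfolding mzeta_region_def by blast
    from bspec[OF this, of r] show ?thesis using q by simp
  qed
  have "wterm r (taylor_rem 0) s summable_on mztuples r"
    using wterm_summable[of r s 0] weight_order_taylor_rem[of 0] r s by (simp add: mzeta_strip_0)
  then have "(wterm (Suc q) (taylor_rem 0) s has_sum wsum r (taylor_rem 0) s) (mztuples (Suc q))"
    unfolding wsum_def q by (rule has_sum_infsum)
  moreover have "(wterm (Suc q) (taylor_rem 0) s has_sum S) (mztuples (Suc q)) \<longleftrightarrow>
      (h has_sum S) (Sigma (mztuples q) B)" for S
  proof (rule has_sum_reindex_bij_witness[of _ "\<lambda>(m, x). m(Suc q := x)" "\<lambda>m. (restrict m {1..q}, m (Suc q))"])
    fix m assume m: "m \<in> mztuples (Suc q)"
    then have m': "restrict m {1..q} \<in> mztuples q" "m \<in> extensional {1..Suc q}"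
      "(if q = 0 then 0 else m q) < m (Suc q)" using mztuples_Suc_iff by blast+
    show "(case (restrict m {1..q}, m (Suc q)) of (m, x) \<Rightarrow> m(Suc q := x)) = m"
      using m'(2) by (auto simp: fun_eq_iff extensional_def)
    show "(restrict m {1..q}, m (Suc q)) \<in> Sigma (mztuples q) B"
      using m' by (auto simp: B_def lastv_def)
    show "h (restrict m {1..q}, m (Suc q)) = wterm (Suc q) (taylor_rem 0) s m"
      unfolding h_def wterm_def P_def by simp
  next
    fix b assume b: "b \<in> Sigma (mztuples q) B"
    obtain m x where mx: "b = (m, x)" "m \<in> mztuples q" "lastv m < x"
      using b by (auto simp: B_def)
    have e: "m \<in> extensional {1..q}" using mx(2) by (auto simp: mztuples_def PiE_iff)
    then have rr: "restrict (m(Suc q := x)) {1..q} = m"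
      by (auto simp: fun_eq_iff extensional_def)
    show "(restrict (case b of (m, x) \<Rightarrow> m(Suc q := x)) {1..q}, (case b of (m, x) \<Rightarrow> m(Suc q := x)) (Suc q)) = b"
      using rr by (simp add: mx)
    show "(case b of (m, x) \<Rightarrow> m(Suc q := x)) \<in> mztuples (Suc q)"
      unfolding mztuples_Suc_iff mx prod.case rr
      using mx e by (auto simp: lastv_def extensional_def)
  qed (rule refl)
  ultimately have "(h has_sum wsum r (taylor_rem 0) s) (Sigma (mztuples q) B)" by simp
  then have "(g has_sum wsum r (taylor_rem 0) s) (mztuples q)"
  proof (rule has_sum_SigmaD)
    fix m
    show "((\<lambda>x. h (m, x)) has_sum g m) (B m)"
      unfolding h_def g_def B_def prod.case by (intro has_sum_cmult_right has_sum_taylor_rem_0 re)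
  qed
  then have w: "wsum r (taylor_rem 0) s = infsum g (mztuples q)"
    by (rule infsumI[symmetric])
  show ?thesis
  proof (cases "q = 0")
    case True
    then have "g = (\<lambda>_. 0)" by (auto simp: g_def lastv_def)
    then show ?thesis using w True q by simp
  next
    case False
    have "g m = wterm q (\<lambda>n z. of_nat n powr - z) (merge_last r s) m" for m
    proof -
      have "P m = (\<Prod>i\<in>{1..<q}. complex_of_nat (m i) powr (- s i)) * of_nat (m q) powr (- s q)"
        using False by (simp add: P_def prod.atLeastLessThan_Suc)
      moreover have "of_nat (m q) powr (- s q) * of_nat (m q) powr (1 - s (Suc q)) =
          complex_of_nat (m q) powr (- (s q + s (Suc q) - 1))"
        by (simp add: powr_add[symmetric] algebra_simps)
      moreover have "(\<Prod>i\<in>{1..<q}. complex_of_nat (m i) powr (- merge_last r s i)) =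
          (\<Prod>i\<in>{1..<q}. complex_of_nat (m i) powr (- s i))"
        by (rule prod.cong) (auto simp: merge_last_def q)
      moreover have "merge_last r s q = s q + s (Suc q) - 1" by (simp add: merge_last_def q)
      ultimately show ?thesis
        using False by (simp add: g_def lastv_def wterm_def mult.assoc)
    qed
    then have "g = wterm q (\<lambda>n z. of_nat n powr - z) (merge_last r s)" by (rule ext)
    then have "infsum g (mztuples q) = mzeta_series q (merge_last r s)"
      using mzeta_series_eq_wsum[of q "merge_last r s"] False by (simp add: wsum_def)
    then show ?thesis using w False q by simp
  qed
qed

lemma sum_upd_last:
  fixes s :: "nat \<Rightarrow> complex"
  assumes "k \<le> r"
  shows "(\<Sum>i=k..r. (s(r := z)) i) = (\<Sum>i=k..<r. s i) + (z :: complex)"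
proof -
  have "(\<Sum>i=k..r. (s(r := z)) i) = (\<Sum>i=k..<r. (s(r := z)) i) + z"
    using sum.last_plus[OF assms, of "s(r := z)"] by simp
  moreover have "(\<Sum>i=k..<r. (s(r := z)) i) = (\<Sum>i=k..<r. s i)" by (rule sum.cong) auto
  ultimately show ?thesis by simp
qed

lemma sum_shift_last:
  fixes s :: "nat \<Rightarrow> complex"
  assumes "k \<le> r"
  shows "(\<Sum>i=k..r. (s(r := s r + z)) i) = (\<Sum>i=k..r. s i) + (z :: complex)"
  using sum_upd_last[OF assms, of s "s r"] sum_upd_last[OF assms, of s "s r + z"] by simp

lemma mzeta_strip_shift:
  assumes "s \<in> mzeta_strip r (A + a)" "r \<ge> 1" "a \<le> d"
  shows "s(r := s r + of_nat d) \<in> mzeta_strip r A"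
  unfolding mzeta_strip_def
proof (intro CollectI conjI ballI)
  show "s(r := s r + of_nat d) \<in> cspace {1..r}"
    using assms by (auto simp: mzeta_strip_def)
  fix k assume k: "k \<in> {1..r}"
  then have "Re (\<Sum>i=k..r. s i) > real (r - k + 1) - real (A + a)"
    using assms(1) unfolding mzeta_strip_def by blast
  then show "Re (\<Sum>i=k..r. (s(r := s r + of_nat d)) i) > real (r - k + 1) - real A"
    using k assms(3) by (subst sum_shift_last) auto
qed

lemma has_sum_finite_sum:
  fixes f :: "'a \<Rightarrow> 'b \<Rightarrow> 'c :: topological_comm_monoid_add"
  assumes "finite X" "\<And>k. k \<in> X \<Longrightarrow> (f k has_sum a k) A"
  shows "((\<lambda>m. \<Sum>k\<in>X. f k m) has_sum (\<Sum>k\<in>X. a k)) A"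
  using assms by (induction X rule: finite_induct) (simp_all add: has_sum_add has_sum_0)

lemma mzeta_functional_eq:
  assumes r: "r \<ge> 1" and s: "s \<in> mzeta_region r" and K: "K \<ge> 1"
  shows "(s r - 1) * mzeta_series r s =
    (if r = 1 then 0 else mzeta_series (r - 1) (merge_last r s))
    - (\<Sum>k=2..K. pochhammer (s r - 1) k / fact k * mzeta_series r (s(r := s r + of_nat (k - 1))))
    - wsum r (taylor_rem K) s"
proof -
  let ?\<phi> = "\<lambda>n z. complex_of_nat n powr - z"
  have in_strip: "s \<in> mzeta_strip r a" for a
    using s mzeta_strip_mono[of 0 a r] by (auto simp: mzeta_strip_0)
  have hs: "(wterm r ?\<phi> (s(r := s r + of_nat k)) has_sum mzeta_series r (s(r := s r + of_nat k))) (mztuples r)" for k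
  proof -
    have "wterm r ?\<phi> (s(r := s r + of_nat k)) summable_on mztuples r"
      using mzeta_strip_shift[of s r 0 0 k] s r
      by (intro wterm_summable[OF r _ weight_order_powr]) (simp add: mzeta_strip_0)
    then show ?thesis
      unfolding mzeta_series_eq_wsum[OF r] wsum_def by (rule has_sum_infsum)
  qed
  have eq: "wterm r (taylor_rem 0) s m =
      (\<Sum>k=1..K. pochhammer (s r - 1) k / fact k * wterm r ?\<phi> (s(r := s r + of_nat (k - 1))) m)
      + wterm r (taylor_rem K) s m" for m
  proof -
    have P: "(\<Prod>i\<in>{1..<r}. complex_of_nat (m i) powr (- (s(r := w)) i)) =
        (\<Prod>i\<in>{1..<r}. of_nat (m i) powr (- s i))" for w
      by (rule prod.cong) auto
    show ?thesis
      unfolding wterm_def P fun_upd_same taylor_rem_0_eq[of "m r" "s r" K] distrib_left sum_distrib_left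
      by (simp only: mult_ac)
  qed
  have sumhs: "((\<lambda>m. \<Sum>k\<in>X. pochhammer (s r - 1) k / fact k * wterm r ?\<phi> (s(r := s r + of_nat (k - 1))) m)
      has_sum (\<Sum>k\<in>X. pochhammer (s r - 1) k / fact k * mzeta_series r (s(r := s r + of_nat (k - 1)))))
      (mztuples r)" if "finite X" for X
    by (rule has_sum_finite_sum[OF that], rule has_sum_cmult_right, rule hs)
  have "((\<lambda>m. wterm r (taylor_rem 0) s m) has_sum
      (\<Sum>k=1..K. pochhammer (s r - 1) k / fact k * mzeta_series r (s(r := s r + of_nat (k - 1))))
      + wsum r (taylor_rem K) s) (mztuples r)"
    unfolding eq wsum_def
    by (intro has_sum_add sumhs has_sum_infsum wterm_summable[OF r in_strip weight_order_taylor_rem]) simp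
  then have "wsum r (taylor_rem 0) s =
      (\<Sum>k=1..K. pochhammer (s r - 1) k / fact k * mzeta_series r (s(r := s r + of_nat (k - 1))))
      + wsum r (taylor_rem K) s"
    unfolding wsum_def[of r "taylor_rem 0"] by (rule infsumI)
  \<comment> \<open>The term \<open>k = 1\<close> is the unshifted series with coefficient
    \<open>s r - 1\<close>; it is the one to be solved for.\<close>
  also have "(\<Sum>k=1..K. pochhammer (s r - 1) k / fact k * mzeta_series r (s(r := s r + of_nat (k - 1)))) =
      (s r - 1) * mzeta_series r s
      + (\<Sum>k=2..K. pochhammer (s r - 1) k / fact k * mzeta_series r (s(r := s r + of_nat (k - 1))))"
    using K by (simp add: sum.atLeast_Suc_atMost numeral_2_eq_2)
  finally show ?thesis
    unfolding wsum_telescope[OF r s] by (simp add: algebra_simps)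
qed

section \<open>Meromorphic continuation\<close>

definition tail :: "nat \<Rightarrow> nat \<Rightarrow> (nat \<Rightarrow> complex) \<Rightarrow> complex" where
  "tail r k s = (\<Sum>i=k..r. s i) - of_nat (r - k + 1)"

text \<open>Entire, vanishing exactly where some \<open>tail r k s\<close> with \<open>k < r\<close>
  is a nonpositive integer: the candidate poles attached to tails of length at least two.\<close>

definition gfac :: "nat \<Rightarrow> (nat \<Rightarrow> complex) \<Rightarrow> complex" where
  "gfac r s = (\<Prod>k\<in>{1..<r}. rGamma (tail r k s))"

definition zden :: "nat \<Rightarrow> (nat \<Rightarrow> complex) \<Rightarrow> complex" where
  "zden r s = (s r - 1) * gfac r s"

lemma holo_several_tail:
  assumes "openin (top_of_set (cspace I)) U" shows "holo_several I U (tail r k)"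
  unfolding tail_def[abs_def]
  by (intro holo_several_diff holo_several_sum holo_several_const holo_several_coordinate assms)

lemma holo_several_gfac:
  assumes "openin (top_of_set (cspace I)) U" shows "holo_several I U (gfac r)"
  unfolding gfac_def[abs_def]
  by (intro holo_several_prod assms holo_several_compose_entire[OF holo_several_tail[OF assms]] holomorphic_rGamma)

lemma holo_several_zden:
  assumes "openin (top_of_set (cspace I)) U" shows "holo_several I U (zden r)"
  unfolding zden_def[abs_def]
  by (intro holo_several_mult holo_several_diff holo_several_const holo_several_coordinate
        holo_several_gfac assms)

lemma holo_several_pochhammer:
  assumes "holo_several I U f" shows "holo_several I U (\<lambda>s. pochhammer (f s) n)"
proof -
  have "(\<lambda>z::complex. pochhammer z n) holomorphic_on UNIV"
    unfolding pochhammer_prod by (intro holomorphic_intros)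
  from holo_several_compose_entire[OF assms this] show ?thesis .
qed

lemma mzeta_regionD:
  assumes "s \<in> mzeta_region r" "k \<in> {1..r}"
  shows "Re (\<Sum>i=k..r. s i) > real (r - k + 1)"
  using assms unfolding mzeta_region_def by blast

lemma mzeta_region_shift:
  assumes "s \<in> mzeta_region r" "r \<ge> 1"
  shows "s(r := s r + of_nat d) \<in> mzeta_region r"
  using mzeta_strip_shift[of s r 0 0 d] assms by (simp add: mzeta_strip_0)

lemma rGamma_nz: "Re z > 0 \<Longrightarrow> rGamma z \<noteq> (0 :: complex)"
  by (auto simp: rGamma_eq_zero_iff elim!: nonpos_Ints_cases)

lemma zden_nz:
  assumes "s \<in> mzeta_region r" "r \<ge> 1"
  shows "zden r s \<noteq> 0"
proof -
  have "Re (tail r k s) > 0" if "k \<in> {1..r}" for k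
    using mzeta_regionD[OF assms(1) that] by (simp add: tail_def)
  then have "gfac r s \<noteq> 0" by (simp add: gfac_def rGamma_nz)
  moreover have "Re (s r) > 1" using mzeta_regionD[OF assms(1), of r] assms(2) by simp
  then have "s r - 1 \<noteq> 0" by auto
  ultimately show ?thesis by (simp add: zden_def)
qed

lemma tail_shift: "k \<le> r \<Longrightarrow> tail r k (s(r := s r + z)) = tail r k s + z"
  by (simp add: tail_def sum_shift_last del: fun_upd_apply)

text \<open>Raising \<open>s r\<close> by \<open>n\<close> raises each tail by \<open>n\<close>, so
  the Gamma recurrence leaves a polynomial cofactor. It lets the shifted series in the functional
  equation be cleared of denominators too.\<close>

lemma gfac_shift:
  "gfac r s = (\<Prod>k\<in>{1..<r}. pochhammer (tail r k s) n) * gfac r (s(r := s r + of_nat n))"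
  unfolding gfac_def prod.distrib[symmetric]
proof (rule prod.cong[OF refl])
  fix k assume "k \<in> {1..<r}"
  then show "rGamma (tail r k s) = pochhammer (tail r k s) n * rGamma (tail r k (s(r := s r + of_nat n)))"
    using pochhammer_rGamma[of "tail r k s" n] by (simp only: tail_shift atLeastLessThan_iff less_imp_le)
qed

lemma merge_last_cspace: "r \<ge> 2 \<Longrightarrow> s \<in> cspace {1..r} \<Longrightarrow> merge_last r s \<in> cspace {1..r - 1}"
  by (auto simp: cspace_def merge_last_def)

lemma sum_merge_last:
  assumes "r \<ge> 2" "k \<le> r - 1"
  shows "(\<Sum>i=k..r - 1. merge_last r s i) = (\<Sum>i=k..r. s i) - 1"
proof -
  obtain q where q: "r = Suc q" "q \<ge> 1" using assms(1) by (cases r) auto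
  have "(\<Sum>i=k..q. merge_last r s i) = (\<Sum>i=k..q. (s(q := s q + (s (Suc q) - 1))) i)"
    by (rule sum.cong) (auto simp: merge_last_def q)
  then show ?thesis
    using sum_shift_last[of k q s "s (Suc q) - 1"] assms q by simp
qed

lemma merge_last_region:
  assumes "r \<ge> 2" "s \<in> mzeta_region r"
  shows "merge_last r s \<in> mzeta_region (r - 1)"
  unfolding mzeta_region_def
proof (intro CollectI conjI ballI)
  show "merge_last r s \<in> cspace {1..r - 1}"
    using assms merge_last_cspace by (auto simp: mzeta_region_def)
  fix k assume k: "k \<in> {1..r - 1}"
  then show "real (r - 1 - k + 1) < Re (\<Sum>i=k..r - 1. merge_last r s i)"
    using mzeta_regionD[OF assms(2), of k] assms(1) by (subst sum_merge_last) (auto simp: of_nat_diff)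
qed

text \<open>The \<open>- 1\<close> in \<open>merge_last\<close> matches the loss of one index, so
  the tails with \<open>k < r - 1\<close> are unchanged. From the factor \<open>k = r - 1\<close>,
  the relation \<open>rGamma z = z * rGamma (z + 1)\<close> splits off
  \<open>z = s (r - 1) + s r - 2\<close>, the pole factor of the merged last variable.\<close>

lemma gfac_merge:
  assumes "r \<ge> 2"
  shows "gfac r s = rGamma (s (r - 1) + s r - 1) * zden (r - 1) (merge_last r s)"
proof -
  obtain q where q: "r = Suc q" "q \<ge> 1" using assms by (cases r) auto
  have "tail q k (merge_last r s) = tail r k s" if "k \<in> {1..<q}" for k
    using sum_merge_last[OF assms, of k s] that q by (simp add: tail_def of_nat_diff algebra_simps)
  then have "gfac q (merge_last r s) = (\<Prod>k\<in>{1..<q}. rGamma (tail r k s))"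
    by (simp add: gfac_def)
  moreover have "rGamma (tail r q s) = (merge_last r s q - 1) * rGamma (s q + s r - 1)"
    using rGamma_plus1[of "tail r q s"] q by (simp add: tail_def merge_last_def algebra_simps)
  moreover have "gfac r s = (\<Prod>k\<in>{1..<q}. rGamma (tail r k s)) * rGamma (tail r q s)"
    using q by (simp add: gfac_def)
  ultimately show ?thesis
    using q by (simp add: zden_def mult_ac)
qed

lemma holo_several_shift_last:
  assumes "holo_several {1..r} V f" "openin (top_of_set (cspace {1..r})) U"
    "\<And>s. s \<in> U \<Longrightarrow> s(r := s r + c) \<in> V"
  shows "holo_several {1..r} U (\<lambda>s. f (s(r := s r + c)))"
proof (rule holo_several_subst[OF assms(1,2) _ assms(3)])
  show "continuous_on U (\<lambda>s. s(r := s r + c))"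
  proof (rule continuous_on_coordinatewise_then_product)
    fix k show "continuous_on U (\<lambda>s. (s(r := s r + c)) k)"
      by (cases "k = r") (auto intro!: continuous_intros continuous_on_coordinate)
  qed
  fix s :: "nat \<Rightarrow> complex" and i assume i: "i \<in> {1..r}"
  show "\<exists>j\<in>{1..r}. \<exists>a. \<forall>z. (s(i := z))(r := (s(i := z)) r + c) =
      (s(r := s r + c))(j := (s(r := s r + c)) j + a * (z - s i))"
    by (rule bexI[OF _ i], rule exI[of _ 1]) (auto simp: fun_eq_iff)
qed

lemma holo_several_merge_last:
  assumes "r \<ge> 2" "holo_several {1..r - 1} (cspace {1..r - 1}) f"
  shows "holo_several {1..r} (cspace {1..r}) (\<lambda>s. f (merge_last r s))"
proof (rule holo_several_subst[OF assms(2)])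
  show "continuous_on (cspace {1..r}) (merge_last r)"
  proof (rule continuous_on_coordinatewise_then_product)
    fix k show "continuous_on (cspace {1..r}) (\<lambda>s. merge_last r s k)"
      unfolding merge_last_def
      by (cases "k = r"; cases "k = r - 1") (auto intro!: continuous_intros continuous_on_coordinate)
  qed
  fix s :: "nat \<Rightarrow> complex" and i assume i: "i \<in> {1..r}"
  show "\<exists>j\<in>{1..r - 1}. \<exists>a. \<forall>z. merge_last r (s(i := z)) =
      (merge_last r s)(j := merge_last r s j + a * (z - s i))"
  proof (rule bexI[of _ "if i = r then r - 1 else i"], rule exI[of _ 1], rule allI)
    fix z show "merge_last r (s(i := z)) = (merge_last r s)
      (if i = r then r - 1 else i := merge_last r s (if i = r then r - 1 else i) + 1 * (z - s i))"
      using assms(1) by (auto simp: merge_last_def fun_eq_iff)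
  qed (use i assms(1) in auto)
qed (use assms(1) merge_last_cspace in auto)

text \<open>\<open>g'\<close> is the functional equation multiplied by \<open>gfac r s\<close>, with
  every series replaced by a function already continued. Shifts by \<open>k - 1 \<ge> 1\<close>
  carry strip \<open>Suc A\<close> into strip \<open>A\<close>, and \<open>K = Suc A\<close> is the
  order at which the remainder converges on strip \<open>Suc A\<close>.\<close>

lemma mzeta_strip_continuation_step:
  assumes r: "r \<ge> 1"
    and F': "r \<ge> 2 \<Longrightarrow> holo_several {1..r - 1} (cspace {1..r - 1}) F'"
      "\<And>s. r \<ge> 2 \<Longrightarrow> s \<in> mzeta_region (r - 1) \<Longrightarrow> F' s = zden (r - 1) s * mzeta_series (r - 1) s"
    and g: "holo_several {1..r} (mzeta_strip r A) g"
      "\<And>s. s \<in> mzeta_region r \<Longrightarrow> g s = zden r s * mzeta_series r s"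
  defines "K \<equiv> Suc A"
  defines "g' \<equiv> \<lambda>s. (if r = 1 then 0 else rGamma (s (r - 1) + s r - 1) * F' (merge_last r s))
      - (\<Sum>k=2..K. pochhammer (s r - 1) (k - 1) / fact k
          * (\<Prod>i\<in>{1..<r}. pochhammer (tail r i s) (k - 1)) * g (s(r := s r + of_nat (k - 1))))
      - gfac r s * wsum r (taylor_rem K) s"
  shows "holo_several {1..r} (mzeta_strip r (Suc A)) g'"
    "\<And>s. s \<in> mzeta_region r \<Longrightarrow> g' s = zden r s * mzeta_series r s"
proof -
  note op = openin_mzeta_strip[of r "Suc A"]
  have 1: "holo_several {1..r} (mzeta_strip r (Suc A))
      (\<lambda>s. if r = 1 then 0 else rGamma (s (r - 1) + s r - 1) * F' (merge_last r s))"
  proof (cases "r = 1")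
    case False
    then have r2: "r \<ge> 2" using r by simp
    have "holo_several {1..r} (mzeta_strip r (Suc A)) (\<lambda>s. rGamma (s (r - 1) + s r - 1) * F' (merge_last r s))"
    proof (rule holo_several_mult)
      show "holo_several {1..r} (mzeta_strip r (Suc A)) (\<lambda>s. rGamma (s (r - 1) + s r - 1))"
        by (intro holo_several_compose_entire[OF _ holomorphic_rGamma] holo_several_diff
              holo_several_add holo_several_coordinate holo_several_const op)
      show "holo_several {1..r} (mzeta_strip r (Suc A)) (\<lambda>s. F' (merge_last r s))"
        by (rule holo_several_subset[OF holo_several_merge_last[OF r2 F'(1)[OF r2]] op])
           (auto simp: mzeta_strip_def)
    qed
    then show ?thesis using False by simp
  qed (use holo_several_const[OF op] in simp)
  have 2: "holo_several {1..r} (mzeta_strip r (Suc A)) (\<lambda>s. g (s(r := s r + of_nat (k - 1))))"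
    if "k \<in> {2..K}" for k
    by (rule holo_several_shift_last[OF g(1) op])
       (rule mzeta_strip_shift[where a = 1], use r that in auto)
  have 3: "holo_several {1..r} (mzeta_strip r (Suc A)) (wsum r (taylor_rem K))"
    unfolding K_def by (rule holo_several_wsum[OF r weight_order_taylor_rem])
  show "holo_several {1..r} (mzeta_strip r (Suc A)) g'"
    unfolding g'_def divide_inverse
    by (intro holo_several_diff holo_several_mult[OF holo_several_gfac[OF op] 3] 1 holo_several_sum
          holo_several_mult[OF _ 2] holo_several_mult holo_several_prod holo_several_pochhammer
          holo_several_coordinate holo_several_const holo_several_tail op)
  fix s assume s: "s \<in> mzeta_region r"
  have "zden r s * mzeta_series r s = gfac r s * ((s r - 1) * mzeta_series r s)"
    by (simp add: zden_def)
  also have "\<dots> = (if r = 1 then 0 else gfac r s * mzeta_series (r - 1) (merge_last r s))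
      - (\<Sum>k=2..K. gfac r s * (pochhammer (s r - 1) k / fact k * mzeta_series r (s(r := s r + of_nat (k - 1)))))
      - gfac r s * wsum r (taylor_rem K) s"
    by (subst mzeta_functional_eq[OF r s, of K])
       (simp_all add: K_def right_diff_distrib sum_distrib_left del: sum.cl_ivl_Suc fun_upd_apply)
  also have "(if r = 1 then 0 else gfac r s * mzeta_series (r - 1) (merge_last r s)) =
      (if r = 1 then 0 else rGamma (s (r - 1) + s r - 1) * F' (merge_last r s))"
    using r F'(2)[OF _ merge_last_region[OF _ s]] gfac_merge[of r s] by auto
  also have "(\<Sum>k=2..K. gfac r s * (pochhammer (s r - 1) k / fact k * mzeta_series r (s(r := s r + of_nat (k - 1))))) =
      (\<Sum>k=2..K. pochhammer (s r - 1) (k - 1) / fact k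
          * (\<Prod>i\<in>{1..<r}. pochhammer (tail r i s) (k - 1)) * g (s(r := s r + of_nat (k - 1))))"
  proof (rule sum.cong[OF refl])
    fix k assume "k \<in> {2..K}"
    then obtain n where n: "k = Suc n" by (cases k) auto
    define t where "t = s(r := s r + of_nat n)"
    have "g t = (t r - 1) * gfac r t * mzeta_series r t"
      using g(2)[OF mzeta_region_shift[OF s r, of n]] by (simp add: t_def zden_def del: fun_upd_apply)
    moreover have "gfac r s = (\<Prod>i\<in>{1..<r}. pochhammer (tail r i s) n) * gfac r t"
      unfolding t_def by (rule gfac_shift)
    \<comment> \<open>The last factor \<open>s r - 1 + n\<close> equals \<open>t r - 1\<close>,
      precisely the factor of \<open>zden r t\<close> besides \<open>gfac r t\<close>; hence
      \<open>g'\<close> carries only \<open>pochhammer (s r - 1) (k - 1)\<close>.\<close>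
    moreover have "pochhammer (s r - 1) k = pochhammer (s r - 1) n * (t r - 1)"
      by (simp add: n pochhammer_Suc t_def algebra_simps)
    ultimately show "gfac r s * (pochhammer (s r - 1) k / fact k * mzeta_series r (s(r := s r + of_nat (k - 1)))) =
      pochhammer (s r - 1) (k - 1) / fact k
          * (\<Prod>i\<in>{1..<r}. pochhammer (tail r i s) (k - 1)) * g (s(r := s r + of_nat (k - 1)))"
      unfolding n diff_Suc_1 t_def[symmetric] by (simp add: mult_ac)
  qed
  finally show "g' s = zden r s * mzeta_series r s" unfolding g'_def by simp
qed

lemma mzeta_strip_upd_iff:
  assumes "r \<ge> 1" "s \<in> cspace {1..r}"
  shows "s(r := z) \<in> mzeta_strip r A \<longleftrightarrow>
    (\<forall>k\<in>{1..r}. real (r - k + 1) - real A - Re (\<Sum>i=k..<r. s i) < Re z)"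
proof -
  have "Re (\<Sum>i=k..r. (s(r := z)) i) = Re (\<Sum>i=k..<r. s i) + Re z" if "k \<in> {1..r}" for k
    using sum_upd_last[of k r s z] that by simp
  then have "(\<forall>k\<in>{1..r}. real (r - k + 1) - real A < Re (\<Sum>i=k..r. (s(r := z)) i)) \<longleftrightarrow>
     (\<forall>k\<in>{1..r}. real (r - k + 1) - real A - Re (\<Sum>i=k..<r. s i) < Re z)"
    by (intro ball_cong refl) (simp only:, linarith)
  then show ?thesis using assms by (simp add: mzeta_strip_def del: fun_upd_apply)
qed

text \<open>Every point of a strip is joined to the convergence region by a line in the last coordinate.\<close>

lemma mzeta_strip_agree:
  assumes r: "r \<ge> 1" and f: "holo_several {1..r} (mzeta_strip r A) f"
    and g: "holo_several {1..r} (mzeta_strip r A) g"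
    and eq: "\<And>s. s \<in> mzeta_region r \<Longrightarrow> f s = g s" and s: "s \<in> mzeta_strip r A"
  shows "f s = g s"
proof -
  have sc: "s \<in> cspace {1..r}" using s by (auto simp: mzeta_strip_def)
  define D where "D = (\<lambda>A. {z. s(r := z) \<in> mzeta_strip r A})"
  have r1: "r \<in> {1..r}" using r by simp
  have D: "D A = (\<Inter>k\<in>{1..r}. {z. real (r - k + 1) - real A - Re (\<Sum>i=k..<r. s i) < Re z})" for A
    unfolding D_def mzeta_strip_upd_iff[OF r sc] by blast
  have "f (s(r := s r)) = g (s(r := s r))"
  proof (rule analytic_continuation_open[where f = "\<lambda>z. f (s(r := z))" and g = "\<lambda>z. g (s(r := z))"])
    show "open (D 0)" "open (D A)"
      unfolding D_def by (rule open_slice[OF openin_mzeta_strip sc r1])+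
    show "connected (D A)"
      unfolding D by (intro convex_connected convex_INT convex_halfspace_Re_gt)
    show "D 0 \<subseteq> D A" unfolding D_def using mzeta_strip_mono[of 0 A r] by blast
    show "D 0 \<noteq> {}"
    proof -
      define c where "c = (\<Sum>k=1..r. \<bar>real (r - k + 1) - real 0 - Re (\<Sum>i=k..<r. s i)\<bar>) + 1"
      have "real (r - k + 1) - real 0 - Re (\<Sum>i=k..<r. s i) < Re (of_real c)" if "k \<in> {1..r}" for k
        using member_le_sum[OF that, of "\<lambda>k. \<bar>real (r - k + 1) - real 0 - Re (\<Sum>i=k..<r. s i)\<bar>"]
        unfolding c_def Re_complex_of_real by simp
      then have "of_real c \<in> D 0" unfolding D by blast
      then show ?thesis by blast
    qed
    show "(\<lambda>z. f (s(r := z))) holomorphic_on D A"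
      by (rule holo_several_slice[OF f r1]) (auto simp: D_def)
    show "(\<lambda>z. g (s(r := z))) holomorphic_on D A"
      by (rule holo_several_slice[OF g r1]) (auto simp: D_def)
    show "f (s(r := z)) = g (s(r := z))" if "z \<in> D 0" for z
      using that eq by (simp add: D_def mzeta_strip_0)
    show "s r \<in> D A" using s by (simp add: D_def)
  qed
  then show ?thesis by simp
qed

lemma mzeta_strip_exhaust:
  assumes "s \<in> cspace {1..r}" obtains A where "s \<in> mzeta_strip r A"
proof -
  define c where "c = (\<Sum>k=1..r. \<bar>real (r - k + 1) - Re (\<Sum>i=k..r. s i)\<bar>)"
  obtain A :: nat where A: "c < real A" using reals_Archimedean2 by blast
  have "real (r - k + 1) - real A < Re (\<Sum>i=k..r. s i)" if "k \<in> {1..r}" for k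
    using member_le_sum[OF that, of "\<lambda>k. \<bar>real (r - k + 1) - Re (\<Sum>i=k..r. s i)\<bar>"] A
    unfolding c_def by simp
  then show ?thesis using that[of A] assms by (auto simp: mzeta_strip_def)
qed

text \<open>Strong induction on \<open>r\<close> supplies the merged term, an inner induction on
  \<open>A\<close> widens the strip. Functions on different strips agree with the series on the
  region, hence with each other, and glue to an entire function.\<close>

theorem mzeta_entire_numerator:
  assumes "r \<ge> 1"
  shows "\<exists>F. holo_several {1..r} (cspace {1..r}) F \<and>
    (\<forall>s\<in>mzeta_region r. F s = zden r s * mzeta_series r s)"
  using assms
proof (induction r rule: less_induct)
  case (less r)
  have "\<exists>F'. r \<ge> 2 \<longrightarrow> (holo_several {1..r - 1} (cspace {1..r - 1}) F' \<and>
      (\<forall>s\<in>mzeta_region (r - 1). F' s = zden (r - 1) s * mzeta_series (r - 1) s))"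
    using less.IH[of "r - 1"] by (cases "r \<ge> 2") simp_all
  then obtain F' where F': "r \<ge> 2 \<Longrightarrow> holo_several {1..r - 1} (cspace {1..r - 1}) F'"
    "\<And>s. r \<ge> 2 \<Longrightarrow> s \<in> mzeta_region (r - 1) \<Longrightarrow> F' s = zden (r - 1) s * mzeta_series (r - 1) s"
    by blast
  have "\<exists>g. holo_several {1..r} (mzeta_strip r A) g \<and>
      (\<forall>s\<in>mzeta_region r. g s = zden r s * mzeta_series r s)" for A
  proof (induction A)
    case 0
    have "holo_several {1..r} (mzeta_strip r 0) (mzeta_series r)"
      unfolding mzeta_series_eq_wsum[OF less.prems, abs_def]
      by (rule holo_several_wsum[OF less.prems weight_order_powr])
    then show ?case
      by (intro exI[of _ "\<lambda>s. zden r s * mzeta_series r s"] conjI ballI refl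
            holo_several_mult holo_several_zden openin_mzeta_strip)
  next
    case (Suc A)
    then obtain g where "holo_several {1..r} (mzeta_strip r A) g"
      "\<And>s. s \<in> mzeta_region r \<Longrightarrow> g s = zden r s * mzeta_series r s" by blast
    from mzeta_strip_continuation_step[OF less.prems F' this]
    show ?case by (intro exI conjI ballI)
  qed
  then obtain G where G: "\<And>A. holo_several {1..r} (mzeta_strip r A) (G A)"
    "\<And>A s. s \<in> mzeta_region r \<Longrightarrow> G A s = zden r s * mzeta_series r s" by metis
  have GG: "G A s = G B s" if "A \<le> B" "s \<in> mzeta_strip r A" for A B s
    by (rule mzeta_strip_agree[OF less.prems G(1) holo_several_subset[OF G(1) openin_mzeta_strip] _ that(2)])
       (use G(2) mzeta_strip_mono[OF that(1)] in auto)
  \<comment> \<open>Any strip containing \<open>s\<close> gives the same value; the least one is a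
    canonical choice.\<close>
  define F where "F = (\<lambda>s. G (LEAST A. s \<in> mzeta_strip r A) s)"
  have FG: "F s = G A s" if "s \<in> mzeta_strip r A" for s A
    unfolding F_def
    by (rule GG) (rule Least_le[where P = "\<lambda>A. s \<in> mzeta_strip r A"], rule that,
      rule LeastI[where P = "\<lambda>A. s \<in> mzeta_strip r A"], rule that)
  have "holo_several {1..r} (cspace {1..r}) F"
  proof (rule holo_several_local)
    fix p assume "p \<in> cspace {1..r}"
    then obtain A where A: "p \<in> mzeta_strip r A" by (rule mzeta_strip_exhaust)
    show "\<exists>V. p \<in> V \<and> V \<subseteq> cspace {1..r} \<and> holo_several {1..r} V F"
      using A holo_several_cong[OF G(1)[of A] FG[symmetric]]
      by (intro exI[of _ "mzeta_strip r A"] conjI) (auto simp: mzeta_strip_def)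
  qed
  moreover have "F s = zden r s * mzeta_series r s" if "s \<in> mzeta_region r" for s
    using FG[of s 0] G(2)[OF that, of 0] that by (simp add: mzeta_strip_0)
  ultimately show ?case by blast
qed

lemma mzeta_numerator_obtain:
  assumes "r \<ge> 1"
  obtains F where "holo_several {1..r} (cspace {1..r}) F"
    "\<And>s. s \<in> mzeta_region r \<Longrightarrow> F s = zden r s * mzeta_series r s"
    "\<And>s. s \<in> cspace {1..r} \<Longrightarrow> zden r s \<noteq> 0 \<Longrightarrow> mzeta_regular r s"
    "\<And>s. s \<in> cspace {1..r} \<Longrightarrow> zden r s \<noteq> 0 \<Longrightarrow> mzeta r s = F s / zden r s"
proof -
  obtain F where F: "holo_several {1..r} (cspace {1..r}) F"
    "\<And>s. s \<in> mzeta_region r \<Longrightarrow> F s = zden r s * mzeta_series r s"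
    using mzeta_entire_numerator[OF assms] by blast
  have H: "holo_several {1..r} (cspace {1..r}) (zden r)" by (intro holo_several_zden) auto
  note q = mzeta_quotient[OF F(1) H F(2) zden_nz[OF _ assms]]
  show ?thesis by (rule that[OF F]) (use q in blast)+
qed

lemma mzeta_eq_series:
  assumes "r \<ge> 1" "s \<in> mzeta_region r"
  shows "mzeta r s = mzeta_series r s"
proof -
  have "s \<in> cspace {1..r}" using assms by (simp add: mzeta_region_def)
  then show ?thesis
    using mzeta_numerator_obtain[OF assms(1)] zden_nz[OF assms(2,1)] assms(2)
    by (metis nonzero_mult_div_cancel_left)
qed

section \<open>The Riemann zeta function at nonpositive integers\<close>

lemma vec1_cspace [simp]: "vec1 z \<in> cspace {1..1}"
  by (auto simp: vec1_def cspace_def)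

lemma vec1_1 [simp]: "vec1 z 1 = z" "vec1 z (Suc 0) = z"
  by (auto simp: vec1_def)

lemma zden_vec1: "zden 1 (vec1 z) = z - 1"
  by (simp add: zden_def gfac_def)

lemma wsum_vec1: "wsum 1 \<phi> (vec1 z) = (\<Sum>\<^sub>\<infinity>m\<in>mztuples 1. \<phi> (m 1) z)"
  by (simp add: wsum_def wterm_def)

lemma vec1_strip: "vec1 z \<in> mzeta_strip 1 A \<longleftrightarrow> Re z > 1 - real A"
  using vec1_cspace[of z] by (auto simp: mzeta_strip_def)

text \<open>For \<open>r = 1\<close> the product \<open>gfac\<close> is empty and \<open>F\<close>
  continues \<open>(z - 1) * zeta z\<close>. Feeding \<open>F\<close> itself into the continuation
  step yields the functional equation beyond the region of convergence.\<close>

lemma zeta_numerator_eq: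
  assumes F: "holo_several {1..1} (cspace {1..1}) F"
    "\<And>s. s \<in> mzeta_region 1 \<Longrightarrow> F s = zden 1 s * mzeta_series 1 s" and z: "Re z > - real A"
  shows "F (vec1 z) = - (\<Sum>k=2..Suc A. pochhammer (z - 1) (k - 1) / fact k * F (vec1 (z + of_nat (k - 1))))
     - wsum 1 (taylor_rem (Suc A)) (vec1 z)"
proof -
  have FA: "holo_several {1..1} (mzeta_strip 1 A) F" for A
    by (rule holo_several_subset[OF F(1) openin_mzeta_strip]) (auto simp: mzeta_strip_def)
  \<comment> \<open>The instance \<open>r = 1\<close> of the function in the continuation step, with
    the dummy \<open>F' = 0\<close> in its dead branch.\<close>
  define g' where "g' = (\<lambda>s. (if (1::nat) = 1 then 0 else rGamma (s (1 - 1) + s 1 - 1) * 0)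
      - (\<Sum>k=2..Suc A. pochhammer (s 1 - 1) (k - 1) / fact k
          * (\<Prod>i\<in>{1..<1}. pochhammer (tail 1 i s) (k - 1)) * F (s(1 := s 1 + of_nat (k - 1))))
      - gfac 1 s * wsum 1 (taylor_rem (Suc A)) s)"
  have g': "holo_several {1..1} (mzeta_strip 1 (Suc A)) g'"
    "\<And>s. s \<in> mzeta_region 1 \<Longrightarrow> g' s = zden 1 s * mzeta_series 1 s"
    unfolding g'_def
    by (rule mzeta_strip_continuation_step[where F' = "\<lambda>_. 0", OF _ _ _ FA[of A] F(2)]; simp)+
  have "F (vec1 z) = g' (vec1 z)"
  proof (rule mzeta_strip_agree[OF _ FA g'(1)])
    show "vec1 z \<in> mzeta_strip 1 (Suc A)" using z unfolding vec1_strip by simp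
  qed (use g'(2) F(2) in auto)
  moreover have "(vec1 z)(1 := w) = vec1 w" for w by (simp add: vec1_def)
  ultimately show ?thesis by (simp add: g'_def gfac_def del: fun_upd_apply)
qed

text \<open>This is the residue of zeta at 1. At \<open>z = 1\<close> the remainder of order 1
  vanishes for all \<open>n \<ge> 2\<close>, so a single term survives.\<close>

lemma zeta_numerator_1:
  assumes F: "holo_several {1..1} (cspace {1..1}) F"
    "\<And>s. s \<in> mzeta_region 1 \<Longrightarrow> F s = zden 1 s * mzeta_series 1 s"
  shows "F (vec1 1) = 1"
proof -
  define m0 :: "nat \<Rightarrow> nat" where "m0 = restrict (\<lambda>_. 1) {1..1}"
  have m0: "m0 \<in> mztuples 1" by (auto simp: mztuples_def m0_def strict_mono_on_def)
  \<comment> \<open>At entry 1 the convention \<open>0 powr 0 = 0\<close> leaves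
    \<open>0 - 1 = - 1\<close>; elsewhere both powers are 1 and cancel.\<close>
  have "infsum (\<lambda>m. taylor_rem 1 (m 1) 1) (mztuples 1) = infsum (\<lambda>_. - 1) {m0}"
  proof (rule infsum_cong_neutral)
    fix m assume m: "m \<in> mztuples 1 - {m0}"
    have "m 1 \<noteq> 1"
    proof
      assume "m 1 = 1"
      moreover have "m \<in> extensional {1..1}" using m by (auto simp: mztuples_def PiE_iff)
      ultimately have "m = m0" by (auto simp: m0_def fun_eq_iff extensional_def)
      then show False using m by simp
    qed
    then have "m 1 \<ge> 2" using mztuplesD(1)[of m 1 1] m by auto
    then show "taylor_rem 1 (m 1) 1 = 0" by (simp add: taylor_rem_def)
  qed (use m0 in \<open>auto simp: taylor_rem_def m0_def\<close>)
  then show ?thesis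
    using zeta_numerator_eq[OF F, where A = 0 and z = 1] unfolding wsum_vec1 by simp
qed

lemma pochhammer_minus_nat: "pochhammer (- of_nat N) k / fact k = (- 1) ^ k * (of_nat (N choose k) :: complex)"
  using gbinomial_pochhammer[of "of_nat N :: complex" k] by (simp add: binomial_gbinomial)

text \<open>At \<open>z = - n\<close> the expanded function is the polynomial
  \<open>(m - 1) ^ (n + 1)\<close>, whose expansion is the finite binomial formula; the coefficient
  at \<open>k = n + 2\<close> is 0.\<close>

lemma taylor_rem_minus_nat:
  assumes "m \<ge> 1" shows "taylor_rem (n + 2) m (- of_nat n) = 0"
proof -
  have "of_nat m powr (1 - - of_nat n - of_nat k) = complex_of_nat m ^ (n + 1 - k)" if "k \<le> n + 1" for k
  proof -
    have "1 - - of_nat n - of_nat k = complex_of_nat (n + 1 - k)" using that by (simp add: of_nat_diff)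
    then show ?thesis using assms by (simp only: powr_complexpow of_nat_eq_0_iff)
  qed
  moreover have "of_nat (m - 1) powr (1 - - of_nat n) = (complex_of_nat m - 1) ^ (n + 1)"
  proof (cases "m = 1")
    case False
    have "1 - - of_nat n = complex_of_nat (n + 1)" by simp
    then show ?thesis using assms False by (simp only: powr_complexpow of_nat_eq_0_iff) (simp add: of_nat_diff)
  qed auto
  moreover have "- of_nat n - 1 = - (of_nat (n + 1) :: complex)" by simp
  ultimately have "taylor_rem (n + 2) m (- of_nat n) = (complex_of_nat m - 1) ^ (n + 1)
      - (\<Sum>k\<le>n + 1. (- 1) ^ k * of_nat ((n + 1) choose k) * of_nat m ^ (n + 1 - k))"
    unfolding taylor_rem_def by (simp only: pochhammer_minus_nat) (simp add: binomial_eq_0)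
  also have "(complex_of_nat m - 1) ^ (n + 1) = (\<Sum>k\<le>n + 1. of_nat ((n + 1) choose k) * (- 1) ^ k * of_nat m ^ (n + 1 - k))"
    using binomial_ring[of "- 1" "complex_of_nat m" "n + 1"] by simp
  finally show ?thesis by (simp add: mult_ac)
qed

lemma mzeta_regular_minus_nat: "mzeta_regular 1 (vec1 (- of_nat n))"
proof -
  have "- of_nat n - 1 = - (of_nat (Suc n) :: complex)" by simp
  then have "- of_nat n - 1 \<noteq> (0 :: complex)"
    by (simp only: neg_equal_0_iff_equal of_nat_eq_0_iff nat.distinct not_False_eq_True)
  then show ?thesis
    using mzeta_numerator_obtain[of 1] by (metis order_refl vec1_cspace zden_vec1)
qed

text \<open>The functional equation at \<open>z = - n\<close>, where the remainder is 0. The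
  right-hand side is the term whose shifted argument is 1, that is, the residue.\<close>

lemma zeta_minus_nat_recurrence:
  "(\<Sum>k=1..n + 1. (- 1) ^ k * of_nat ((n + 1) choose k) * mzeta 1 (vec1 (- of_nat (n + 1 - k)))) =
     (- 1) ^ n / of_nat (n + 2)"
proof -
  obtain F where F: "holo_several {1..1} (cspace {1..1}) F"
    "\<And>s. s \<in> mzeta_region 1 \<Longrightarrow> F s = zden 1 s * mzeta_series 1 s"
    "\<And>s. s \<in> cspace {1..1} \<Longrightarrow> zden 1 s \<noteq> 0 \<Longrightarrow> mzeta 1 s = F s / zden 1 s"
    using mzeta_numerator_obtain[of 1] by (metis order_refl)
  define \<zeta> where "\<zeta> = (\<lambda>k. mzeta 1 (vec1 (- of_nat k)))"
  have nz: "of_nat k + 1 \<noteq> (0 :: complex)" for k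
    using of_nat_eq_0_iff[of "Suc k", where 'a = complex] by (simp add: add.commute)
  have F\<zeta>: "F (vec1 (- of_nat k)) = - (of_nat k + 1) * \<zeta> k" for k
  proof -
    have "zden 1 (vec1 (- of_nat k)) = - (of_nat k + 1)" by (subst zden_vec1) simp
    moreover have "- (of_nat k + 1) \<noteq> (0 :: complex)"
      using nz[of k] by (simp only: neg_equal_0_iff_equal not_False_eq_True)
    ultimately have "\<zeta> k = F (vec1 (- of_nat k)) / (- (of_nat k + 1))"
      using F(3)[OF vec1_cspace, of "- of_nat k"] unfolding \<zeta>_def by metis
    with \<open>- (of_nat k + 1) \<noteq> (0 :: complex)\<close> show ?thesis
      by (simp only: times_divide_eq_right nonzero_mult_div_cancel_left not_False_eq_True)
  qed
  define P where "P = (\<lambda>k. (- 1) ^ k * of_nat ((n + 1) choose k) :: complex)"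
  have P: "pochhammer (- of_nat n - 1) k / fact k = P k" for k
  proof -
    have "- of_nat n - 1 = - (of_nat (n + 1) :: complex)" by simp
    then show ?thesis by (simp only: P_def pochhammer_minus_nat)
  qed
  have "infsum (\<lambda>m. taylor_rem (n + 2) (m 1) (- of_nat n)) (mztuples 1) = 0"
    by (rule infsum_0) (use mztuplesD(1)[of _ 1 1] in \<open>force intro!: taylor_rem_minus_nat\<close>)
  \<comment> \<open>\<open>A = n + 1\<close> satisfies \<open>- n > - A\<close>. The top index
    \<open>k = n + 2\<close> of the sum evaluates \<open>F\<close> at 1.\<close>
  then have "F (vec1 (- of_nat n)) =
      - (\<Sum>k=2..Suc (n + 1). pochhammer (- of_nat n - 1) (k - 1) / fact k * F (vec1 (- of_nat n + of_nat (k - 1))))"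
    using zeta_numerator_eq[OF F(1,2), where A = "n + 1" and z = "- of_nat n"]
    unfolding wsum_vec1 by simp
  also have "\<dots> = - (\<Sum>k=2..n + 1. pochhammer (- of_nat n - 1) (k - 1) / fact k * F (vec1 (- of_nat n + of_nat (k - 1))))
      - pochhammer (- of_nat n - 1) (n + 1) / fact (n + 2)"
    using zeta_numerator_1[OF F(1,2)] by simp
  also have "pochhammer (- of_nat n - 1) (n + 1) / fact (n + 2) = P (n + 1) / of_nat (n + 2)"
    unfolding P[symmetric] by simp
  also have "(\<Sum>k=2..n + 1. pochhammer (- of_nat n - 1) (k - 1) / fact k * F (vec1 (- of_nat n + of_nat (k - 1)))) =
      (\<Sum>k=2..n + 1. P k * \<zeta> (n + 1 - k))"
  proof (rule sum.cong[OF refl])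
    fix k assume k: "k \<in> {2..n + 1}"
    then obtain i where i: "k = Suc i" by (cases k) auto
    have "- of_nat n + of_nat (k - 1) = - (of_nat (n + 1 - k) :: complex)"
      using k by (simp add: of_nat_diff)
    \<comment> \<open>The factor relating \<open>F\<close> to zeta at the shifted point completes
      the Pochhammer symbol from \<open>k - 1\<close> to \<open>k\<close>.\<close>
    moreover have "- (of_nat (n + 1 - k) + 1) = (- of_nat n - 1) + (of_nat i :: complex)"
      using k i by (simp add: of_nat_diff)
    ultimately show "pochhammer (- of_nat n - 1) (k - 1) / fact k * F (vec1 (- of_nat n + of_nat (k - 1))) =
        P k * \<zeta> (n + 1 - k)"
      unfolding P[symmetric] F\<zeta> using i by (simp only: F\<zeta> pochhammer_Suc diff_Suc_1) (simp add: mult_ac)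
  qed
  finally have "- (of_nat n + 1) * \<zeta> n + (\<Sum>k=2..n + 1. P k * \<zeta> (n + 1 - k)) = - P (n + 1) / of_nat (n + 2)"
    unfolding F\<zeta> by (simp add: algebra_simps)
  moreover have "(\<Sum>k=1..n + 1. P k * \<zeta> (n + 1 - k)) = P 1 * \<zeta> n + (\<Sum>k=2..n + 1. P k * \<zeta> (n + 1 - k))"
    by (subst sum.atLeast_Suc_atMost) (simp_all add: numeral_2_eq_2)
  moreover have "P 1 = - (of_nat n + 1)" "P (n + 1) = - ((- 1) ^ n)" by (simp_all add: P_def)
  ultimately have "(\<Sum>k=1..n + 1. P k * \<zeta> (n + 1 - k)) = (- 1) ^ n / of_nat (n + 2)" by simp
  then show ?thesis by (simp add: P_def \<zeta>_def)
qed

section \<open>Zeta values at nonpositive integers and power sums\<close>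

text \<open>The polynomial \<open>B_(n+1)(x + 1) / (n + 1)\<close> for the Bernoulli polynomial
  \<open>B_(n+1)\<close>, with its coefficients expressed by zeta(-k) as the theorem
  requires.\<close>

definition faulhaber :: "nat \<Rightarrow> complex \<Rightarrow> complex" where
  "faulhaber n x = 1 / (of_nat n + 1) * x ^ (n + 1)
     - (\<Sum>k=0..n. of_nat (n choose k) * x ^ (n - k) * mzeta 1 (vec1 (- of_nat k)))"

text \<open>The recurrence read backwards through \<open>k \<mapsto> p - k\<close>, completed by the
  term \<open>k = p\<close>. The case \<open>p = 0\<close>, which no instance of the recurrence
  covers, has no correction.\<close>

lemma zeta_minus_nat_convolution:
  "(\<Sum>k=0..p. of_nat (p choose k) * mzeta 1 (vec1 (- of_nat k)) * (- 1) ^ (p - k)) =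
     mzeta 1 (vec1 (- of_nat p)) + (if p = 0 then 0 else - ((- 1) ^ p / of_nat (p + 1)))"
proof (cases p)
  case (Suc n)
  let ?\<zeta> = "\<lambda>k. mzeta 1 (vec1 (- of_nat k))"
  have "(\<Sum>k=0..p. of_nat (p choose k) * ?\<zeta> k * (- 1) ^ (p - k)) =
      (\<Sum>k=0..n. of_nat (p choose k) * ?\<zeta> k * (- 1) ^ (p - k)) + ?\<zeta> p"
    using Suc by simp
  also have "(\<Sum>k=0..n. of_nat (p choose k) * ?\<zeta> k * (- 1) ^ (p - k)) =
      (\<Sum>k=1..n + 1. (- 1) ^ k * of_nat ((n + 1) choose k) * ?\<zeta> (n + 1 - k))"
  proof (rule sum.reindex_bij_witness[of _ "\<lambda>k. p - k" "\<lambda>k. p - k"])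
    fix k assume k: "k \<in> {0..n}"
    then have "(n + 1) choose (p - k) = p choose k"
      using binomial_symmetric[of k p] Suc by simp
    then show "(- 1) ^ (p - k) * of_nat ((n + 1) choose (p - k)) * ?\<zeta> (n + 1 - (p - k)) =
        of_nat (p choose k) * ?\<zeta> k * (- 1) ^ (p - k)"
      using k Suc by simp
  qed (use Suc in auto)
  also have "\<dots> = (- 1) ^ n / of_nat (n + 2)" by (rule zeta_minus_nat_recurrence)
  finally show ?thesis using Suc by simp
qed simp

lemma binomial_Suc_div:
  assumes "i \<le> n"
  shows "of_nat ((n + 1) choose i) / (of_nat n + 1) = (of_nat (n choose i) / of_nat (n + 1 - i) :: complex)"
proof -
  have "(n + 1 - i) * ((n + 1) choose i) = (n + 1) * (n choose i)"
    using binomial_absorb_comp[of "n + 1" i] by simp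
  then have eq: "(of_nat (n + 1 - i) * of_nat ((n + 1) choose i) :: complex) = of_nat (n + 1) * of_nat (n choose i)"
    by (simp only: of_nat_mult[symmetric])
  have nz: "(of_nat (n + 1) :: complex) \<noteq> 0" "(of_nat (n + 1 - i) :: complex) \<noteq> 0"
    using assms by (simp_all only: of_nat_eq_0_iff)
  have e: "(of_nat n + 1 :: complex) = of_nat (n + 1)" by simp
  show ?thesis
    unfolding e frac_eq_eq[OF nz] using eq by (simp only: mult.commute)
qed

text \<open>Expand the powers of \<open>x - 1\<close> and collect by \<open>x ^ i\<close>. Each
  coefficient of the zeta part is a convolution, which returns the original coefficient plus a
  correction; the corrections cancel against the expansion of \<open>(x - 1) ^ (n + 1)\<close>,
  except at \<open>i = n\<close>.\<close>

lemma faulhaber_diff: "faulhaber n x - faulhaber n (x - 1) = x ^ n"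
proof -
  let ?\<zeta> = "\<lambda>k. mzeta 1 (vec1 (- of_nat k))"
  \<comment> \<open>The correction term of \<open>zeta_minus_nat_convolution\<close>.\<close>
  define e where "e = (\<lambda>p. if p = 0 then 0 else - ((- 1) ^ p / of_nat (p + 1)) :: complex)"
  have ex: "(x - 1) ^ N = (\<Sum>i=0..N. of_nat (N choose i) * x ^ i * (- 1) ^ (N - i))" for N
    using binomial_ring[of x "- 1" N] by (simp add: atMost_atLeast0)
  have "(\<Sum>k=0..n. of_nat (n choose k) * (x - 1) ^ (n - k) * ?\<zeta> k) =
      (\<Sum>k=0..n. \<Sum>i\<in>{i\<in>{0..n}. i + k \<le> n}.
         of_nat (n choose i) * x ^ i * (of_nat ((n - i) choose k) * ?\<zeta> k * (- 1) ^ (n - i - k)))"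
  proof (rule sum.cong[OF refl])
    fix k assume k: "k \<in> {0..n}"
    have "of_nat (n choose k) * (x - 1) ^ (n - k) * ?\<zeta> k =
        (\<Sum>i=0..n - k. of_nat (n choose k) * (of_nat ((n - k) choose i) * x ^ i * (- 1) ^ (n - k - i)) * ?\<zeta> k)"
      unfolding ex sum_distrib_left sum_distrib_right by simp
    also have "\<dots> = (\<Sum>i\<in>{i\<in>{0..n}. i + k \<le> n}.
         of_nat (n choose i) * x ^ i * (of_nat ((n - i) choose k) * ?\<zeta> k * (- 1) ^ (n - i - k)))"
    proof (rule sum.cong)
      fix i assume i: "i \<in> {i\<in>{0..n}. i + k \<le> n}"
      have le: "i \<le> n - k" "k \<le> n - i" using i by auto
      have "(n choose k) * ((n - k) choose i) = (n choose i) * ((n - i) choose k)"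
        using choose_mult_lemma[of "n - k - i" k i] i k binomial_symmetric[of i n]
          binomial_symmetric[of k n] binomial_symmetric[OF le(1)] binomial_symmetric[OF le(2)]
        by (simp add: add.commute)
      then have eq: "(of_nat (n choose k) * of_nat ((n - k) choose i) :: complex) =
          of_nat (n choose i) * of_nat ((n - i) choose k)"
        by (simp only: of_nat_mult[symmetric])
      have "n - k - i = n - i - k" by simp
      then have "of_nat (n choose k) * (of_nat ((n - k) choose i) * x ^ i * (- 1) ^ (n - k - i)) * ?\<zeta> k =
         (of_nat (n choose k) * of_nat ((n - k) choose i)) * (x ^ i * ?\<zeta> k * (- 1) ^ (n - i - k))"
        by (simp only: mult_ac)
      then show "of_nat (n choose k) * (of_nat ((n - k) choose i) * x ^ i * (- 1) ^ (n - k - i)) * ?\<zeta> k =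
         of_nat (n choose i) * x ^ i * (of_nat ((n - i) choose k) * ?\<zeta> k * (- 1) ^ (n - i - k))"
        unfolding eq by (simp only: mult_ac)
    qed (use k in auto)
    finally show "of_nat (n choose k) * (x - 1) ^ (n - k) * ?\<zeta> k = \<dots>" .
  qed
  also have "\<dots> = (\<Sum>i=0..n. \<Sum>k\<in>{k\<in>{0..n}. i + k \<le> n}.
         of_nat (n choose i) * x ^ i * (of_nat ((n - i) choose k) * ?\<zeta> k * (- 1) ^ (n - i - k)))"
    by (rule sum.swap_restrict) auto
  also have "\<dots> = (\<Sum>i=0..n. of_nat (n choose i) * x ^ i * (?\<zeta> (n - i) + e (n - i)))"
  proof (rule sum.cong[OF refl])
    fix i assume "i \<in> {0..n}"
    then have "{k\<in>{0..n}. i + k \<le> n} = {0..n - i}" by auto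
    then show "(\<Sum>k\<in>{k\<in>{0..n}. i + k \<le> n}.
         of_nat (n choose i) * x ^ i * (of_nat ((n - i) choose k) * ?\<zeta> k * (- 1) ^ (n - i - k))) =
       of_nat (n choose i) * x ^ i * (?\<zeta> (n - i) + e (n - i))"
      unfolding e_def zeta_minus_nat_convolution[symmetric] by (simp only: sum_distrib_left)
  qed
  also have "\<dots> = (\<Sum>i=0..n. of_nat (n choose i) * x ^ i * ?\<zeta> (n - i))
      + (\<Sum>i=0..n. of_nat (n choose i) * x ^ i * e (n - i))"
    by (simp only: distrib_left sum.distrib)
  also have "(\<Sum>i=0..n. of_nat (n choose i) * x ^ i * ?\<zeta> (n - i)) =
      (\<Sum>k=0..n. of_nat (n choose k) * x ^ (n - k) * ?\<zeta> k)"
    by (rule sum.reindex_bij_witness[of _ "\<lambda>k. n - k" "\<lambda>k. n - k"])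
       (auto simp: binomial_symmetric[symmetric])
  finally have 1: "(\<Sum>k=0..n. of_nat (n choose k) * (x - 1) ^ (n - k) * ?\<zeta> k) =
      (\<Sum>k=0..n. of_nat (n choose k) * x ^ (n - k) * ?\<zeta> k)
      + (\<Sum>i=0..n. of_nat (n choose i) * x ^ i * e (n - i))" .
  have "1 / (of_nat n + 1) * (x - 1) ^ (n + 1) =
      (\<Sum>i=0..n. 1 / (of_nat n + 1) * (of_nat ((n + 1) choose i) * x ^ i * (- 1) ^ (n + 1 - i)))
      + 1 / (of_nat n + 1) * x ^ (n + 1)"
    by (subst ex) (simp add: sum_distrib_left distrib_left)
  also have "(\<Sum>i=0..n. 1 / (of_nat n + 1) * (of_nat ((n + 1) choose i) * x ^ i * (- 1) ^ (n + 1 - i))) =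
      (\<Sum>i=0..n. of_nat (n choose i) * x ^ i * (e (n - i) - (if i = n then 1 else 0)))"
  proof (rule sum.cong[OF refl])
    fix i assume i: "i \<in> {0..n}"
    have "1 / (of_nat n + 1) * (of_nat ((n + 1) choose i) * x ^ i * (- 1) ^ (n + 1 - i)) =
        (of_nat ((n + 1) choose i) / (of_nat n + 1)) * x ^ i * (- 1) ^ (n + 1 - i)"
      by simp
    also have "\<dots> = of_nat (n choose i) * x ^ i * ((- 1) ^ (n + 1 - i) / of_nat (n + 1 - i))"
      using i by (subst binomial_Suc_div) auto
    \<comment> \<open>At \<open>i = n\<close> the quotient is \<open>- 1\<close> whereas
      \<open>e 0 = 0\<close>; this single mismatch produces \<open>x ^ n\<close>.\<close>
    also have "(- 1) ^ (n + 1 - i) / of_nat (n + 1 - i) = e (n - i) - (if i = n then 1 else 0)"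
      using i by (auto simp: e_def Suc_diff_le)
    finally show "1 / (of_nat n + 1) * (of_nat ((n + 1) choose i) * x ^ i * (- 1) ^ (n + 1 - i)) =
        of_nat (n choose i) * x ^ i * (e (n - i) - (if i = n then 1 else 0))" .
  qed
  also have "\<dots> = (\<Sum>i=0..n. of_nat (n choose i) * x ^ i * e (n - i))
      - (\<Sum>i=0..n. if i = n then of_nat (n choose i) * x ^ i else 0)"
    unfolding right_diff_distrib sum_subtractf by (intro arg_cong2[where f = "(-)"] sum.cong refl) auto
  also have "(\<Sum>i=0..n. if i = n then of_nat (n choose i) * x ^ i else 0) = x ^ n"
    by (simp add: sum.delta)
  finally show ?thesis
    unfolding faulhaber_def 1 by (simp add: algebra_simps)
qed

text \<open>The difference telescopes over the half-open interval up to \<open>N\<close>. Its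
  endpoint is kept apart because it becomes the second term on the left of the theorem.\<close>

lemma sum_powers_faulhaber:
  assumes "M < N"
  shows "(\<Sum>x\<in>{M<..<N}. of_nat x ^ n) + of_nat N ^ n = faulhaber n (of_nat N) - faulhaber n (of_nat M)"
proof -
  have "(\<Sum>x\<in>{M<..N}. of_nat x ^ n) = faulhaber n (of_nat N) - faulhaber n (of_nat M)" if "M \<le> N" for N
    using that
  proof (induction N rule: dec_induct)
    case (step N)
    then have "{M<..Suc N} = insert (Suc N) {M<..N}" by auto
    then show ?case
      using step faulhaber_diff[of n "of_nat (Suc N)"] by (simp add: algebra_simps)
  qed simp
  from this[of N] have "(\<Sum>x\<in>{M<..N}. of_nat x ^ n) = faulhaber n (of_nat N) - faulhaber n (of_nat M)"
    using assms by simp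
  moreover have "{M<..N} = insert N {M<..<N}" using assms by auto
  ultimately show ?thesis by (simp add: add.commute)
qed

section \<open>The identity in the region of convergence\<close>

lemma has_sum_mzeta_series:
  assumes "r \<ge> 1" "s \<in> mzeta_region r"
  shows "((\<lambda>m. \<Prod>i=1..r. of_nat (m i) powr (- s i)) has_sum mzeta_series r s) (mztuples r)"
proof -
  have w: "wterm r (\<lambda>n z. of_nat n powr - z) s = (\<lambda>m. \<Prod>i=1..r. of_nat (m i) powr (- s i))"
  proof
    fix m
    show "wterm r (\<lambda>n z. of_nat n powr - z) s m = (\<Prod>i=1..r. of_nat (m i) powr (- s i))"
      using prod.last_plus[OF assms(1), of "\<lambda>i. complex_of_nat (m i) powr (- s i)"]
      by (simp add: wterm_def mult.commute)
  qed
  have "wterm r (\<lambda>n z. of_nat n powr - z) s summable_on mztuples r"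
    using wterm_summable[OF assms(1) _ weight_order_powr] assms(2) by (simp add: mzeta_strip_0)
  from has_sum_infsum[OF this] show ?thesis
    unfolding mzeta_series_eq_wsum[OF assms(1)] wsum_def w .
qed

lemma has_sum_mzeta_shift:
  assumes l: "l \<in> {1..q}" and t: "t(l := t l - of_nat p) \<in> mzeta_region q"
  shows "((\<lambda>m. (\<Prod>i=1..q. of_nat (m i) powr (- t i)) * of_nat (m l) ^ p)
    has_sum mzeta_series q (t(l := t l - of_nat p))) (mztuples q)"
proof -
  have "((\<lambda>m. \<Prod>i=1..q. of_nat (m i) powr (- (t(l := t l - of_nat p)) i))
      has_sum mzeta_series q (t(l := t l - of_nat p))) (mztuples q)"
    by (rule has_sum_mzeta_series[OF _ t]) (use l in simp)
  moreover have "(\<Prod>i=1..q. of_nat (m i) powr (- (t(l := t l - of_nat p)) i)) =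
      (\<Prod>i=1..q. of_nat (m i) powr (- t i)) * complex_of_nat (m l) ^ p" if "m \<in> mztuples q" for m
  proof -
    have "m l \<noteq> 0" using mztuplesD(1)[OF that l] by simp
    then have "of_nat (m l) powr (- (t l - of_nat p)) = of_nat (m l) powr (- t l) * complex_of_nat (m l) ^ p"
      by (simp add: powr_diff field_simps powr_minus)
    moreover have "(\<Prod>i\<in>{1..q} - {l}. of_nat (m i) powr (- (t(l := t l - of_nat p)) i)) =
        (\<Prod>i\<in>{1..q} - {l}. complex_of_nat (m i) powr (- t i))"
      by (rule prod.cong) auto
    ultimately show ?thesis
      using prod.remove[OF finite_atLeastAtMost l, of "\<lambda>i. complex_of_nat (m i) powr (- (t(l := t l - of_nat p)) i)"]
        prod.remove[OF finite_atLeastAtMost l, of "\<lambda>i. complex_of_nat (m i) powr (- t i)"]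
      by (simp only: fun_upd_same mult_ac)
  qed
  ultimately show ?thesis by (simp cong: has_sum_cong)
qed

text \<open>In the shortened tuple the two neighbours of the deleted entry sit at positions
  \<open>j - 1\<close> and \<open>j\<close>. The restriction keeps the result extensional, so that
  insertion is an exact inverse.\<close>

definition delete_entry :: "nat \<Rightarrow> nat \<Rightarrow> (nat \<Rightarrow> nat) \<Rightarrow> nat \<Rightarrow> nat" where
  "delete_entry q j m = restrict (\<lambda>i. if i < j then m i else m (i + 1)) {1..q}"

definition insert_entry :: "nat \<Rightarrow> nat \<Rightarrow> (nat \<Rightarrow> nat) \<Rightarrow> nat \<Rightarrow> nat \<Rightarrow> nat" where
  "insert_entry q j m x = restrict (\<lambda>i. if i < j then m i else if i = j then x else m (i - 1)) {1..Suc q}"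

lemma delete_entry_mztuples:
  assumes j: "j \<in> {2..q}" and m: "m \<in> mztuples (Suc q)"
  shows "delete_entry q j m \<in> mztuples q"
    "m j \<in> {delete_entry q j m (j - 1)<..<delete_entry q j m j}"
    "insert_entry q j (delete_entry q j m) (m j) = m"
proof -
  show "delete_entry q j m \<in> mztuples q"
    unfolding mztuples_def
  proof (intro CollectI conjI strict_mono_onI)
    show "delete_entry q j m \<in> {1..q} \<rightarrow>\<^sub>E {0<..}"
      using mztuplesD(1)[OF m] by (auto simp: delete_entry_def)
    fix a b assume "a \<in> {1..q}" "b \<in> {1..q}" "a < b"
    then show "delete_entry q j m a < delete_entry q j m b"
      using mztuplesD(2)[OF m, of a b] mztuplesD(2)[OF m, of a "b + 1"] mztuplesD(2)[OF m, of "a + 1" "b + 1"]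
      by (auto simp: delete_entry_def)
  qed
  show "m j \<in> {delete_entry q j m (j - 1)<..<delete_entry q j m j}"
    using mztuplesD(2)[OF m, of "j - 1" j] mztuplesD(2)[OF m, of j "j + 1"] j
    by (auto simp: delete_entry_def)
  have "m \<in> extensional {1..Suc q}" using m by (auto simp: mztuples_def PiE_iff)
  then show "insert_entry q j (delete_entry q j m) (m j) = m"
    using j by (auto simp: insert_entry_def delete_entry_def fun_eq_iff extensional_def)
qed

lemma insert_entry_mztuples:
  assumes j: "j \<in> {2..q}" and m: "m \<in> mztuples q" and x: "x \<in> {m (j - 1)<..<m j}"
  shows "insert_entry q j m x \<in> mztuples (Suc q)"
    "delete_entry q j (insert_entry q j m x) = m" "insert_entry q j m x j = x"
proof -
  have lo: "m a < x" if "1 \<le> a" "a < j" for a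
  proof (cases "a = j - 1")
    case False
    then have "a < j - 1" "j - 1 \<le> q" using that j by auto
    then show ?thesis using mztuplesD(2)[OF m, of a "j - 1"] that x by auto
  qed (use x in simp)
  have hi: "x < m a" if "j \<le> a" "a \<le> q" for a
    using mztuplesD(2)[OF m, of j a] that j x by (cases "a = j") auto
  show "insert_entry q j m x \<in> mztuples (Suc q)"
    unfolding mztuples_def
  proof (intro CollectI conjI strict_mono_onI)
    have "0 < insert_entry q j m x i" if "i \<in> {1..Suc q}" for i
    proof (cases "i \<le> j")
      case True
      then show ?thesis using mztuplesD(1)[OF m, of i] that j x by (auto simp: insert_entry_def)
    next
      case False
      then have "i - 1 \<in> {1..q}" using that j by auto
      then show ?thesis
        using mztuplesD(1)[OF m, of "i - 1"] False that by (simp add: insert_entry_def)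
    qed
    then show "insert_entry q j m x \<in> {1..Suc q} \<rightarrow>\<^sub>E {0<..}"
      by (auto simp: PiE_iff insert_entry_def extensional_def)
    fix a b assume "a \<in> {1..Suc q}" "b \<in> {1..Suc q}" "a < b"
    then show "insert_entry q j m x a < insert_entry q j m x b"
      using mztuplesD(2)[OF m, of a b] mztuplesD(2)[OF m, of a "b - 1"] mztuplesD(2)[OF m, of "a - 1" "b - 1"]
        lo[of a] hi[of "b - 1"] j
      by (auto simp: insert_entry_def)
  qed
  have "m \<in> extensional {1..q}" using m by (auto simp: mztuples_def PiE_iff)
  then show "delete_entry q j (insert_entry q j m x) = m"
    using j by (auto simp: insert_entry_def delete_entry_def fun_eq_iff extensional_def)
  show "insert_entry q j m x j = x" using j by (auto simp: insert_entry_def)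
qed

text \<open>Summing over entry \<open>j\<close> first: with exponent \<open>- n\<close> it
  contributes \<open>x ^ n\<close>, over the finite interval strictly between its
  neighbours.\<close>

lemma has_sum_mzeta_insert:
  assumes j: "j \<in> {2..q}" and u: "u(j := - of_nat n) \<in> mzeta_region (Suc q)"
  shows "((\<lambda>m. (\<Prod>i=1..q. of_nat (m i) powr (- omit j u i)) * (\<Sum>x\<in>{m (j - 1)<..<m j}. of_nat x ^ n))
    has_sum mzeta_series (Suc q) (u(j := - of_nat n))) (mztuples q)"
proof -
  define v where "v = u(j := - of_nat n)"
  define W where "W = (\<lambda>m. \<Prod>i=1..q. complex_of_nat (m i) powr (- omit j u i))"
  define h where "h = (\<lambda>(m, x). W m * complex_of_nat x ^ n)"
  define B where "B = (\<lambda>m::nat \<Rightarrow> nat. {m (j - 1)<..<m j})"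
  have "((\<lambda>m. \<Prod>i=1..Suc q. of_nat (m i) powr (- v i)) has_sum mzeta_series (Suc q) v) (mztuples (Suc q))"
    unfolding v_def by (rule has_sum_mzeta_series[OF _ u]) simp
  moreover have "((\<lambda>m. \<Prod>i=1..Suc q. of_nat (m i) powr (- v i)) has_sum S) (mztuples (Suc q)) \<longleftrightarrow>
      (h has_sum S) (Sigma (mztuples q) B)" for S
  proof (rule has_sum_reindex_bij_witness[of _ "\<lambda>(m, x). insert_entry q j m x" "\<lambda>m. (delete_entry q j m, m j)"])
    fix m assume m: "m \<in> mztuples (Suc q)"
    note d = delete_entry_mztuples[OF j m]
    show "(case (delete_entry q j m, m j) of (m, x) \<Rightarrow> insert_entry q j m x) = m" using d by simp
    show "(delete_entry q j m, m j) \<in> Sigma (mztuples q) B" using d by (simp add: B_def)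
    have jj: "j \<in> {1..Suc q}" using j by auto
    have "m j \<noteq> 0" using mztuplesD(1)[OF m jj] by simp
    then have "of_nat (m j) powr (- v j) = complex_of_nat (m j) ^ n" by (simp add: v_def)
    moreover have "(\<Prod>i\<in>{1..Suc q} - {j}. complex_of_nat (m i) powr (- v i)) = W (delete_entry q j m)"
      unfolding W_def
      by (rule prod.reindex_bij_witness[of _ "\<lambda>i. if i < j then i else i + 1" "\<lambda>i. if i < j then i else i - 1"])
         (use j in \<open>auto simp: v_def omit_def delete_entry_def\<close>)
    ultimately show "h (delete_entry q j m, m j) = (\<Prod>i=1..Suc q. of_nat (m i) powr (- v i))"
      using prod.remove[OF finite_atLeastAtMost jj, of "\<lambda>i. complex_of_nat (m i) powr (- v i)"]
      unfolding h_def prod.case by (simp only: mult.commute)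
  next
    fix b assume "b \<in> Sigma (mztuples q) B"
    then obtain m x where b: "b = (m, x)" "m \<in> mztuples q" "x \<in> {m (j - 1)<..<m j}"
      by (auto simp: B_def)
    note i = insert_entry_mztuples[OF j b(2,3)]
    show "(delete_entry q j (case b of (m, x) \<Rightarrow> insert_entry q j m x),
        (case b of (m, x) \<Rightarrow> insert_entry q j m x) j) = b" using i by (simp add: b)
    show "(case b of (m, x) \<Rightarrow> insert_entry q j m x) \<in> mztuples (Suc q)" using i by (simp add: b)
  qed (rule refl)
  ultimately have "(h has_sum mzeta_series (Suc q) v) (Sigma (mztuples q) B)" by simp
  then have "((\<lambda>m. W m * (\<Sum>x\<in>{m (j - 1)<..<m j}. of_nat x ^ n)) has_sum mzeta_series (Suc q) v) (mztuples q)"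
  proof (rule has_sum_SigmaD)
    fix m
    show "((\<lambda>x. h (m, x)) has_sum W m * (\<Sum>x\<in>{m (j - 1)<..<m j}. of_nat x ^ n)) (B m)"
      unfolding h_def B_def prod.case by (intro has_sum_cmult_right has_sum_finite) auto
  qed
  then show ?thesis by (simp only: W_def v_def)
qed

text \<open>Each power of \<open>m l\<close> in the polynomial lowers the argument
  \<open>t l\<close> by its degree. Degrees up to \<open>n + 1\<close> occur, hence the convergence
  hypothesis for all \<open>p \<le> n + 1\<close>.\<close>

lemma has_sum_faulhaber:
  assumes l: "l \<in> {1..q}" and t: "\<And>p. p \<le> n + 1 \<Longrightarrow> t(l := t l - of_nat p) \<in> mzeta_region q"
  shows "((\<lambda>m. (\<Prod>i=1..q. of_nat (m i) powr (- t i)) * faulhaber n (of_nat (m l))) has_sum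
    1 / (of_nat n + 1) * mzeta_series q (t(l := t l - of_nat (n + 1)))
     - (\<Sum>k=0..n. of_nat (n choose k) * mzeta_series q (t(l := t l - of_nat (n - k)))
          * mzeta 1 (vec1 (- of_nat k)))) (mztuples q)"
proof -
  define W where "W = (\<lambda>m. \<Prod>i=1..q. complex_of_nat (m i) powr (- t i))"
  define c where "c = (\<lambda>k. of_nat (n choose k) * mzeta 1 (vec1 (- of_nat k)))"
  have h: "((\<lambda>m. W m * of_nat (m l) ^ p) has_sum mzeta_series q (t(l := t l - of_nat p))) (mztuples q)"
    if "p \<le> n + 1" for p
    unfolding W_def by (rule has_sum_mzeta_shift[OF l t[OF that]])
  have "((\<lambda>m. 1 / (of_nat n + 1) * (W m * of_nat (m l) ^ (n + 1)) + - (\<Sum>k=0..n. c k * (W m * of_nat (m l) ^ (n - k))))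
    has_sum 1 / (of_nat n + 1) * mzeta_series q (t(l := t l - of_nat (n + 1)))
      + - (\<Sum>k=0..n. c k * mzeta_series q (t(l := t l - of_nat (n - k))))) (mztuples q)"
    by (intro has_sum_add has_sum_cmult_right h has_sum_uminusI has_sum_finite_sum) auto
  moreover have "1 / (of_nat n + 1) * (W m * of_nat (m l) ^ (n + 1)) + - (\<Sum>k=0..n. c k * (W m * of_nat (m l) ^ (n - k)))
      = W m * faulhaber n (of_nat (m l))" for m
    unfolding faulhaber_def right_diff_distrib sum_distrib_left c_def by (simp add: mult_ac)
  moreover have "(\<Sum>k=0..n. c k * mzeta_series q (t(l := t l - of_nat (n - k)))) =
      (\<Sum>k=0..n. of_nat (n choose k) * mzeta_series q (t(l := t l - of_nat (n - k))) * mzeta 1 (vec1 (- of_nat k)))"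
    by (rule sum.cong) (simp_all add: c_def mult_ac del: fun_upd_apply)
  ultimately show ?thesis unfolding W_def by simp
qed

text \<open>Both sides are sums over the same \<open>q\<close>-tuples and agree term by term, by the
  power sum formula between \<open>m (j - 1)\<close> and \<open>m j\<close>.\<close>

lemma mzeta_series_identity:
  assumes j: "j \<in> {2..q}" and u: "u(j := - of_nat n) \<in> mzeta_region (Suc q)"
    and t: "t = omit j u"
    and tj: "\<And>p. p \<le> n + 1 \<Longrightarrow> t(j := t j - of_nat p) \<in> mzeta_region q"
    and ti: "\<And>p. p \<le> n + 1 \<Longrightarrow> t(j - 1 := t (j - 1) - of_nat p) \<in> mzeta_region q"
  shows "mzeta_series (Suc q) (u(j := - of_nat n)) + mzeta_series q (t(j := t j - of_nat n)) =
    - (1 / (of_nat n + 1)) * mzeta_series q (t(j - 1 := t (j - 1) - of_nat (n + 1)))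
    + 1 / (of_nat n + 1) * mzeta_series q (t(j := t j - of_nat (n + 1)))
    + (\<Sum>k=0..n. of_nat (n choose k) * mzeta_series q (t(j - 1 := t (j - 1) - of_nat (n - k)))
        * mzeta 1 (vec1 (- of_nat k)))
    - (\<Sum>k=0..n. of_nat (n choose k) * mzeta_series q (t(j := t j - of_nat (n - k)))
        * mzeta 1 (vec1 (- of_nat k)))" (is "?L = ?R")
proof -
  define W where "W = (\<lambda>m. \<Prod>i=1..q. complex_of_nat (m i) powr (- t i))"
  have jq: "j \<in> {1..q}" "j - 1 \<in> {1..q}" using j by auto
  have "((\<lambda>m. W m * (\<Sum>x\<in>{m (j - 1)<..<m j}. of_nat x ^ n) + W m * of_nat (m j) ^ n) has_sum ?L) (mztuples q)"
    unfolding W_def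
    by (intro has_sum_add has_sum_mzeta_shift jq tj has_sum_mzeta_insert[OF j u, folded t]) simp
  moreover have "((\<lambda>m. W m * faulhaber n (of_nat (m j)) + - (W m * faulhaber n (of_nat (m (j - 1))))) has_sum
      (1 / (of_nat n + 1) * mzeta_series q (t(j := t j - of_nat (n + 1)))
     - (\<Sum>k=0..n. of_nat (n choose k) * mzeta_series q (t(j := t j - of_nat (n - k)))
          * mzeta 1 (vec1 (- of_nat k)))) +
      - (1 / (of_nat n + 1) * mzeta_series q (t(j - 1 := t (j - 1) - of_nat (n + 1)))
     - (\<Sum>k=0..n. of_nat (n choose k) * mzeta_series q (t(j - 1 := t (j - 1) - of_nat (n - k)))
          * mzeta 1 (vec1 (- of_nat k))))) (mztuples q)" (is "(_ has_sum ?R') _")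
    unfolding W_def by (intro has_sum_add has_sum_uminusI has_sum_faulhaber jq tj ti)
  moreover have "W m * (\<Sum>x\<in>{m (j - 1)<..<m j}. of_nat x ^ n) + W m * of_nat (m j) ^ n =
      W m * faulhaber n (of_nat (m j)) + - (W m * faulhaber n (of_nat (m (j - 1))))" if "m \<in> mztuples q" for m
  proof -
    have "m (j - 1) < m j" using mztuplesD(2)[OF that jq(2), of j] j by simp
    from sum_powers_faulhaber[OF this, of n] show ?thesis
      by (simp only: distrib_left[symmetric] diff_conv_add_uminus mult_minus_right[symmetric])
  qed
  ultimately have "?L = ?R'"
    using has_sum_unique has_sum_cong[of "mztuples q"] by (smt (verit))
  then show ?thesis by (simp only:) (simp add: algebra_simps del: fun_upd_apply)
qed

section \<open>Meromorphic identities by continuation\<close>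

text \<open>Fixing one point \<open>p\<close> off the exceptional zero set makes these notions closed under finite combinations.\<close>

definition generic :: "nat set \<Rightarrow> (nat \<Rightarrow> complex) \<Rightarrow> ((nat \<Rightarrow> complex) \<Rightarrow> bool) \<Rightarrow> bool" where
  "generic I p P \<longleftrightarrow>
     (\<exists>h. holo_several I (cspace I) h \<and> h p \<noteq> 0 \<and> (\<forall>s\<in>cspace I. h s \<noteq> 0 \<longrightarrow> P s))"

lemma openin_cspace: "openin (top_of_set (cspace I)) (cspace I)"
  by simp

lemma generic_True: "(\<And>s. P s) \<Longrightarrow> generic I p P"
  unfolding generic_def by (rule exI[of _ "\<lambda>_. 1"]) (simp add: holo_several_const[OF openin_cspace])

lemma generic_conj:
  assumes "generic I p P" "generic I p Q" shows "generic I p (\<lambda>s. P s \<and> Q s)"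
proof -
  obtain h where h: "holo_several I (cspace I) h" "h p \<noteq> 0" "\<And>s. s \<in> cspace I \<Longrightarrow> h s \<noteq> 0 \<Longrightarrow> P s"
    using assms(1) unfolding generic_def by blast
  obtain k where k: "holo_several I (cspace I) k" "k p \<noteq> 0" "\<And>s. s \<in> cspace I \<Longrightarrow> k s \<noteq> 0 \<Longrightarrow> Q s"
    using assms(2) unfolding generic_def by blast
  show ?thesis unfolding generic_def
    by (rule exI[of _ "\<lambda>s. h s * k s"]) (use h k holo_several_mult[OF h(1) k(1)] in simp)
qed

lemma generic_ball:
  assumes "finite X" "\<And>k. k \<in> X \<Longrightarrow> generic I p (P k)"
  shows "generic I p (\<lambda>s. \<forall>k\<in>X. P k s)"
  using assms by (induction X rule: finite_induct) (simp_all add: generic_True generic_conj)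

definition quotient_at :: "nat set \<Rightarrow> (nat \<Rightarrow> complex) \<Rightarrow> ((nat \<Rightarrow> complex) \<Rightarrow> complex) \<Rightarrow> bool" where
  "quotient_at I p f \<longleftrightarrow> (\<exists>g h. holo_several I (cspace I) g \<and> holo_several I (cspace I) h \<and> h p \<noteq> 0 \<and>
     (\<forall>s\<in>cspace I. h s \<noteq> 0 \<longrightarrow> f s = g s / h s))"

lemma quotient_atI:
  "holo_several I (cspace I) g \<Longrightarrow> holo_several I (cspace I) h \<Longrightarrow> h p \<noteq> 0 \<Longrightarrow>
     (\<And>s. s \<in> cspace I \<Longrightarrow> h s \<noteq> 0 \<Longrightarrow> f s = g s / h s) \<Longrightarrow> quotient_at I p f"
  unfolding quotient_at_def by (intro exI[of _ g] exI[of _ h]) simp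

lemma quotient_at_const: "quotient_at I p (\<lambda>s. c)"
  by (rule quotient_atI[of I "\<lambda>_. c" "\<lambda>_. 1"]) (simp_all add: holo_several_const[OF openin_cspace])

lemma quotient_at_mult:
  assumes "quotient_at I p f" "quotient_at I p f'" shows "quotient_at I p (\<lambda>s. f s * f' s)"
proof -
  obtain g h where 1: "holo_several I (cspace I) g \<and> holo_several I (cspace I) h \<and> h p \<noteq> 0 \<and>
      (\<forall>s\<in>cspace I. h s \<noteq> 0 \<longrightarrow> f s = g s / h s)"
    using assms(1) unfolding quotient_at_def by (elim exE) (rule that)
  then have 1: "holo_several I (cspace I) g" "holo_several I (cspace I) h" "h p \<noteq> 0"
    "\<And>s. s \<in> cspace I \<Longrightarrow> h s \<noteq> 0 \<Longrightarrow> f s = g s / h s" by blast+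
  obtain g' h' where 2: "holo_several I (cspace I) g' \<and> holo_several I (cspace I) h' \<and> h' p \<noteq> 0 \<and>
      (\<forall>s\<in>cspace I. h' s \<noteq> 0 \<longrightarrow> f' s = g' s / h' s)"
    using assms(2) unfolding quotient_at_def by (elim exE) (rule that)
  then have 2: "holo_several I (cspace I) g'" "holo_several I (cspace I) h'" "h' p \<noteq> 0"
    "\<And>s. s \<in> cspace I \<Longrightarrow> h' s \<noteq> 0 \<Longrightarrow> f' s = g' s / h' s" by blast+
  show ?thesis
    by (rule quotient_atI[OF holo_several_mult[OF 1(1) 2(1)] holo_several_mult[OF 1(2) 2(2)]])
       (use 1 2 in auto)
qed

lemma quotient_at_add:
  assumes "quotient_at I p f" "quotient_at I p f'" shows "quotient_at I p (\<lambda>s. f s + f' s)"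
proof -
  obtain g h where 1: "holo_several I (cspace I) g \<and> holo_several I (cspace I) h \<and> h p \<noteq> 0 \<and>
      (\<forall>s\<in>cspace I. h s \<noteq> 0 \<longrightarrow> f s = g s / h s)"
    using assms(1) unfolding quotient_at_def by (elim exE) (rule that)
  then have 1: "holo_several I (cspace I) g" "holo_several I (cspace I) h" "h p \<noteq> 0"
    "\<And>s. s \<in> cspace I \<Longrightarrow> h s \<noteq> 0 \<Longrightarrow> f s = g s / h s" by blast+
  obtain g' h' where 2: "holo_several I (cspace I) g' \<and> holo_several I (cspace I) h' \<and> h' p \<noteq> 0 \<and>
      (\<forall>s\<in>cspace I. h' s \<noteq> 0 \<longrightarrow> f' s = g' s / h' s)"
    using assms(2) unfolding quotient_at_def by (elim exE) (rule that)
  then have 2: "holo_several I (cspace I) g'" "holo_several I (cspace I) h'" "h' p \<noteq> 0"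
    "\<And>s. s \<in> cspace I \<Longrightarrow> h' s \<noteq> 0 \<Longrightarrow> f' s = g' s / h' s" by blast+
  show ?thesis
    by (rule quotient_atI[OF holo_several_add[OF holo_several_mult[OF 1(1) 2(2)] holo_several_mult[OF 2(1) 1(2)]]
          holo_several_mult[OF 1(2) 2(2)]])
       (use 1 2 in \<open>auto simp: add_frac_eq\<close>)
qed

lemma quotient_at_diff:
  assumes "quotient_at I p f" "quotient_at I p f'" shows "quotient_at I p (\<lambda>s. f s - f' s)"
  using quotient_at_add[OF assms(1) quotient_at_mult[OF quotient_at_const[of I p "- 1"] assms(2)]] by simp

lemma quotient_at_sum:
  assumes "\<And>k. k \<in> X \<Longrightarrow> quotient_at I p (f k)"
  shows "quotient_at I p (\<lambda>s. \<Sum>k\<in>X. f k s)"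
  using assms
  by (induction X rule: infinite_finite_induct) (simp_all add: quotient_at_const quotient_at_add)

text \<open>Both denominators are nonzero at \<open>p\<close>, so agreement on \<open>E\<close>
  makes the cross difference of the two quotients vanish near \<open>p\<close>, hence everywhere.
  This gives equality on a dense set; holomorphy on \<open>D\<close> extends it to every point of
  \<open>D\<close>, including zeros of the chosen denominators.\<close>

lemma mero_identityI:
  assumes I: "finite I" and p: "p \<in> cspace I" and F: "quotient_at I p F" and G: "quotient_at I p G"
    and E: "openin (top_of_set (cspace I)) E" "p \<in> E" "\<And>s. s \<in> E \<Longrightarrow> F s = G s"
    and D: "openin (top_of_set (cspace I)) D" "generic I p (\<lambda>s. s \<in> D)"
      "holo_several I D F" "holo_several I D G"
  shows "mero_identity I D F G"
proof -
  obtain a b where F': "holo_several I (cspace I) a \<and> holo_several I (cspace I) b \<and> b p \<noteq> 0 \<and>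
      (\<forall>s\<in>cspace I. b s \<noteq> 0 \<longrightarrow> F s = a s / b s)"
    using F unfolding quotient_at_def by (elim exE) (rule that)
  then have F': "holo_several I (cspace I) a" "holo_several I (cspace I) b" "b p \<noteq> 0"
    "\<And>s. s \<in> cspace I \<Longrightarrow> b s \<noteq> 0 \<Longrightarrow> F s = a s / b s" by blast+
  obtain c d where G': "holo_several I (cspace I) c \<and> holo_several I (cspace I) d \<and> d p \<noteq> 0 \<and>
      (\<forall>s\<in>cspace I. d s \<noteq> 0 \<longrightarrow> G s = c s / d s)"
    using G unfolding quotient_at_def by (elim exE) (rule that)
  then have G': "holo_several I (cspace I) c" "holo_several I (cspace I) d" "d p \<noteq> 0"
    "\<And>s. s \<in> cspace I \<Longrightarrow> d s \<noteq> 0 \<Longrightarrow> G s = c s / d s" by blast+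
  have m: "mero_several I F" "mero_several I G"
    using mero_several_quotient[OF I F'(1,2) p F'(3,4)] mero_several_quotient[OF I G'(1,2) p G'(3,4)]
    by simp_all
  have FG: "F s = G s \<longleftrightarrow> a s * d s - c s * b s = 0" if "s \<in> cspace I" "b s * d s \<noteq> 0" for s
    using F'(4)[OF that(1)] G'(4)[OF that(1)] that(2) by (simp add: frac_eq_eq)
  have bd: "holo_several I (cspace I) (\<lambda>s. b s * d s)"
    by (intro holo_several_mult F' G')
  define N where "N = {s \<in> cspace I. b s * d s \<noteq> 0}"
  have "a s * d s - c s * b s = 0" if "s \<in> cspace I" for s
  proof (rule holo_several_cspace_zero[OF I _ _ _ _ that])
    show "holo_several I (cspace I) (\<lambda>s. a s * d s - c s * b s)"
      by (intro holo_several_diff holo_several_mult F' G')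
    show "openin (top_of_set (cspace I)) {s \<in> E. b s * d s \<noteq> 0}"
      by (rule openin_nonzero[OF bd E(1) openin_imp_subset[OF E(1)]])
    show "{s \<in> E. b s * d s \<noteq> 0} \<noteq> {}" using E(2) F'(3) G'(3) by auto
    show "a s * d s - c s * b s = 0" if "s \<in> {s \<in> E. b s * d s \<noteq> 0}" for s
      using FG[of s] E(3)[of s] that openin_imp_subset[OF E(1)] by auto
  qed
  then have FN: "F s = G s" if "s \<in> N" for s using FG[of s] that by (simp add: N_def)
  have N: "cspace I \<subseteq> closure N"
    unfolding N_def by (rule holo_several_cspace_dense[OF I bd p]) (use F' G' in simp)
  have Dsub: "D \<subseteq> cspace I" by (rule openin_imp_subset[OF D(1)])
  have DN: "D \<subseteq> closure (D \<inter> N)"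
    by (rule closure_Int_openin[OF D(1) closure_subset _ D(1)]) (use N Dsub in \<open>auto simp: N_def\<close>)
  have "F s = G s" if "s \<in> D" for s
  proof -
    have "F s - G s = 0"
      by (rule continuous_zero_closure[OF holo_severalD(2)[OF holo_several_diff[OF D(3,4)]], of "D \<inter> N"])
         (use that DN FN in auto)
    then show ?thesis by simp
  qed
  moreover have "cspace I \<subseteq> closure D"
  proof -
    obtain h where h: "holo_several I (cspace I) h" "h p \<noteq> 0" "\<And>s. s \<in> cspace I \<Longrightarrow> h s \<noteq> 0 \<Longrightarrow> s \<in> D"
      using D(2) unfolding generic_def by blast
    have "closure {s \<in> cspace I. h s \<noteq> 0} \<subseteq> closure D"
      by (rule closure_mono) (use h in blast)
    then show ?thesis using holo_several_cspace_dense[OF I h(1) p h(2)] by blast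
  qed
  ultimately show ?thesis unfolding mero_identity_def using m D(1) by simp
qed

section \<open>Restriction and substitution of arguments\<close>

definition coord_map :: "nat set \<Rightarrow> nat \<Rightarrow> ((nat \<Rightarrow> complex) \<Rightarrow> nat \<Rightarrow> complex) \<Rightarrow> bool" where
  "coord_map I R \<phi> \<longleftrightarrow> (\<forall>s\<in>cspace I. \<phi> s \<in> cspace {1..R}) \<and> continuous_on (cspace I) \<phi> \<and>
     (\<forall>s\<in>cspace I. \<forall>i\<in>I. \<exists>j\<in>{1..R}. \<exists>a. \<forall>z. \<phi> (s(i := z)) = (\<phi> s)(j := \<phi> s j + a * (z - s i)))"

lemma coord_mapD:
  assumes "coord_map I R \<phi>"
  shows "\<forall>s\<in>cspace I. \<phi> s \<in> cspace {1..R}" "continuous_on (cspace I) \<phi>"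
    "\<forall>s\<in>cspace I. \<forall>i\<in>I. \<exists>j\<in>{1..R}. \<exists>a. \<forall>z. \<phi> (s(i := z)) = (\<phi> s)(j := \<phi> s j + a * (z - s i))"
proof -
  note d = assms[unfolded coord_map_def]
  show "\<forall>s\<in>cspace I. \<phi> s \<in> cspace {1..R}" by (rule conjunct1[OF d])
  show "continuous_on (cspace I) \<phi>" by (rule conjunct1[OF conjunct2[OF d]])
  show "\<forall>s\<in>cspace I. \<forall>i\<in>I. \<exists>j\<in>{1..R}. \<exists>a. \<forall>z. \<phi> (s(i := z)) = (\<phi> s)(j := \<phi> s j + a * (z - s i))"
    by (rule conjunct2[OF conjunct2[OF d]])
qed

lemma holo_several_coord_map:
  assumes "coord_map I R \<phi>" "holo_several {1..R} V f" "openin (top_of_set (cspace I)) U"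
    "\<And>s. s \<in> U \<Longrightarrow> \<phi> s \<in> V"
  shows "holo_several I U (\<lambda>s. f (\<phi> s))"
proof (rule holo_several_subst[OF assms(2,3) _ assms(4)])
  have U: "U \<subseteq> cspace I" by (rule openin_imp_subset[OF assms(3)])
  show "continuous_on U \<phi>"
    by (rule continuous_on_subset[OF coord_mapD(2)[OF assms(1)] U])
  show "\<exists>j\<in>{1..R}. \<exists>a. \<forall>z. \<phi> (s(i := z)) = (\<phi> s)(j := \<phi> s j + a * (z - s i))" if "s \<in> U" "i \<in> I" for s i
    by (rule bspec[OF bspec[OF coord_mapD(3)[OF assms(1)]]]) (use that U in auto)
qed

text \<open>Since \<open>\<phi> p\<close> lies in the region of convergence, \<open>zden R\<close>
  is nonzero there and its pullback does not vanish identically. This is what keeps the image of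
  \<open>\<phi>\<close>, in particular the set \<open>s_j = -n\<close>, from lying inside the
  candidate polar set.\<close>

lemma mzeta_coord_map:
  assumes R: "R \<ge> 1" and \<phi>: "coord_map I R \<phi>" and p: "p \<in> cspace I" "\<phi> p \<in> mzeta_region R"
  shows "generic I p (\<lambda>s. mzeta_regular R (\<phi> s))" "quotient_at I p (\<lambda>s. mzeta R (\<phi> s))"
    "openin (top_of_set (cspace I)) {s \<in> cspace I. mzeta_regular R (\<phi> s)}"
    "holo_several I {s \<in> cspace I. mzeta_regular R (\<phi> s)} (\<lambda>s. mzeta R (\<phi> s))"
proof -
  obtain F where F: "holo_several {1..R} (cspace {1..R}) F"
    "\<And>s. s \<in> mzeta_region R \<Longrightarrow> F s = zden R s * mzeta_series R s"
    "\<And>s. s \<in> cspace {1..R} \<Longrightarrow> zden R s \<noteq> 0 \<Longrightarrow> mzeta_regular R s"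
    "\<And>s. s \<in> cspace {1..R} \<Longrightarrow> zden R s \<noteq> 0 \<Longrightarrow> mzeta R s = F s / zden R s"
    using mzeta_numerator_obtain[OF R] by blast
  have c: "\<phi> s \<in> cspace {1..R}" if "s \<in> cspace I" for s
    by (rule bspec[OF coord_mapD(1)[OF \<phi>] that])
  have hF: "holo_several I (cspace I) (\<lambda>s. F (\<phi> s))"
    by (rule holo_several_coord_map[OF \<phi> F(1) openin_cspace c])
  have hH: "holo_several I (cspace I) (\<lambda>s. zden R (\<phi> s))"
    by (rule holo_several_coord_map[OF \<phi> holo_several_zden[OF openin_cspace] openin_cspace c])
  have nz: "zden R (\<phi> p) \<noteq> 0" by (rule zden_nz[OF p(2) R])
  show "generic I p (\<lambda>s. mzeta_regular R (\<phi> s))"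
    unfolding generic_def by (rule exI[of _ "\<lambda>s. zden R (\<phi> s)"]) (simp add: hH nz F(3)[OF c])
  show "quotient_at I p (\<lambda>s. mzeta R (\<phi> s))"
    by (rule quotient_atI[OF hF hH nz]) (rule F(4)[OF c])
  note reg = holo_severalD[OF holo_several_mzeta[of R]]
  have "openin (top_of_set (cspace I)) (cspace I \<inter> \<phi> -` {s. mzeta_regular R s})"
    by (rule continuous_openin_preimage[OF coord_mapD(2)[OF \<phi>] _ reg(1)]) (use c in auto)
  moreover have "cspace I \<inter> \<phi> -` {s. mzeta_regular R s} = {s \<in> cspace I. mzeta_regular R (\<phi> s)}" by auto
  ultimately show o: "openin (top_of_set (cspace I)) {s \<in> cspace I. mzeta_regular R (\<phi> s)}" by simp
  show "holo_several I {s \<in> cspace I. mzeta_regular R (\<phi> s)} (\<lambda>s. mzeta R (\<phi> s))"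
    by (rule holo_several_coord_map[OF \<phi> holo_several_mzeta o]) simp
qed

lemma coord_map_fix:
  assumes "j \<in> {1..r}"
  shows "coord_map ({1..r} - {j}) r (\<lambda>s. s(j := c))"
  unfolding coord_map_def
proof (intro conjI ballI)
  show "continuous_on (cspace ({1..r} - {j})) (\<lambda>s. s(j := c))"
  proof (rule continuous_on_coordinatewise_then_product)
    fix k show "continuous_on (cspace ({1..r} - {j})) (\<lambda>s. (s(j := c)) k)"
      by (cases "k = j") (auto intro!: continuous_intros continuous_on_coordinate)
  qed
next
  fix s :: "nat \<Rightarrow> complex" and i assume i: "i \<in> {1..r} - {j}"
  show "\<exists>k\<in>{1..r}. \<exists>a. \<forall>z. (s(i := z))(j := c) = (s(j := c))(k := (s(j := c)) k + a * (z - s i))"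
    by (rule bexI[of _ i], rule exI[of _ 1]) (use i in \<open>auto simp: fun_eq_iff\<close>)
qed (use assms in \<open>auto simp: cspace_def\<close>)

text \<open>The function \<open>f\<close> is kept apart from its normal form \<open>z + c\<close> so
  that the lemma matches shifts in the shape written in the theorem.\<close>

lemma coord_map_omit:
  assumes "j \<in> {1..q}" "l \<in> {1..Suc q} - {j}" and f: "\<And>z. f z = z + c"
  shows "coord_map ({1..Suc q} - {j}) q (\<lambda>s. omit j (s(l := f (s l))))"
  unfolding coord_map_def f
proof (intro conjI ballI)
  let ?C = "cspace ({1..Suc q} - {j})"
  show "continuous_on ?C (\<lambda>s. omit j (s(l := s l + c)))"
  proof (rule continuous_on_coordinatewise_then_product)
    fix k
    have "continuous_on ?C (\<lambda>s. (s(l := s l + c)) i)" for i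
      by (cases "i = l") (auto intro!: continuous_intros continuous_on_coordinate)
    then show "continuous_on ?C (\<lambda>s. omit j (s(l := s l + c)) k)"
      unfolding omit_def by (cases "k < j") simp_all
  qed
next
  fix s :: "nat \<Rightarrow> complex" and i assume i: "i \<in> {1..Suc q} - {j}"
  show "\<exists>k\<in>{1..q}. \<exists>a. \<forall>z. omit j ((s(i := z))(l := (s(i := z)) l + c)) =
      (omit j (s(l := s l + c)))(k := omit j (s(l := s l + c)) k + a * (z - s i))"
    by (rule bexI[of _ "if i < j then i else i - 1"], rule exI[of _ 1])
       (use i assms(1) in \<open>auto simp: fun_eq_iff omit_def\<close>)
qed (use assms(1,2) in \<open>auto simp: cspace_def omit_def\<close>)

section \<open>Assembling the identity on the hyperplane\<close>

lemma openin_Collect_conj: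
  assumes "openin T {s \<in> S. P s}" "openin T {s \<in> S. Q s}" shows "openin T {s \<in> S. P s \<and> Q s}"
proof -
  have "{s \<in> S. P s \<and> Q s} = {s \<in> S. P s} \<inter> {s \<in> S. Q s}" by auto
  then show ?thesis using assms by auto
qed

lemma openin_Collect_ball:
  assumes "finite X" "openin T S" "\<And>k. k \<in> X \<Longrightarrow> openin T {s \<in> S. P k s}"
  shows "openin T {s \<in> S. \<forall>k\<in>X. P k s}"
  using assms(1,3)
proof (induction X rule: finite_induct)
  case (insert k X)
  then show ?case using openin_Collect_conj[of T S "P k" "\<lambda>s. \<forall>k\<in>X. P k s"] by simp
qed (use assms(2) in simp)

lemma omit_upd_right: "omit j (s(j + 1 := w)) = (omit j s)(j := w)"
  by (auto simp: omit_def fun_eq_iff)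

lemma omit_upd_left: "1 \<le> j \<Longrightarrow> omit j (s(j - 1 := w)) = (omit j s)(j - 1 := w)"
  by (auto simp: omit_def fun_eq_iff)

text \<open>The bound leaves room for a shift of any coordinate by \<open>n + 1\<close> to the left.\<close>

definition common_box :: "nat \<Rightarrow> nat \<Rightarrow> nat \<Rightarrow> (nat \<Rightarrow> complex) set" where
  "common_box r j n = polybox ({1..r} - {j}) (\<lambda>_. {z. real (2 * n + 4) < Re z})"

lemma omit_common_box:
  assumes j: "j \<in> {2..q}" and s: "s \<in> common_box (Suc q) j n"
    and l: "l \<in> {1..q}" and c: "Re c \<ge> - real (n + 1)"
  shows "(omit j s)(l := omit j s l + c) \<in> mzeta_region q"
proof (rule mzeta_regionI)
  have "omit j s i = 0" if "i \<notin> {1..q}" for i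
    using that j s by (auto simp: omit_def common_box_def polybox_def cspace_def)
  then show "(omit j s)(l := omit j s l + c) \<in> cspace {1..q}"
    using l by (auto simp: cspace_def)
  fix i assume i: "i \<in> {1..q}"
  have "real (2 * n + 4) < Re (omit j s i)"
    using s i j by (auto simp: omit_def common_box_def polybox_def)
  then show "Re (((omit j s)(l := omit j s l + c)) i) > 1"
    using c by auto
qed

text \<open>The only negative contribution to a tail is that of \<open>j\<close>. Because
  \<open>j < Suc q\<close>, such a tail also contains the last index, whose surplus above
  \<open>2 * n + 3\<close> outweighs \<open>- n - 1\<close>.\<close>

lemma fix_common_box:
  assumes j: "j \<in> {2..q}" and s: "s \<in> common_box (Suc q) j n"
  shows "s(j := - of_nat n) \<in> mzeta_region (Suc q)"
  unfolding mzeta_region_def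
proof (intro CollectI conjI ballI)
  show "s(j := - of_nat n) \<in> cspace {1..Suc q}"
    using s j by (auto simp: common_box_def polybox_def cspace_def)
  fix k assume k: "k \<in> {1..Suc q}"
  define x where "x = (\<lambda>i. Re ((s(j := - of_nat n)) i) - 1)"
  have big: "x i > real (2 * n + 3)" if "i \<in> {1..Suc q}" "i \<noteq> j" for i
  proof -
    have "real (2 * n + 4) < Re (s i)" using s that by (simp add: common_box_def polybox_def)
    then show ?thesis using that by (simp add: x_def)
  qed
  have xj: "x j = - real n - 1" by (simp add: x_def)
  have lst: "x (Suc q) > real (2 * n + 3)" using big[of "Suc q"] j by simp
  have "0 < (\<Sum>i=k..Suc q. x i)"
  proof (cases "k \<le> j")
    case True
    have "0 < x j + x (Suc q)" using xj lst by simp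
    also have "\<dots> = (\<Sum>i\<in>{j, Suc q}. x i)" using j by simp
    also have "\<dots> \<le> (\<Sum>i=k..Suc q. x i)"
    proof (rule sum_mono2)
      fix i assume "i \<in> {k..Suc q} - {j, Suc q}"
      then show "0 \<le> x i" using big[of i] k by auto
    qed (use True j in auto)
    finally show ?thesis .
  next
    case False
    show ?thesis
    proof (rule sum_pos)
      fix i assume "i \<in> {k..Suc q}"
      then show "0 < x i" using big[of i] k False by auto
    qed (use k in auto)
  qed
  moreover have "(\<Sum>i=k..Suc q. x i) = Re (\<Sum>i=k..Suc q. (s(j := - of_nat n)) i) - real (Suc q - k + 1)"
    using k by (simp add: x_def sum_subtractf of_nat_diff del: fun_upd_apply sum.cl_ivl_Suc)
  ultimately show "real (Suc q - k + 1) < Re (\<Sum>i=k..Suc q. (s(j := - of_nat n)) i)" by linarith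
qed

theorem theorem2p12:
  fixes r j n :: nat
  assumes "2 \<le> r" and "j \<in> {2..r - 1}"
  shows "mero_identity ({1..r} - {j})
    {s \<in> cspace ({1..r} - {j}).
       mzeta_regular r (s(j := - of_nat n)) \<and>
       mzeta_regular (r - 1) (omit j (s(j + 1 := s (j + 1) - of_nat n))) \<and>
       mzeta_regular (r - 1) (omit j (s(j - 1 := s (j - 1) - of_nat n - 1))) \<and>
       mzeta_regular (r - 1) (omit j (s(j + 1 := s (j + 1) - of_nat n - 1))) \<and>
       (\<forall>k\<in>{0..n}.
          mzeta_regular (r - 1) (omit j (s(j - 1 := s (j - 1) - of_nat n + of_nat k))) \<and>
          mzeta_regular (r - 1) (omit j (s(j + 1 := s (j + 1) - of_nat n + of_nat k))) \<and>
          mzeta_regular 1 (vec1 (- of_nat k)))}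
    (\<lambda>s. mzeta r (s(j := - of_nat n))
       + mzeta (r - 1) (omit j (s(j + 1 := s (j + 1) - of_nat n))))
    (\<lambda>s. - (1 / (of_nat n + 1)) * mzeta (r - 1) (omit j (s(j - 1 := s (j - 1) - of_nat n - 1)))
       + 1 / (of_nat n + 1) * mzeta (r - 1) (omit j (s(j + 1 := s (j + 1) - of_nat n - 1)))
       + (\<Sum>k=0..n. of_nat (n choose k)
            * mzeta (r - 1) (omit j (s(j - 1 := s (j - 1) - of_nat n + of_nat k)))
            * mzeta 1 (vec1 (- of_nat k)))
       - (\<Sum>k=0..n. of_nat (n choose k)
            * mzeta (r - 1) (omit j (s(j + 1 := s (j + 1) - of_nat n + of_nat k)))
            * mzeta 1 (vec1 (- of_nat k))))"
proof -
  obtain q where r: "r = Suc q" and j: "j \<in> {2..q}"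
    using assms by (cases r) auto
  have rq: "r - 1 = q" using r by simp
  have q1: "1 \<le> q" "1 \<le> r" and jr: "j \<in> {1..r}" using j r by auto
  define I where "I = {1..r} - {j}"
  \<comment> \<open>The base point for all genericity arguments: its free coordinates exceed the
    bound \<open>2 * n + 4\<close> of \<open>common_box\<close>.\<close>
  define p :: "nat \<Rightarrow> complex" where "p = (\<lambda>i. if i \<in> I then of_nat (2 * n + 5) else 0)"
  have E: "openin (top_of_set (cspace I)) (common_box r j n)"
    unfolding common_box_def I_def by (intro openin_polybox) (auto simp: open_halfspace_Re_gt)
  have pE: "p \<in> common_box r j n"
    by (auto simp: common_box_def polybox_def p_def I_def cspace_def)
  have pc: "p \<in> cspace I" using pE openin_imp_subset[OF E] by blast
  \<comment> \<open>Omission moves position \<open>j + 1\<close> to \<open>j\<close> and leaves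
    \<open>j - 1\<close> in place; stated for arbitrary \<open>f\<close> so that one rule serves all
    shifts.\<close>
  have omit_eq: "omit j (s(j + 1 := f (s (j + 1)))) = (omit j s)(j := f (omit j s j))"
    "omit j (s(j - 1 := f (s (j - 1)))) = (omit j s)(j - 1 := f (omit j s (j - 1)))"
    for s :: "nat \<Rightarrow> complex" and f
  proof -
    have "omit j s j = s (j + 1)" "omit j s (j - 1) = s (j - 1)" "1 \<le> j"
      using j by (auto simp: omit_def)
    then show "omit j (s(j + 1 := f (s (j + 1)))) = (omit j s)(j := f (omit j s j))"
      "omit j (s(j - 1 := f (s (j - 1)))) = (omit j s)(j - 1 := f (omit j s (j - 1)))"
      by (simp_all only: omit_upd_right omit_upd_left)
  qed
  note C0 = coord_map_fix[OF jr, of "- of_nat n", folded I_def]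
  have reg0: "s(j := - of_nat n) \<in> mzeta_region r" if "s \<in> common_box r j n" for s
    using fix_common_box[OF j] that unfolding r by blast
  have jq: "j \<in> {1..q}" "j - 1 \<in> {1..q}" using j by auto
  have regR: "omit j (s(j + 1 := f (s (j + 1)))) \<in> mzeta_region q"
    if "s \<in> common_box r j n" "\<And>z. f z = z + c" "Re c \<ge> - real (n + 1)" for s f c
    unfolding omit_eq(1)[of s f] unfolding that(2)
    by (rule omit_common_box[OF j that(1)[unfolded r] jq(1) that(3)])
  have regL: "omit j (s(j - 1 := f (s (j - 1)))) \<in> mzeta_region q"
    if "s \<in> common_box r j n" "\<And>z. f z = z + c" "Re c \<ge> - real (n + 1)" for s f c
    unfolding omit_eq(2)[of s f] unfolding that(2)
    by (rule omit_common_box[OF j that(1)[unfolded r] jq(2) that(3)])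
  have "j + 1 \<in> {1..Suc q} - {j}" "j - 1 \<in> {1..Suc q} - {j}" using j by auto
  note co = coord_map_omit[OF jq(1) this(1), folded r, folded I_def] coord_map_omit[OF jq(1) this(2), folded r, folded I_def]
  note M0 = mzeta_coord_map[OF q1(2) C0 pc reg0[OF pE]]
  have NR: "generic I p (\<lambda>s. mzeta_regular q (omit j (s(j + 1 := f (s (j + 1))))))"
    "quotient_at I p (\<lambda>s. mzeta q (omit j (s(j + 1 := f (s (j + 1))))))"
    "openin (top_of_set (cspace I)) {s \<in> cspace I. mzeta_regular q (omit j (s(j + 1 := f (s (j + 1)))))}"
    "holo_several I {s \<in> cspace I. mzeta_regular q (omit j (s(j + 1 := f (s (j + 1)))))} (\<lambda>s. mzeta q (omit j (s(j + 1 := f (s (j + 1))))))"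
    if "\<And>z. f z = z + c" "Re c \<ge> - real (n + 1)" for f c
    by (rule mzeta_coord_map[OF q1(1) co(1)[OF that(1)] pc regR[OF pE that]])+
  have NL: "generic I p (\<lambda>s. mzeta_regular q (omit j (s(j - 1 := f (s (j - 1))))))"
    "quotient_at I p (\<lambda>s. mzeta q (omit j (s(j - 1 := f (s (j - 1))))))"
    "openin (top_of_set (cspace I)) {s \<in> cspace I. mzeta_regular q (omit j (s(j - 1 := f (s (j - 1)))))}"
    "holo_several I {s \<in> cspace I. mzeta_regular q (omit j (s(j - 1 := f (s (j - 1)))))} (\<lambda>s. mzeta q (omit j (s(j - 1 := f (s (j - 1))))))"
    if "\<And>z. f z = z + c" "Re c \<ge> - real (n + 1)" for f c
    by (rule mzeta_coord_map[OF q1(1) co(2)[OF that(1)] pc regL[OF pE that]])+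
  have f1: "z - of_nat n = z + - of_nat n" "- real (n + 1) \<le> Re (- of_nat n)" for z :: complex
    by simp_all
  have f2: "z - of_nat n - 1 = z + (- of_nat n - 1)" "- real (n + 1) \<le> Re (- of_nat n - 1)" for z :: complex
    by simp_all
  have f3: "z - of_nat n + of_nat k = z + (- of_nat n + of_nat k)" "- real (n + 1) \<le> Re (- of_nat n + of_nat k)"
    for z :: complex and k by simp_all
  note R1 = NR[where f = "\<lambda>z. z - of_nat n", OF f1]
  note R2 = NR[where f = "\<lambda>z. z - of_nat n - 1", OF f2]
  note R3 = NR[where f = "\<lambda>z. z - of_nat n + of_nat k" for k, OF f3]
  note L2 = NL[where f = "\<lambda>z. z - of_nat n - 1", OF f2]
  note L3 = NL[where f = "\<lambda>z. z - of_nat n + of_nat k" for k, OF f3]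
  define D where "D = {s \<in> cspace I.
       mzeta_regular r (s(j := - of_nat n)) \<and>
       mzeta_regular q (omit j (s(j + 1 := s (j + 1) - of_nat n))) \<and>
       mzeta_regular q (omit j (s(j - 1 := s (j - 1) - of_nat n - 1))) \<and>
       mzeta_regular q (omit j (s(j + 1 := s (j + 1) - of_nat n - 1))) \<and>
       (\<forall>k\<in>{0..n}.
          mzeta_regular q (omit j (s(j - 1 := s (j - 1) - of_nat n + of_nat k))) \<and>
          mzeta_regular q (omit j (s(j + 1 := s (j + 1) - of_nat n + of_nat k))) \<and>
          mzeta_regular 1 (vec1 (- of_nat k)))}"
  \<comment> \<open>This condition does not involve \<open>s\<close>: zeta is regular at every
    nonpositive integer, so the set is the whole space.\<close>
  have reg1: "openin (top_of_set (cspace I)) {s \<in> cspace I. mzeta_regular 1 (vec1 (- of_nat k))}" for k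
    using mzeta_regular_minus_nat[of k] by simp
  have oD: "openin (top_of_set (cspace I)) D"
    unfolding D_def
    by (intro openin_Collect_conj openin_Collect_ball M0(3) R1(3) R2(3) R3(3) L2(3) L3(3) reg1
          openin_cspace finite_atLeastAtMost)
  have gD: "generic I p (\<lambda>s. s \<in> D)"
  proof -
    have "generic I p (\<lambda>s. mzeta_regular r (s(j := - of_nat n)) \<and>
       mzeta_regular q (omit j (s(j + 1 := s (j + 1) - of_nat n))) \<and>
       mzeta_regular q (omit j (s(j - 1 := s (j - 1) - of_nat n - 1))) \<and>
       mzeta_regular q (omit j (s(j + 1 := s (j + 1) - of_nat n - 1))) \<and>
       (\<forall>k\<in>{0..n}.
          mzeta_regular q (omit j (s(j - 1 := s (j - 1) - of_nat n + of_nat k))) \<and>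
          mzeta_regular q (omit j (s(j + 1 := s (j + 1) - of_nat n + of_nat k))) \<and>
          mzeta_regular 1 (vec1 (- of_nat k))))"
      by (intro generic_conj generic_ball M0(1) R1(1) R2(1) R3(1) L2(1) L3(1) finite_atLeastAtMost
            generic_True mzeta_regular_minus_nat)
    then show ?thesis unfolding generic_def D_def by simp
  qed
  have hD: "holo_several I D f" if "holo_several I U f" "D \<subseteq> U" for f U
    by (rule holo_several_subset[OF that(1) oD that(2)])
  define F where "F = (\<lambda>s. mzeta r (s(j := - of_nat n))
       + mzeta q (omit j (s(j + 1 := s (j + 1) - of_nat n))))"
  define G where "G = (\<lambda>s. - (1 / (of_nat n + 1)) * mzeta q (omit j (s(j - 1 := s (j - 1) - of_nat n - 1)))
       + 1 / (of_nat n + 1) * mzeta q (omit j (s(j + 1 := s (j + 1) - of_nat n - 1)))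
       + (\<Sum>k=0..n. of_nat (n choose k)
            * mzeta q (omit j (s(j - 1 := s (j - 1) - of_nat n + of_nat k)))
            * mzeta 1 (vec1 (- of_nat k)))
       - (\<Sum>k=0..n. of_nat (n choose k)
            * mzeta q (omit j (s(j + 1 := s (j + 1) - of_nat n + of_nat k)))
            * mzeta 1 (vec1 (- of_nat k))))"
  have "mero_identity I D F G"
  proof (rule mero_identityI[OF _ pc _ _ E pE _ oD gD])
    show "finite I" by (simp add: I_def)
    show "quotient_at I p F"
      unfolding F_def by (intro quotient_at_add M0(2) R1(2))
    show "quotient_at I p G"
      unfolding G_def
      by (intro quotient_at_diff quotient_at_add quotient_at_mult quotient_at_sum quotient_at_const
            R2(2) R3(2) L2(2) L3(2))
    show "holo_several I D F"
      unfolding F_def by (intro holo_several_add hD[OF M0(4)] hD[OF R1(4)]) (auto simp: D_def simp del: fun_upd_apply)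
    show "holo_several I D G"
      unfolding G_def
      by (intro holo_several_diff holo_several_add holo_several_mult holo_several_sum holo_several_const
            oD hD[OF R2(4)] hD[OF R3(4)] hD[OF L2(4)] hD[OF L3(4)]) (auto simp: D_def simp del: fun_upd_apply)
    fix s assume s: "s \<in> common_box r j n"
    define t where "t = omit j s"
    have ser: "mzeta q (t(l := t l + c)) = mzeta_series q (t(l := t l + c))"
      if "l \<in> {1..q}" "Re c \<ge> - real (n + 1)" for l c
      using mzeta_eq_series[OF q1(1) omit_common_box[OF j s[unfolded r] that]] by (simp only: t_def)
    have reg: "t(l := t l - of_nat m) \<in> mzeta_region q" if "m \<le> n + 1" "l \<in> {1..q}" for m l
      using omit_common_box[OF j s[unfolded r] that(2), of "- of_nat m"] that(1) by (simp add: t_def del: fun_upd_apply)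
    have eqs: "mzeta q (t(l := t l - of_nat m)) = mzeta_series q (t(l := t l - of_nat m))"
      if "m \<le> n + 1" "l \<in> {1..q}" for m l
      by (rule mzeta_eq_series[OF q1(1) reg[OF that]])
    \<comment> \<open>All shifts are rewritten as subtraction of a natural number at most
      \<open>n + 1\<close>, the form used in the series identity.\<close>
    have z1: "z - of_nat n - 1 = z - (of_nat (n + 1) :: complex)" for z by simp
    have z2: "z - of_nat n + of_nat k = z - (of_nat (n - k) :: complex)" if "k \<in> {0..n}" for z k
      using that by (simp add: of_nat_diff)
    have sumeq: "(\<Sum>k=0..n. of_nat (n choose k) * mzeta q (t(l := t l - of_nat n + of_nat k)) * mzeta 1 (vec1 (- of_nat k))) =
        (\<Sum>k=0..n. of_nat (n choose k) * mzeta_series q (t(l := t l - of_nat (n - k))) * mzeta 1 (vec1 (- of_nat k)))"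
      if "l \<in> {1..q}" for l
    proof (rule sum.cong[OF refl])
      fix k assume k: "k \<in> {0..n}"
      show "of_nat (n choose k) * mzeta q (t(l := t l - of_nat n + of_nat k)) * mzeta 1 (vec1 (- of_nat k)) =
        of_nat (n choose k) * mzeta_series q (t(l := t l - of_nat (n - k))) * mzeta 1 (vec1 (- of_nat k))"
        unfolding z2[OF k] by (subst eqs) (use that in auto)
    qed
    have "F s = mzeta_series (Suc q) (s(j := - of_nat n)) + mzeta_series q (t(j := t j - of_nat n))"
      unfolding F_def omit_eq[of s "\<lambda>z. z - of_nat n"] t_def[symmetric]
      using mzeta_eq_series[OF q1(2) reg0[OF s]] eqs[of n j] jq by (simp only: r le_add1)
    also have "\<dots> = - (1 / (of_nat n + 1)) * mzeta_series q (t(j - 1 := t (j - 1) - of_nat (n + 1)))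
      + 1 / (of_nat n + 1) * mzeta_series q (t(j := t j - of_nat (n + 1)))
      + (\<Sum>k=0..n. of_nat (n choose k) * mzeta_series q (t(j - 1 := t (j - 1) - of_nat (n - k)))
          * mzeta 1 (vec1 (- of_nat k)))
      - (\<Sum>k=0..n. of_nat (n choose k) * mzeta_series q (t(j := t j - of_nat (n - k)))
          * mzeta 1 (vec1 (- of_nat k)))"
      by (rule mzeta_series_identity[OF j reg0[OF s, unfolded r] t_def reg reg]) (use jq in auto)
    also have "\<dots> = G s"
      unfolding G_def z1 omit_eq[of s "\<lambda>z. z - of_nat (n + 1)"] omit_eq[of s "\<lambda>z. z - of_nat n + of_nat _"]
        t_def[symmetric] sumeq[OF jq(1)] sumeq[OF jq(2)]
      by (simp only: eqs[OF order_refl jq(1)] eqs[OF order_refl jq(2)])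
    finally show "F s = G s" .
  qed
  then show ?thesis
    unfolding D_def F_def G_def I_def rq .
qed

end
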